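(* Let $m,N$ be positive integers and $\kappa\in\mathbb{C}$. Let $V$ be any $\widehat{\mathfrak{sl}}_m$-module such that for every vector of $V$ there is a degree $i$ such that the subspace $t^{\,i}\,\mathfrak{sl}_m[t]\subset\widehat{\mathfrak{sl}}_m$ annihilates that vector. Let $$W=\mathbb{C}[x_1,x_1^{-1},\ldots,x_N,x_N^{-1}]\otimes(\mathbb{C}^m)^{\otimes N}\otimes V .$$ (i) An action of the trigonometric Cherednik algebra $\mathfrak{C}_N$ (with parameter $\kappa$) on the vector space $W$ can be defined as follows: the elements $x_p,x_p^{-1}\in\mathfrak{C}_N$ act via multiplication in $\mathbb{C}[x_1,x_1^{-1},\ldots,x_N,x_N^{-1}]$, the group $\mathfrak{S}_N$ acts by simultaneous permutations of the variables $x_1,\ldots,x_N$ and of the $N$ tensor factors $\mathbb{C}^m$, and the element $z_p$ acts, for $p=1,\ldots,N$, as the operator $$\kappa\,x_p\,\partial_p\otimes\mathrm{id}^{\otimes N}\otimes\mathrm{id}+\sum_{r\neq p}\frac{x_p}{x_p-x_r}(1-\sigma_{pr})\otimes\sigma_{pr}\otimes\mathrm{id}+\sum_{i=0}^\infty x_p^{-i}\otimes\Bigl(\sum_{a,b=1}^m E_{ab}^{(p)}\otimes E_{ba}\,t^{\,i}-\frac1m\,\mathrm{id}^{\otimes N}\otimes I\,t^{\,i}\Bigr),$$ where $I=E_{11}+\ldots+E_{mm}$. (ii) This action of $\mathfrak{C}_N$ on $W$ commutes with the action of the Lie subalgebra $\mathfrak{sl}_m\subset\widehat{\mathfrak{sl}}_m$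 on $W$. (iii) If $V$ has level $\kappa-m$ (that is, the central element $C\in\widehat{\mathfrak{sl}}_m$ acts on $V$ as the scalar $\kappa-m$), then the action of $\mathfrak{C}_N$ preserves the subspace $\mathfrak{q}\,W\subset W$, where $\mathfrak{q}=t^{-1}\,\mathfrak{sl}_m[t^{-1}]\subset\widehat{\mathfrak{sl}}_m$.
   Context: All algebras and vector spaces are over $\mathbb{C}$. $\mathfrak{S}_N$ is the symmetric group and $\sigma_{pq}$ denotes the transposition of $p$ and $q$. $E_{ab}$ are the standard matrix units, and $E_{ab}^{(p)}$ is the operator on $(\mathbb{C}^m)^{\otimes N}$ acting as $E_{ab}$ in the $p$-th tensor factor and as the identity in the others. Trigonometric Cherednik algebra: $\mathfrak{C}_N$ (depending on $\kappa$) is the associative algebra generated by the Laurent polynomial ring $\mathbb{C}[x_1,x_1^{-1},\ldots,x_N,x_N^{-1}]$, the group algebra $\mathbb{C}\mathfrak{S}_N$ and elements $z_1,\ldots,z_N$ subject to the relations $\sigma x_p\sigma^{-1}=x_{\sigma(p)}$ and $\sigma z_p\sigma^{-1}=z_{\sigma(p)}$ for $\sigma\in\mathfrak{S}_N$; $[z_p,z_q]=\sigma_{pq}(z_p-z_q)$ for $p\ne q$; $[z_p,x_q]=-x_p\sigma_{pq}$ for $q\neq p$; and $[z_p,x_p]=\kappa x_p+\sum_{r\neq p}x_p\sigma_{pr}$. Affine Lie algebras: $\widehat{\mathfrak{gl}}_m$ is the central extension of $\mathfrak{gl}_m[t,t^{-1}]$ by the one-dimensional space $\mathbb{C}C$,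 with $C$ central and $$[E_{ab}t^{\,i},E_{cd}t^{\,j}]=(\delta_{bc}E_{ad}-\delta_{ad}E_{cb})\,t^{\,i+j}+i\,\delta_{i,-j}\,\delta_{ad}\,\delta_{bc}\,C .$$ $\widehat{\mathfrak{sl}}_m$ is the subalgebra spanned by $\mathfrak{sl}_m[t,t^{-1}]$ and $C$. The subspaces $\mathfrak{sl}_m$ (degree zero in $t$) and $\mathfrak{q}=t^{-1}\mathfrak{sl}_m[t^{-1}]$ are Lie subalgebras of $\widehat{\mathfrak{sl}}_m$. The space $\mathbb{C}[x_1^{\pm1},\ldots,x_N^{\pm1}]\otimes(\mathbb{C}^m)^{\otimes N}$ is identified with $\mathbb{C}^m[t,t^{-1}]^{\otimes N}$, an $\widehat{\mathfrak{sl}}_m$-module on which $C$ acts as zero, and $W$ is the tensor product $\widehat{\mathfrak{sl}}_m$-module with $V$: $P\,t^{\,j}$ with $P\in\mathfrak{sl}_m$ acts on $W$ as $\sum_{q=1}^N x_q^{\,j}\otimes P^{(q)}\otimes\mathrm{id}+\mathrm{id}\otimes\mathrm{id}^{\otimes N}\otimes P\,t^{\,j}$, where $P^{(q)}$ is $P$ acting in the $q$-th factor $\mathbb{C}^m$. $\mathfrak{q}W$ is the span of all $Pw$ with $P\in\mathfrak{q}$, $w\in W$. In the operator in (i): $\partial_p=\partial/\partial x_p$; in the middle summands the left $\sigma_{pr}$ permutes the variables $x_p,x_r$ in Laurent polynomials and the right $\sigma_{pr}$ permutes the $p$-th and $r$-th tensor factors $\mathbb{C}^m$. The expression in the large parentheses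 uses only the $\widehat{\mathfrak{sl}}_m$-module structure of $V$: since $\sum_a E_{aa}^{(p)}=\mathrm{id}^{\otimes N}$, it means $\sum_{a,b}E_{ab}^{(p)}\otimes(E_{ba}-\tfrac1m\delta_{ab}I)\,t^{\,i}$ with $E_{ba}-\tfrac1m\delta_{ab}I\in\mathfrak{sl}_m$. The infinite sum is well defined on $W$ because of the annihilation condition on $V$. *)

theory Defs
  imports
    "HOL-Analysis.Analysis"
    "HOL-Library.Poly_Mapping"
    "HOL-Combinatorics.Perm"
    "HOL-Algebra.QuotRing"
    "HOL-Algebra.Algebraic_Closure_Type"
begin

unbundle no fps_syntax

text \<open>
  The tensor positions and variables are indexed by a finite type \<^typ>\<open>'n\<close> with \<open>N = CARD('n)\<close>,
  the standard basis of \<open>\<complex>\<^sup>m\<close> by a finite type \<^typ>\<open>'m\<close> with \<open>m = CARD('m)\<close>.  The symmetric group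
  is \<^typ>\<open>'n perm\<close>, and \<open>Perm.swap p q\<close> is the transposition \<open>\<sigma>\<^bsub>pq\<^esub>\<close>.
\<close>

section \<open>Laurent polynomials\<close>

text \<open>
  The Laurent polynomial ring is the group algebra of the lattice of exponents
  \<open>'n \<Rightarrow>\<^sub>0 int\<close>, with the convolution product of \<^theory>\<open>HOL-Library.Poly_Mapping\<close>.
\<close>

type_synonym 'n laurent = "('n \<Rightarrow>\<^sub>0 int) \<Rightarrow>\<^sub>0 complex"

definition laurent_scale :: "complex \<Rightarrow> 'n laurent \<Rightarrow> 'n laurent" where
  "laurent_scale c f = Poly_Mapping.map ((*) c) f"

definition xpow :: "'n \<Rightarrow> int \<Rightarrow> 'n laurent" where
  "xpow p j = Poly_Mapping.single (Poly_Mapping.single p j) 1"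

definition laurent_partial :: "'n \<Rightarrow> 'n laurent \<Rightarrow> 'n laurent" where
  "laurent_partial p f =
     (\<Sum>\<alpha>\<in>Poly_Mapping.keys f.
        Poly_Mapping.single (\<alpha> - Poly_Mapping.single p 1)
          (of_int (Poly_Mapping.lookup \<alpha> p) * Poly_Mapping.lookup f \<alpha>))"

text \<open>\<open>\<sigma>\<close> sends \<open>x\<^sub>p\<close> to \<open>x\<^bsub>\<sigma>(p)\<^esub>\<close>, so it moves the exponent at \<open>p\<close> to position \<open>\<sigma>(p)\<close>.\<close>

definition perm_exponent :: "'n perm \<Rightarrow> ('n \<Rightarrow>\<^sub>0 int) \<Rightarrow> ('n \<Rightarrow>\<^sub>0 int)" where
  "perm_exponent \<sigma> \<alpha> = Poly_Mapping.map_key (Perm.apply (inverse \<sigma>)) \<alpha>"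

definition perm_laurent :: "'n perm \<Rightarrow> 'n laurent \<Rightarrow> 'n laurent" where
  "perm_laurent \<sigma> f =
     (\<Sum>\<alpha>\<in>Poly_Mapping.keys f.
        Poly_Mapping.single (perm_exponent \<sigma> \<alpha>) (Poly_Mapping.lookup f \<alpha>))"

text \<open>
  \<open>(f - \<sigma>\<^bsub>pr\<^esub> f) / (x\<^sub>p - x\<^sub>r)\<close> as an element of the Laurent polynomial ring;
  lemma \<open>divided_difference_ex1\<close> below shows that it exists and is unique for \<open>p \<noteq> r\<close>.
\<close>

definition divided_difference :: "'n \<Rightarrow> 'n \<Rightarrow> 'n laurent \<Rightarrow> 'n laurent" where
  "divided_difference p r f =
     (THE g. (xpow p 1 - xpow r 1) * g = f - perm_laurent (Perm.swap p r) f)"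


lemma lookup_single_times_add:
  fixes g :: "'k::ab_group_add \<Rightarrow>\<^sub>0 complex"
  shows "Poly_Mapping.lookup (Poly_Mapping.single a c * g) \<beta> = c * Poly_Mapping.lookup g (\<beta> - a)"
proof -
  have *: "\<beta> = a + q \<longleftrightarrow> q = \<beta> - a" for q by (auto simp: algebra_simps)
  have "Poly_Mapping.lookup (Poly_Mapping.single a c * g) \<beta> =
     (\<Sum>l. (c when a = l) * (\<Sum>q. Poly_Mapping.lookup g q when \<beta> = l + q))"
    by (simp add: times_poly_mapping.rep_eq prod_fun_def lookup_single)
  also have "\<dots> = (\<Sum>l. (c * (\<Sum>q. Poly_Mapping.lookup g q when \<beta> = l + q)) when l = a)"
    by (rule Sum_any.cong) (simp add: when_def)
  finally show ?thesis by (simp add: *)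
qed

lemma xpow_diff_cancel:
  fixes g :: "'n laurent"
  assumes "p \<noteq> r" "(xpow p 1 - xpow r 1) * g = 0"
  shows "g = 0"
proof (rule ccontr)
  assume "g \<noteq> 0"
  then obtain \<beta> where \<beta>: "Poly_Mapping.lookup g \<beta> \<noteq> 0"
    by (metis Poly_Mapping.lookup_zero poly_mapping_eqI)
  define \<delta> :: "'n \<Rightarrow>\<^sub>0 int" where "\<delta> = Poly_Mapping.single p 1 - Poly_Mapping.single r 1"
  have shift: "Poly_Mapping.lookup g \<gamma> = Poly_Mapping.lookup g (\<gamma> + \<delta>)" for \<gamma>
  proof -
    have "Poly_Mapping.lookup ((xpow p 1 - xpow r 1) * g) (\<gamma> + Poly_Mapping.single p 1) = 0"
      using assms(2) by simp
    then show ?thesis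
      by (simp add: left_diff_distrib lookup_minus xpow_def lookup_single_times_add \<delta>_def
          add_diff_eq)
  qed
  define s where "s k = \<beta> + Poly_Mapping.map ((*) (int k)) \<delta>" for k
  have lk: "Poly_Mapping.lookup (s k) p = Poly_Mapping.lookup \<beta> p + int k" for k
    using assms(1) by (simp add: s_def lookup_add \<delta>_def Poly_Mapping.map.rep_eq lookup_minus
        lookup_single when_def)
  have "s (Suc k) = s k + \<delta>" for k
    by (rule poly_mapping_eqI)
      (simp add: s_def lookup_add Poly_Mapping.map.rep_eq when_def algebra_simps)
  then have "Poly_Mapping.lookup g (s k) \<noteq> 0" for k
  proof (induction k)
    case 0
    have "s 0 = \<beta>" by (rule poly_mapping_eqI) (simp add: s_def lookup_add Poly_Mapping.map.rep_eq when_def)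
    then show ?case using \<beta> by simp
  next
    case (Suc k)
    then show ?case using shift by metis
  qed
  then have "range s \<subseteq> Poly_Mapping.keys g" by (auto simp: in_keys_iff)
  then have "finite (range s)" using finite_keys finite_subset by blast
  moreover have "inj s"
    by (rule injI) (metis lk add_left_cancel of_nat_eq_iff)
  ultimately show False using finite_imageD by blast
qed

lemma perm_exponent_swap:
  "Poly_Mapping.lookup (perm_exponent \<sigma> \<alpha>) q = Poly_Mapping.lookup \<alpha> (Perm.apply (inverse \<sigma>) q)"
proof -
  have "inj (Perm.apply (inverse \<sigma>))" by (rule injI) (simp add: Perm.apply_inj)
  then show ?thesis by (simp add: perm_exponent_def map_key.rep_eq)
qed

lemma xpow_power: "xpow p 1 ^ k = xpow p (int k)"
  by (induction k) (simp_all add: xpow_def mult_single single_add[symmetric] add.commute flip: single_one)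

lemma divided_difference_exists:
  fixes f :: "'n laurent"
  assumes "p \<noteq> r"
  shows "(xpow p 1 - xpow r 1) dvd (f - perm_laurent (Perm.swap p r) f)"
proof -
  have key: "(xpow p 1 - xpow r 1) dvd
     (Poly_Mapping.single \<alpha> c - Poly_Mapping.single (perm_exponent (Perm.swap p r) \<alpha>) c)" for \<alpha> and c :: complex
  proof -
    define a b where "a = Poly_Mapping.lookup \<alpha> p" and "b = Poly_Mapping.lookup \<alpha> r"
    define m where "m = min a b"
    define \<gamma> where "\<gamma> = \<alpha> - Poly_Mapping.single p (a - m) - Poly_Mapping.single r (b - m)"
    have l\<gamma>: "Poly_Mapping.lookup \<gamma> q = (if q = p then m else if q = r then m else Poly_Mapping.lookup \<alpha> q)" for q
      using assms by (auto simp: \<gamma>_def lookup_minus lookup_single when_def a_def b_def)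
    have e1: "\<alpha> = \<gamma> + Poly_Mapping.single p (a - m) + Poly_Mapping.single r (b - m)"
      by (simp add: \<gamma>_def)
    have e2: "perm_exponent (Perm.swap p r) \<alpha> =
        \<gamma> + Poly_Mapping.single p (b - m) + Poly_Mapping.single r (a - m)"
    proof (rule poly_mapping_eqI)
      fix q
      show "Poly_Mapping.lookup (perm_exponent (Perm.swap p r) \<alpha>) q =
        Poly_Mapping.lookup (\<gamma> + Poly_Mapping.single p (b - m) + Poly_Mapping.single r (a - m)) q"
        using assms
        by (cases "q = p"; cases "q = r")
          (auto simp: perm_exponent_swap lookup_add lookup_single when_def l\<gamma> a_def b_def)
    qed
    have *: "Poly_Mapping.single (\<gamma> + Poly_Mapping.single p i + Poly_Mapping.single r j) c =
        Poly_Mapping.single \<gamma> c * (xpow p i * xpow r j)" for i j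
      by (simp add: xpow_def mult_single add.assoc)
    have "(xpow p 1 - xpow r 1) dvd (xpow p (a - m) * xpow r (b - m) - xpow p (b - m) * xpow r (a - m))"
    proof (cases "a \<le> b")
      case True
      then obtain k where "a - m = 0" and "b - m = int k"
        by (metis m_def min.absorb1 diff_self zle_iff_zadd add_diff_cancel_left')
      moreover have "(xpow p 1 - xpow r 1 :: 'n laurent) dvd xpow r 1 ^ k - xpow p 1 ^ k" for k
        by (metis dvd_minus_iff minus_diff_eq dvd_triv_left power_diff_sumr2)
      moreover have "xpow q 0 = (1 :: 'n laurent)" for q by (simp add: xpow_def)
      ultimately show ?thesis by (simp add: xpow_power)
    next
      case False
      then obtain k where "b - m = 0" and "a - m = int k"
        by (metis m_def min.absorb2 diff_self zle_iff_zadd add_diff_cancel_left' linear)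
      moreover have "(xpow p 1 - xpow r 1 :: 'n laurent) dvd xpow p 1 ^ k - xpow r 1 ^ k" for k
        by (metis dvd_triv_left power_diff_sumr2)
      moreover have "xpow q 0 = (1 :: 'n laurent)" for q by (simp add: xpow_def)
      ultimately show ?thesis by (simp add: xpow_power)
    qed
    then show ?thesis
      unfolding e2 by (subst e1) (simp only: * right_diff_distrib[symmetric] dvd_mult)
  qed
  have "f = (\<Sum>\<alpha>\<in>Poly_Mapping.keys f. Poly_Mapping.single \<alpha> (Poly_Mapping.lookup f \<alpha>))"
    by (rule poly_mapping_eqI)
      (simp add: lookup_sum lookup_single when_def sum.delta in_keys_iff)
  then have "f - perm_laurent (Perm.swap p r) f =
     (\<Sum>\<alpha>\<in>Poly_Mapping.keys f. Poly_Mapping.single \<alpha> (Poly_Mapping.lookup f \<alpha>)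
        - Poly_Mapping.single (perm_exponent (Perm.swap p r) \<alpha>) (Poly_Mapping.lookup f \<alpha>))"
    by (simp add: perm_laurent_def sum_subtractf)
  then show ?thesis using key by (simp add: dvd_sum)
qed

lemma divided_difference_ex1:
  fixes f :: "'n laurent"
  assumes "p \<noteq> r"
  shows "\<exists>!g. (xpow p 1 - xpow r 1) * g = f - perm_laurent (Perm.swap p r) f"
proof -
  obtain g where "(xpow p 1 - xpow r 1) * g = f - perm_laurent (Perm.swap p r) f"
    using divided_difference_exists[OF assms, of f] by (metis dvdE)
  moreover have "g = h" if "(xpow p 1 - xpow r 1) * g = (xpow p 1 - xpow r 1) * h"
    for g h :: "'n laurent"
    using xpow_diff_cancel[OF assms, of "g - h"] that by (simp add: right_diff_distrib)
  ultimately show ?thesis by metis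
qed


section \<open>The tensor power of \<open>\<complex>\<^sup>m\<close>\<close>

text \<open>
  An element of \<open>(\<complex>\<^sup>m)\<^bsup>\<otimes>N\<^esup>\<close> is given by its coordinates in the basis
  \<open>e\<^bsub>g(1)\<^esub> \<otimes> \<dots> \<otimes> e\<^bsub>g(N)\<^esub>\<close>, \<open>g :: 'n \<Rightarrow> 'm\<close>.
\<close>

type_synonym ('n, 'm) tpower = "complex ^ ('n \<Rightarrow> 'm)"

definition tpower_pure :: "('n::finite \<Rightarrow> complex ^ 'm::finite) \<Rightarrow> ('n, 'm) tpower" where
  "tpower_pure u = (\<chi> g. \<Prod>p\<in>UNIV. u p $ g p)"

definition perm_tensor :: "'n::finite perm \<Rightarrow> ('n, 'm::finite) tpower \<Rightarrow> ('n, 'm) tpower" where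
  "perm_tensor \<sigma> u = (\<chi> g. u $ (g \<circ> Perm.apply \<sigma>))"

definition factor_op ::
  "'n::finite \<Rightarrow> complex ^ 'm ^ 'm::finite \<Rightarrow> ('n, 'm) tpower \<Rightarrow> ('n, 'm) tpower" where
  "factor_op q P u = (\<chi> g. \<Sum>b\<in>UNIV. P $ g q $ b * u $ (g(q := b)))"

definition matrix_unit :: "'m::finite \<Rightarrow> 'm \<Rightarrow> complex ^ 'm ^ 'm" where
  "matrix_unit a b = (\<chi> i j. if i = a \<and> j = b then 1 else 0)"

lemma factor_op_tpower_pure:
  "factor_op q P (tpower_pure u) = tpower_pure (u(q := P *v u q))"
proof -
  have "(\<Prod>p\<in>UNIV. u p $ (g(q := b)) p) = u q $ b * (\<Prod>p\<in>UNIV - {q}. u p $ g p)" for g b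
    by (subst prod.remove[of UNIV q]) auto
  moreover have "(\<Prod>p\<in>UNIV. (u(q := P *v u q)) p $ g p) =
      (P *v u q) $ g q * (\<Prod>p\<in>UNIV - {q}. u p $ g p)" for g
    by (subst prod.remove[of UNIV q]) auto
  ultimately show ?thesis
    unfolding factor_op_def tpower_pure_def vec_eq_iff vec_lambda_beta
    by (simp only: matrix_vector_mult_def vec_lambda_beta sum_distrib_right mult.assoc simp_thms)
qed

lemma perm_tensor_tpower_pure:
  "perm_tensor \<sigma> (tpower_pure u) = tpower_pure (u \<circ> Perm.apply (inverse \<sigma>))"
proof -
  have "(\<Prod>p\<in>UNIV. u p $ g (Perm.apply \<sigma> p)) =
      (\<Prod>p\<in>UNIV. u (Perm.apply (inverse \<sigma>) p) $ g p)" for g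
    by (rule prod.reindex_bij_witness[where i = "Perm.apply (inverse \<sigma>)" and j = "Perm.apply \<sigma>"])
      (simp_all add: Perm.apply_sequence)
  then show ?thesis
    by (simp add: perm_tensor_def tpower_pure_def vec_eq_iff)
qed


section \<open>Affine Lie algebras\<close>

text \<open>
  An element of \<open>\<g>\<l>\<^sub>m[t,t\<^sup>-\<^sup>1] \<oplus> \<complex> C\<close> is a pair of a matrix-valued Laurent polynomial in \<open>t\<close>
  and the coefficient of \<open>C\<close>.
\<close>

type_synonym 'm affine_gl = "(int \<Rightarrow>\<^sub>0 complex ^ 'm ^ 'm) \<times> complex"

definition affine_scale :: "complex \<Rightarrow> 'm::finite affine_gl \<Rightarrow> 'm affine_gl" where
  "affine_scale c \<xi> = (Poly_Mapping.map (map_matrix ((*) c)) (fst \<xi>), c * snd \<xi>)"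

definition loop :: "complex ^ 'm ^ 'm::finite \<Rightarrow> int \<Rightarrow> 'm affine_gl" where
  "loop A i = (Poly_Mapping.single i A, 0)"

definition central :: "'m::finite affine_gl" where
  "central = (0, 1)"

definition affine_bracket :: "'m::finite affine_gl \<Rightarrow> 'm affine_gl \<Rightarrow> 'm affine_gl" where
  "affine_bracket \<xi> \<eta> =
     (\<Sum>i\<in>Poly_Mapping.keys (fst \<xi>). \<Sum>j\<in>Poly_Mapping.keys (fst \<eta>).
        let A = Poly_Mapping.lookup (fst \<xi>) i; B = Poly_Mapping.lookup (fst \<eta>) j
        in loop (A ** B - B ** A) (i + j)
           + affine_scale (if i = - j then of_int i * trace (A ** B) else 0) central)"

lemma matrix_unit_mult:
  "matrix_unit a b ** matrix_unit c d = (if b = c then matrix_unit a d else 0)"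
  unfolding matrix_unit_def matrix_matrix_mult_def vec_eq_iff
  by (auto simp: if_distrib[of "\<lambda>x. x * _"] sum.delta cong: if_cong)

lemma trace_matrix_unit: "trace (matrix_unit a b) = (if a = b then 1 else 0)"
proof -
  have "trace (matrix_unit a b) = (\<Sum>i\<in>UNIV. if i = a then (if a = b then 1 else 0) else 0)"
    unfolding trace_def matrix_unit_def by (rule sum.cong) auto
  then show ?thesis by (simp add: sum.delta)
qed

lemma matrix_unit_nonzero: "matrix_unit a b \<noteq> 0"
proof
  assume "matrix_unit a b = 0"
  then have "matrix_unit a b $ a $ b = 0" by simp
  then show False by (simp add: matrix_unit_def)
qed

text \<open>The defining formula of the bracket on the generators \<open>E\<^bsub>ab\<^esub> t\<^sup>i\<close>.\<close>

lemma affine_bracket_matrix_unit: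
  fixes a b c d :: "'m::finite"
  shows "affine_bracket (loop (matrix_unit a b) i) (loop (matrix_unit c d) j) =
     loop ((if b = c then matrix_unit a d else 0) - (if a = d then matrix_unit c b else 0)) (i + j)
     + affine_scale (of_int i * (if i = - j then 1 else 0) * (if a = d then 1 else 0)
         * (if b = c then 1 else 0)) central"
proof -
  have "trace (0 :: complex ^ 'm ^ 'm) = 0"
    by (simp add: trace_def)
  then show ?thesis
    by (simp add: affine_bracket_def loop_def matrix_unit_nonzero Let_def matrix_unit_mult
        trace_matrix_unit)
qed

definition affine_sl :: "'m::finite affine_gl set" where
  "affine_sl = {\<xi>. \<forall>i. trace (Poly_Mapping.lookup (fst \<xi>) i) = 0}"

text \<open>
  The subspace of \<open>\<s>\<l>\<^sub>m[t,t\<^sup>-\<^sup>1]\<close> spanned by the \<open>P t\<^sup>i\<close> with \<open>i \<in> S\<close>: thus \<open>t\<^sup>i \<s>\<l>\<^sub>m[t]\<close> is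
  \<open>loop_sl {i..}\<close>, the subalgebra \<open>\<s>\<l>\<^sub>m\<close> is \<open>loop_sl {0}\<close> and \<open>\<q>\<close> is \<open>loop_sl {..-1}\<close>.
\<close>

definition loop_sl :: "int set \<Rightarrow> 'm::finite affine_gl set" where
  "loop_sl S = {\<xi> \<in> affine_sl. snd \<xi> = 0 \<and> Poly_Mapping.keys (fst \<xi>) \<subseteq> S}"

text \<open>
  The action \<open>rho\<close> is a total function on the type \<^typ>\<open>'m affine_gl\<close>; it is constrained, and used
  below, only on the subalgebra \<^const>\<open>affine_sl\<close>.
\<close>

locale affine_sl_module = vector_space smul
  for smul :: "complex \<Rightarrow> 'v::ab_group_add \<Rightarrow> 'v" +
  fixes rho :: "'m::finite affine_gl \<Rightarrow> 'v \<Rightarrow> 'v"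
  assumes linear_rho: "\<xi> \<in> affine_sl \<Longrightarrow> Vector_Spaces.linear smul smul (rho \<xi>)"
    and rho_add: "\<xi> \<in> affine_sl \<Longrightarrow> \<eta> \<in> affine_sl \<Longrightarrow> rho (\<xi> + \<eta>) v = rho \<xi> v + rho \<eta> v"
    and rho_scale: "\<xi> \<in> affine_sl \<Longrightarrow> rho (affine_scale c \<xi>) v = smul c (rho \<xi> v)"
    and rho_bracket: "\<xi> \<in> affine_sl \<Longrightarrow> \<eta> \<in> affine_sl \<Longrightarrow>
      rho (affine_bracket \<xi> \<eta>) v = rho \<xi> (rho \<eta> v) - rho \<eta> (rho \<xi> v)"


section \<open>The space \<open>W\<close>\<close>

text \<open>
  The Laurent polynomials and the tensor power have the bases \<open>x\<^sup>\<alpha>\<close> and \<open>e\<^sub>g\<close>, so their tensor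
  product with \<open>V\<close> consists of the finite sums of \<open>x\<^sup>\<alpha> \<otimes> e\<^sub>g \<otimes> v\<^bsub>\<alpha>,g\<^esub>\<close>.  The universal property
  is lemma \<open>pure_tensor_universal\<close> below.
\<close>

type_synonym ('n, 'm, 'v) wspace = "(('n \<Rightarrow>\<^sub>0 int) \<times> ('n \<Rightarrow> 'm)) \<Rightarrow>\<^sub>0 'v"

definition wscale ::
  "(complex \<Rightarrow> 'v::ab_group_add \<Rightarrow> 'v) \<Rightarrow> complex \<Rightarrow> ('n, 'm, 'v) wspace \<Rightarrow> ('n, 'm, 'v) wspace" where
  "wscale smul c w = Poly_Mapping.map (smul c) w"

definition pure_tensor ::
  "(complex \<Rightarrow> 'v::ab_group_add \<Rightarrow> 'v) \<Rightarrow>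
    'n::finite laurent \<Rightarrow> ('n, 'm::finite) tpower \<Rightarrow> 'v \<Rightarrow> ('n, 'm, 'v) wspace" where
  "pure_tensor smul f u v =
     (\<Sum>\<alpha>\<in>Poly_Mapping.keys f. \<Sum>g\<in>UNIV.
        Poly_Mapping.single (\<alpha>, g) (smul (Poly_Mapping.lookup f \<alpha> * u $ g) v))"

text \<open>The operator \<open>A \<otimes> T \<otimes> D\<close> for linear operators \<open>A\<close>, \<open>T\<close>, \<open>D\<close> on the three factors.\<close>

definition tensor_map ::
  "(complex \<Rightarrow> 'v::ab_group_add \<Rightarrow> 'v) \<Rightarrow>
    ('n::finite laurent \<Rightarrow> 'n laurent) \<Rightarrow> (('n, 'm::finite) tpower \<Rightarrow> ('n, 'm) tpower) \<Rightarrow>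
    ('v \<Rightarrow> 'v) \<Rightarrow> ('n, 'm, 'v) wspace \<Rightarrow> ('n, 'm, 'v) wspace" where
  "tensor_map smul A T D w =
     (\<Sum>(\<alpha>, g)\<in>Poly_Mapping.keys w.
        pure_tensor smul (A (Poly_Mapping.single \<alpha> 1)) (T (axis g 1))
          (D (Poly_Mapping.lookup w (\<alpha>, g))))"

lemma lookup_wscale:
  assumes "vector_space smul"
  shows "Poly_Mapping.lookup (wscale smul c w) k = smul c (Poly_Mapping.lookup w k)"
proof -
  interpret vector_space smul by fact
  show ?thesis by (simp add: wscale_def Poly_Mapping.map.rep_eq when_def)
qed

lemma lookup_laurent_scale:
  "Poly_Mapping.lookup (laurent_scale c f) k = c * Poly_Mapping.lookup f k"
  by (simp add: laurent_scale_def Poly_Mapping.map.rep_eq when_def)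

lemma vector_space_wscale:
  assumes "vector_space smul"
  shows "vector_space (wscale smul)"
proof -
  interpret vector_space smul by fact
  show ?thesis
    by unfold_locales
      (rule poly_mapping_eqI, simp add: lookup_wscale[OF assms] lookup_add algebra_simps)+
qed

lemma vector_space_laurent: "vector_space laurent_scale"
  by unfold_locales
    (rule poly_mapping_eqI, simp add: lookup_laurent_scale lookup_add algebra_simps)+

lemma lookup_pure_tensor:
  fixes f :: "'n::finite laurent" and u :: "('n, 'm::finite) tpower"
  assumes "vector_space smul"
  shows "Poly_Mapping.lookup (pure_tensor smul f u v) (\<alpha>, g) =
    smul (Poly_Mapping.lookup f \<alpha> * u $ g) v"
proof -
  interpret vector_space smul by fact
  have "Poly_Mapping.lookup (pure_tensor smul f u v) (\<alpha>, g) =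
    (\<Sum>\<beta>\<in>Poly_Mapping.keys f. \<Sum>h\<in>UNIV. if \<beta> = \<alpha> then
       (if h = g then smul (Poly_Mapping.lookup f \<beta> * u $ h) v else 0) else 0)"
    unfolding pure_tensor_def lookup_sum
    by (intro sum.cong refl) (auto simp: lookup_single when_def)
  also have "\<dots> = (\<Sum>\<beta>\<in>Poly_Mapping.keys f. if \<beta> = \<alpha> then
       (\<Sum>h\<in>UNIV. if h = g then smul (Poly_Mapping.lookup f \<beta> * u $ h) v else 0) else 0)"
    by (intro sum.cong refl) auto
  also have "\<dots> = smul (Poly_Mapping.lookup f \<alpha> * u $ g) v"
    by (auto simp: sum.delta in_keys_iff)
  finally show ?thesis .
qed

lemma pure_tensor_trilinear:
  assumes "vector_space smul"
  shows "Vector_Spaces.linear laurent_scale (wscale smul) (\<lambda>f. pure_tensor smul f u v)"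
    and "Vector_Spaces.linear (*s) (wscale smul) (\<lambda>u. pure_tensor smul f u v)"
    and "Vector_Spaces.linear smul (wscale smul) (\<lambda>v. pure_tensor smul f u v)"
proof -
  interpret vector_space smul by fact
  note * = vector_space_wscale[OF assms] vector_space_laurent vec.vector_space_axioms assms
  show "Vector_Spaces.linear laurent_scale (wscale smul) (\<lambda>f. pure_tensor smul f u v)"
    "Vector_Spaces.linear (*s) (wscale smul) (\<lambda>u. pure_tensor smul f u v)"
    "Vector_Spaces.linear smul (wscale smul) (\<lambda>v. pure_tensor smul f u v)"
    by (auto simp: Vector_Spaces.linear_iff * poly_mapping_eq_iff fun_eq_iff lookup_add
        lookup_pure_tensor lookup_wscale lookup_laurent_scale algebra_simps)
qed

lemma wspace_decompose:
  fixes w :: "('n::finite, 'm::finite, 'v::ab_group_add) wspace"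
  assumes "vector_space smul"
  shows "w = (\<Sum>(\<alpha>, g)\<in>Poly_Mapping.keys w.
     pure_tensor smul (Poly_Mapping.single \<alpha> 1) (axis g 1) (Poly_Mapping.lookup w (\<alpha>, g)))"
proof -
  interpret vector_space smul by fact
  have "pure_tensor smul (Poly_Mapping.single \<alpha> 1) (axis g 1) v =
    (Poly_Mapping.single (\<alpha>, g) v :: ('n, 'm, 'v) wspace)" for \<alpha> g v
  proof (rule poly_mapping_eqI)
    fix k :: "('n \<Rightarrow>\<^sub>0 int) \<times> ('n \<Rightarrow> 'm)"
    obtain \<beta> h where k: "k = (\<beta>, h)" by fastforce
    show "Poly_Mapping.lookup (pure_tensor smul (Poly_Mapping.single \<alpha> 1) (axis g 1) v) k =
      Poly_Mapping.lookup (Poly_Mapping.single (\<alpha>, g) v) k"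
      unfolding k lookup_pure_tensor[OF assms] by (auto simp: lookup_single when_def axis_def)
  qed
  moreover have "w = (\<Sum>k\<in>Poly_Mapping.keys w. Poly_Mapping.single k (Poly_Mapping.lookup w k))"
    by (rule poly_mapping_eqI)
      (simp add: lookup_sum lookup_single when_def sum.delta in_keys_iff)
  ultimately show ?thesis by (simp add: case_prod_unfold)
qed

lemma pure_tensor_universal:
  fixes smul :: "complex \<Rightarrow> 'v::ab_group_add \<Rightarrow> 'v" and smul' :: "complex \<Rightarrow> 'u::ab_group_add \<Rightarrow> 'u"
    and B :: "'n::finite laurent \<Rightarrow> ('n, 'm::finite) tpower \<Rightarrow> 'v \<Rightarrow> 'u"
  assumes "vector_space smul" "vector_space smul'"
    and B: "\<And>u v. Vector_Spaces.linear laurent_scale smul' (\<lambda>f. B f u v)"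
      "\<And>f v. Vector_Spaces.linear (*s) smul' (\<lambda>u. B f u v)"
      "\<And>f u. Vector_Spaces.linear smul smul' (B f u)"
  shows "\<exists>!L. Vector_Spaces.linear (wscale smul) smul' L \<and>
    (\<forall>f u v. L (pure_tensor smul f u v) = B f u v)"
proof -
  interpret V: vector_space smul by fact
  interpret U: vector_space smul' by fact
  define b where "b k = B (Poly_Mapping.single (fst k) 1) (axis (snd k) 1)" for k
  have b0: "b k 0 = 0" for k
    using B(3) unfolding b_def by (rule Vector_Spaces.linear.axioms(3)[THEN module_hom.zero])
  have badd: "b k (v + v') = b k v + b k v'" and bsc: "b k (smul c v) = smul' c (b k v)" for k v v' c
    using B(3) unfolding b_def by (auto simp: Vector_Spaces.linear_iff)
  define L where "L w = (\<Sum>k\<in>Poly_Mapping.keys w. b k (Poly_Mapping.lookup w k))" for w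
  have L_superset: "L w = (\<Sum>k\<in>K. b k (Poly_Mapping.lookup w k))"
    if "finite K" "Poly_Mapping.keys w \<subseteq> K" for w K
    unfolding L_def using that by (intro sum.mono_neutral_left) (auto simp: in_keys_iff b0)
  have Ladd: "L (w + w') = L w + L w'" for w w'
  proof -
    let ?K = "Poly_Mapping.keys w \<union> Poly_Mapping.keys w'"
    have "Poly_Mapping.keys (w + w') \<subseteq> ?K" by (rule Poly_Mapping.keys_add)
    then show ?thesis
      by (simp add: L_superset[of ?K] lookup_add badd sum.distrib)
  qed
  have "Poly_Mapping.keys (wscale smul c w) \<subseteq> Poly_Mapping.keys w" for c and w :: "('n, 'm, 'v) wspace"
    by (auto simp: in_keys_iff lookup_wscale[OF assms(1)])
  then have Lsc: "L (wscale smul c w) = smul' c (L w)" for c w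
    by (subst L_superset[of "Poly_Mapping.keys w"])
      (auto simp: lookup_wscale[OF assms(1)] bsc L_def U.scale_sum_right)
  have linL: "Vector_Spaces.linear (wscale smul) smul' L"
    using Ladd Lsc vector_space_wscale[OF assms(1)] assms(2)
    by (auto simp: Vector_Spaces.linear_iff)
  have B_sum: "B f u v = (\<Sum>\<alpha>\<in>Poly_Mapping.keys f. \<Sum>g\<in>UNIV.
      smul' (Poly_Mapping.lookup f \<alpha> * u $ g) (b (\<alpha>, g) v))" for f u v
  proof -
    have u: "u = (\<Sum>g\<in>UNIV. u $ g *s axis g 1)"
      by (simp add: basis_expansion)
    have f: "f = (\<Sum>\<alpha>\<in>Poly_Mapping.keys f. laurent_scale (Poly_Mapping.lookup f \<alpha>) (Poly_Mapping.single \<alpha> 1))"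
      by (rule poly_mapping_eqI)
        (simp add: lookup_sum lookup_laurent_scale lookup_single when_def if_distrib sum.delta in_keys_iff cong: if_cong)
    interpret F: Vector_Spaces.linear laurent_scale smul' "\<lambda>f. B f u v" by (rule B)
    have "B (\<Sum>\<alpha>\<in>Poly_Mapping.keys f.
          laurent_scale (Poly_Mapping.lookup f \<alpha>) (Poly_Mapping.single \<alpha> 1)) u v =
        (\<Sum>\<alpha>\<in>Poly_Mapping.keys f.
          smul' (Poly_Mapping.lookup f \<alpha>) (B (Poly_Mapping.single \<alpha> 1) u v))"
      by (simp only: F.sum F.scale)
    then have 1: "B f u v = (\<Sum>\<alpha>\<in>Poly_Mapping.keys f.
        smul' (Poly_Mapping.lookup f \<alpha>) (B (Poly_Mapping.single \<alpha> 1) u v))"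
      by (simp only: f[symmetric])
    have 2: "B (Poly_Mapping.single \<alpha> 1) u v = (\<Sum>g\<in>UNIV. smul' (u $ g) (b (\<alpha>, g) v))" for \<alpha>
    proof -
      interpret G: Vector_Spaces.linear "(*s)" smul' "\<lambda>u. B (Poly_Mapping.single \<alpha> 1) u v" by (rule B)
      have "B (Poly_Mapping.single \<alpha> 1) (\<Sum>g\<in>UNIV. u $ g *s axis g 1) v =
          (\<Sum>g\<in>UNIV. smul' (u $ g) (b (\<alpha>, g) v))"
        by (simp only: G.sum G.scale b_def fst_conv snd_conv)
      then show ?thesis by (simp only: u[symmetric])
    qed
    show ?thesis by (simp add: 1 2 U.scale_sum_right)
  qed
  have Lsingle: "L (Poly_Mapping.single k v) = b k v" for k v
    by (subst L_superset[of "{k}"]) (auto simp: lookup_single)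
  have LB: "L (pure_tensor smul f u v) = B f u v" for f u v
  proof -
    interpret L: Vector_Spaces.linear "wscale smul" smul' L by (rule linL)
    show ?thesis unfolding pure_tensor_def B_sum by (simp add: L.sum Lsingle bsc)
  qed
  show ?thesis
  proof (rule ex1I[of _ L])
    show "Vector_Spaces.linear (wscale smul) smul' L \<and> (\<forall>f u v. L (pure_tensor smul f u v) = B f u v)"
      using linL LB by blast
    fix M assume M: "Vector_Spaces.linear (wscale smul) smul' M \<and> (\<forall>f u v. M (pure_tensor smul f u v) = B f u v)"
    interpret L: Vector_Spaces.linear "wscale smul" smul' L by (rule linL)
    interpret M: Vector_Spaces.linear "wscale smul" smul' M using M by blast
    show "M = L"
    proof
      fix w :: "('n, 'm, 'v) wspace"
      show "M w = L w"
        using arg_cong[OF wspace_decompose[OF assms(1), of w], of M]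
          arg_cong[OF wspace_decompose[OF assms(1), of w], of L] M LB
        by (simp only: L.sum M.sum case_prod_unfold)
    qed
  qed
qed

lemma tensor_map_linear_pure:
  assumes "vector_space smul"
    and "Vector_Spaces.linear laurent_scale laurent_scale A"
    and "Vector_Spaces.linear (*s) (*s) T" and "Vector_Spaces.linear smul smul D"
  shows "Vector_Spaces.linear (wscale smul) (wscale smul) (tensor_map smul A T D)"
    and "tensor_map smul A T D (pure_tensor smul f u v) = pure_tensor smul (A f) (T u) (D v)"
proof -
  have c: "Vector_Spaces.linear s1 s3 (\<lambda>x. h (k x))"
    if "Vector_Spaces.linear s1 s2 k" "Vector_Spaces.linear s2 s3 h" for s1 s2 s3 h k
    using Vector_Spaces.linear_compose[OF that] by (simp add: o_def)
  let ?B = "\<lambda>f u v. pure_tensor smul (A f) (T u) (D v)"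
  obtain L where L: "Vector_Spaces.linear (wscale smul) (wscale smul) L"
    and LB: "L (pure_tensor smul f u v) = ?B f u v" for f u v
  proof -
    have "\<exists>!L. Vector_Spaces.linear (wscale smul) (wscale smul) L \<and>
        (\<forall>f u v. L (pure_tensor smul f u v) = ?B f u v)"
      by (rule pure_tensor_universal[OF assms(1) vector_space_wscale[OF assms(1)]])
        (rule c[OF assms(2) pure_tensor_trilinear(1)[OF assms(1)]]
          c[OF assms(3) pure_tensor_trilinear(2)[OF assms(1)]]
          c[OF assms(4) pure_tensor_trilinear(3)[OF assms(1)]])+
    then show thesis using that by blast
  qed
  have "tensor_map smul A T D = L"
  proof
    fix w
    interpret L: Vector_Spaces.linear "wscale smul" "wscale smul" L by (rule L)
    show "tensor_map smul A T D w = L w"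
      using arg_cong[OF wspace_decompose[OF assms(1), of w], of L]
      by (simp only: L.sum case_prod_unfold LB tensor_map_def)
  qed
  then show "Vector_Spaces.linear (wscale smul) (wscale smul) (tensor_map smul A T D)"
    "tensor_map smul A T D (pure_tensor smul f u v) = pure_tensor smul (A f) (T u) (D v)"
    using L LB by simp_all
qed

definition affine_action ::
  "(complex \<Rightarrow> 'v::ab_group_add \<Rightarrow> 'v) \<Rightarrow> ('m::finite affine_gl \<Rightarrow> 'v \<Rightarrow> 'v) \<Rightarrow>
    'm affine_gl \<Rightarrow> ('n::finite, 'm, 'v) wspace \<Rightarrow> ('n, 'm, 'v) wspace" where
  "affine_action smul rho \<xi> w =
     (\<Sum>j\<in>Poly_Mapping.keys (fst \<xi>). \<Sum>q\<in>UNIV.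
        tensor_map smul (\<lambda>f. xpow q j * f) (factor_op q (Poly_Mapping.lookup (fst \<xi>) j)) id w)
     + tensor_map smul id id (rho \<xi>) w"

text \<open>
  The term of degree \<open>i\<close> of the infinite sum in the operator of \<open>z\<^sub>p\<close>.  Only the elements
  \<open>(E\<^bsub>ba\<^esub> - \<delta>\<^bsub>ab\<^esub>/m I) t\<^sup>i\<close> of \<open>\<s>\<l>\<^sub>m[t]\<close> act on \<open>V\<close>.
\<close>

definition casimir_term ::
  "(complex \<Rightarrow> 'v::ab_group_add \<Rightarrow> 'v) \<Rightarrow> ('m::finite affine_gl \<Rightarrow> 'v \<Rightarrow> 'v) \<Rightarrow>
    'n::finite \<Rightarrow> nat \<Rightarrow> ('n, 'm, 'v) wspace \<Rightarrow> ('n, 'm, 'v) wspace" where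
  "casimir_term smul rho p i w =
     (\<Sum>a\<in>UNIV. \<Sum>b\<in>UNIV.
        tensor_map smul (\<lambda>f. xpow p (- int i) * f) (factor_op p (matrix_unit a b))
          (rho (loop (matrix_unit b a - mat (if a = b then 1 / of_nat CARD('m) else 0)) (int i))) w)"

text \<open>
  \<^const>\<open>Sum_any\<close> sums a family with finitely many nonzero terms.
\<close>

definition z_operator ::
  "complex \<Rightarrow> (complex \<Rightarrow> 'v::ab_group_add \<Rightarrow> 'v) \<Rightarrow> ('m::finite affine_gl \<Rightarrow> 'v \<Rightarrow> 'v) \<Rightarrow>
    'n::finite \<Rightarrow> ('n, 'm, 'v) wspace \<Rightarrow> ('n, 'm, 'v) wspace" where
  "z_operator \<kappa> smul rho p w =
     tensor_map smul (\<lambda>f. laurent_scale \<kappa> (xpow p 1 * laurent_partial p f)) id id w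
     + (\<Sum>r\<in>UNIV - {p}.
          tensor_map smul (\<lambda>f. xpow p 1 * divided_difference p r f) (perm_tensor (Perm.swap p r)) id w)
     + Sum_any (\<lambda>i. casimir_term smul rho p i w)"

definition qW ::
  "(complex \<Rightarrow> 'v::ab_group_add \<Rightarrow> 'v) \<Rightarrow> ('m::finite affine_gl \<Rightarrow> 'v \<Rightarrow> 'v) \<Rightarrow>
    ('n::finite, 'm, 'v) wspace set" where
  "qW smul rho =
     module.span (wscale smul) {affine_action smul rho P w | P w. P \<in> loop_sl {..-1}}"


section \<open>The trigonometric Cherednik algebra\<close>

datatype 'g free_monoid = Word "'g list"

instantiation free_monoid :: (type) monoid_add
begin

definition "0 = Word []"

fun plus_free_monoid :: "'a free_monoid \<Rightarrow> 'a free_monoid \<Rightarrow> 'a free_monoid" where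
  "Word u + Word v = Word (u @ v)"

instance
proof
  fix a b c :: "'a free_monoid"
  show "a + b + c = a + (b + c)" by (cases a; cases b; cases c) simp
  show "0 + a = a" by (cases a) (simp add: zero_free_monoid_def)
  show "a + 0 = a" by (cases a) (simp add: zero_free_monoid_def)
qed

end

text \<open>The free associative unital \<open>\<complex>\<close>-algebra is the monoid algebra of the free monoid.\<close>

type_synonym 'g free_algebra = "'g free_monoid \<Rightarrow>\<^sub>0 complex"

datatype 'n cherednik_generator = GenX 'n | GenXinv 'n | GenS "'n perm" | GenZ 'n

definition gen :: "'g \<Rightarrow> 'g free_algebra" where
  "gen g = Poly_Mapping.single (Word [g]) 1"

definition scalar :: "complex \<Rightarrow> 'g free_algebra" where
  "scalar c = Poly_Mapping.single 0 c"

text \<open>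
  The elements that are set to zero: the relations of the Laurent polynomial ring, those of the
  group algebra, and the relations that link them to each other and to the \<open>z\<^sub>p\<close>.
\<close>

inductive_set cherednik_relations ::
  "complex \<Rightarrow> 'n::finite cherednik_generator free_algebra set" for \<kappa> where
  "gen (GenX p) * gen (GenXinv p) - 1 \<in> cherednik_relations \<kappa>"
| "gen (GenXinv p) * gen (GenX p) - 1 \<in> cherednik_relations \<kappa>"
| "gen (GenX p) * gen (GenX q) - gen (GenX q) * gen (GenX p) \<in> cherednik_relations \<kappa>"
| "gen (GenS 1) - 1 \<in> cherednik_relations \<kappa>"
| "gen (GenS \<sigma>) * gen (GenS \<tau>) - gen (GenS (\<sigma> * \<tau>)) \<in> cherednik_relations \<kappa>"
| "gen (GenS \<sigma>) * gen (GenX p) * gen (GenS (inverse \<sigma>)) - gen (GenX (Perm.apply \<sigma> p))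
     \<in> cherednik_relations \<kappa>"
| "gen (GenS \<sigma>) * gen (GenZ p) * gen (GenS (inverse \<sigma>)) - gen (GenZ (Perm.apply \<sigma> p))
     \<in> cherednik_relations \<kappa>"
| "p \<noteq> q \<Longrightarrow>
     (gen (GenZ p) * gen (GenZ q) - gen (GenZ q) * gen (GenZ p))
     - gen (GenS (Perm.swap p q)) * (gen (GenZ p) - gen (GenZ q)) \<in> cherednik_relations \<kappa>"
| "p \<noteq> q \<Longrightarrow>
     (gen (GenZ p) * gen (GenX q) - gen (GenX q) * gen (GenZ p))
     - (- (gen (GenX p) * gen (GenS (Perm.swap p q)))) \<in> cherednik_relations \<kappa>"
| "(gen (GenZ p) * gen (GenX p) - gen (GenX p) * gen (GenZ p))
     - (scalar \<kappa> * gen (GenX p)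
        + (\<Sum>r\<in>UNIV - {p}. gen (GenX p) * gen (GenS (Perm.swap p r)))) \<in> cherednik_relations \<kappa>"

definition cherednik_ideal :: "complex \<Rightarrow> 'n::finite cherednik_generator free_algebra set" where
  "cherednik_ideal \<kappa> = Idl\<^bsub>ring_of_type_algebra\<^esub> (cherednik_relations \<kappa>)"

definition cherednik :: "complex \<Rightarrow> 'n::finite cherednik_generator free_algebra set ring" where
  "cherednik \<kappa> = ring_of_type_algebra Quot (cherednik_ideal \<kappa>)"

definition cherednik_class ::
  "complex \<Rightarrow> 'n::finite cherednik_generator free_algebra \<Rightarrow>
    'n cherednik_generator free_algebra set" where
  "cherednik_class \<kappa> a = cherednik_ideal \<kappa> +>\<^bsub>ring_of_type_algebra\<^esub> a"

text \<open>
  \<open>act\<close> makes the vector space with scalar multiplication \<open>s\<close> a unital module over the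
  \<open>\<complex>\<close>-algebra \<^term>\<open>cherednik \<kappa>\<close>.
\<close>

definition cherednik_action ::
  "complex \<Rightarrow> (complex \<Rightarrow> 'w::ab_group_add \<Rightarrow> 'w) \<Rightarrow>
    ('n::finite cherednik_generator free_algebra set \<Rightarrow> 'w \<Rightarrow> 'w) \<Rightarrow> bool" where
  "cherednik_action \<kappa> s act \<longleftrightarrow>
     (\<forall>a\<in>carrier (cherednik \<kappa>). Vector_Spaces.linear s s (act a)) \<and>
     act \<one>\<^bsub>cherednik \<kappa>\<^esub> = id \<and>
     (\<forall>a\<in>carrier (cherednik \<kappa>). \<forall>b\<in>carrier (cherednik \<kappa>). \<forall>w.
        act (a \<oplus>\<^bsub>cherednik \<kappa>\<^esub> b) w = act a w + act b w \<and>
        act (a \<otimes>\<^bsub>cherednik \<kappa>\<^esub> b) w = act a (act b w)) \<and>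
     (\<forall>c. \<forall>a\<in>carrier (cherednik \<kappa>). \<forall>w.
        act (cherednik_class \<kappa> (scalar c) \<otimes>\<^bsub>cherednik \<kappa>\<^esub> a) w = s c (act a w))"

end

theory Submission
  imports Defs
begin

text \<open>
  An additive operator on \<open>W\<close> that commutes with the multiplications by the \<open>x\<^sub>p\<close>, possibly up to a
  permutation of the variables, is zero as soon as it vanishes on \<open>1 \<otimes> (\<complex>\<^sup>m)\<^bsup>\<otimes>N\<^esup> \<otimes> V\<close>. The Jacobi
  identity shows that the difference of the two sides of \<open>[z\<^sub>p, z\<^sub>q] = \<sigma>\<^bsub>pq\<^esub> (z\<^sub>p - z\<^sub>q)\<close> is such an
  operator. On constants, \<open>x\<^sub>p \<partial>\<^sub>p\<close> disappears, the divided differences of \<open>x\<^sub>q\<^bsup>-j\<^esup>\<close> are telescoping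
  sums of \<open>x\<^sub>p\<^bsup>-k\<^esup> x\<^sub>q\<^bsup>k-j\<^esup>\<close>, and they cancel against the commutators
  \<open>[T\<^sub>p\<^sup>i, T\<^sub>q\<^sup>j] = P\<^bsub>pq\<^esub> (T\<^sub>p\<^bsup>i+j\<^esup> - T\<^sub>q\<^bsup>i+j\<^esup>)\<close> of \<open>T\<^sub>p\<^sup>i = \<Sum>\<^bsub>ab\<^esub> E\<^bsub>ab\<^esub>\<^bsup>(p)\<^esup> \<otimes> E\<^bsub>ba\<^esub> t\<^sup>i\<close>.

  In the same way, for \<open>j \<ge> 0\<close> and \<open>A \<in> \<s>\<l>\<^sub>m\<close>, the commutator of \<open>z\<^sub>p\<close> with the action of \<open>A t\<^bsup>-j\<^esup>\<close>
  on \<open>W\<close> is the sum over \<open>k < j\<close> and \<open>a, b\<close> of the operators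
  \<open>([E\<^bsub>ba\<^esub>, A] t\<^bsup>k-j\<^esup>) x\<^sub>p\<^bsup>-k\<^esup> E\<^bsub>ab\<^esub>\<^bsup>(p)\<^esup>\<close>: the terms in \<open>x\<^sub>p\<^bsup>-j\<^esup> A\<^bsup>(p)\<^esup>\<close> have the
  coefficients \<open>- \<kappa> j\<close> from \<open>x\<^sub>p \<partial>\<^sub>p\<close>, \<open>j C\<close> from the central extension and \<open>m j\<close> from the sum, which
  add up to zero at level \<open>\<kappa> - m\<close>. For \<open>j = 0\<close> this is (ii), for \<open>j > 0\<close> it gives (iii).
\<close>

section \<open>Rings of additive endomorphisms\<close>

text \<open>Operators on \<open>W\<close> become elements of a ring, so that commutation relations
  are proved by rewriting in that ring. Only additivity is bundled; complex scalars enter later as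
  the elements \<open>Sc c\<close>.\<close>

typedef (overloaded) 'a endo = "{f :: 'a::ab_group_add \<Rightarrow> 'a. \<forall>x y. f (x + y) = f x + f y}"
  morphisms app Endo
  by (rule exI[of _ id]) simp

setup_lifting type_definition_endo

text \<open>Not an instance of \<^class>\<open>ring_1\<close>: over the trivial group \<open>0 = 1\<close>.\<close>

instantiation endo :: (ab_group_add) "{ring, monoid_mult}"
begin

lift_definition zero_endo :: "'a endo" is "\<lambda>_. 0" by simp
lift_definition one_endo :: "'a endo" is "\<lambda>x. x" by simp
lift_definition plus_endo :: "'a endo \<Rightarrow> 'a endo \<Rightarrow> 'a endo" is "\<lambda>f g x. f x + g x"
  by (simp add: algebra_simps)
lift_definition minus_endo :: "'a endo \<Rightarrow> 'a endo \<Rightarrow> 'a endo" is "\<lambda>f g x. f x - g x"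
  by (simp add: algebra_simps)
lift_definition uminus_endo :: "'a endo \<Rightarrow> 'a endo" is "\<lambda>f x. - f x"
  by simp
lift_definition times_endo :: "'a endo \<Rightarrow> 'a endo \<Rightarrow> 'a endo" is "\<lambda>f g x. f (g x)"
  by simp

instance
  by standard (transfer; simp add: fun_eq_iff algebra_simps)+

end

lemma app_add [simp]: "app f (x + y) = app f x + app f y"
  by transfer simp

lemma app_zero [simp]: "app f 0 = 0"
  using app_add[of f 0 0] by simp

lemma app_minus [simp]: "app f (- x) = - app f x"
  using app_add[of f x "- x"] by (simp add: eq_neg_iff_add_eq_0 add.commute)

lemma app_diff [simp]: "app f (x - y) = app f x - app f y"
  using app_add[of f x "- y"] by simp

lemma app_sum: "app f (\<Sum>i\<in>I. g i) = (\<Sum>i\<in>I. app f (g i))"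
  by (induction I rule: infinite_finite_induct) simp_all

lemma app_endo [simp]:
  "app 0 x = 0" "app 1 x = x" "app (f + g) x = app f x + app g x"
  "app (f - g) x = app f x - app g x" "app (- f) x = - app f x" "app (f * g) x = app f (app g x)"
  by (transfer; simp)+

lemma app_sum_endo: "app (\<Sum>i\<in>I. f i) x = (\<Sum>i\<in>I. app (f i) x)"
  by (induction I rule: infinite_finite_induct) simp_all

lemma endo_eqI: "(\<And>x. app f x = app g x) \<Longrightarrow> f = g"
  by transfer auto

lemma app_Endo: "(\<And>x y. f (x + y) = f x + f y) \<Longrightarrow> app (Endo f) = f"
  by (rule Endo_inverse) simp


section \<open>Laurent polynomials\<close>

lemma poly_mapping_sum_monomials:
  "f = (\<Sum>\<alpha>\<in>Poly_Mapping.keys f. Poly_Mapping.single \<alpha> (Poly_Mapping.lookup f \<alpha>))"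
  by (rule poly_mapping_eqI) (simp add: lookup_sum lookup_single when_def sum.delta in_keys_iff)

lemma perm_apply_inverse_apply [simp]:
  "Perm.apply (inverse \<sigma>) (Perm.apply \<sigma> a) = a" "Perm.apply \<sigma> (Perm.apply (inverse \<sigma>) a) = a"
  by (simp_all add: Perm.apply_sequence)

declare perm_exponent_swap [simp]

lemma perm_exponent_mult: "perm_exponent (\<sigma> * \<tau>) \<alpha> = perm_exponent \<sigma> (perm_exponent \<tau> \<alpha>)"
  by (rule poly_mapping_eqI) (simp add: Perm.apply_times)

lemma perm_exponent_one [simp]: "perm_exponent 1 \<alpha> = \<alpha>"
  by (rule poly_mapping_eqI) simp

lemma perm_exponent_single:
  "perm_exponent \<sigma> (Poly_Mapping.single p j) = Poly_Mapping.single (Perm.apply \<sigma> p) j"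
proof (rule poly_mapping_eqI)
  fix q
  have "p = Perm.apply (inverse \<sigma>) q \<longleftrightarrow> Perm.apply \<sigma> p = q"
    by (metis Perm.apply_sequence apply_inj perm.left_inverse perm.right_inverse apply_one comp_apply id_apply)
  then show "Poly_Mapping.lookup (perm_exponent \<sigma> (Poly_Mapping.single p j)) q =
      Poly_Mapping.lookup (Poly_Mapping.single (Perm.apply \<sigma> p) j) q"
    by (simp add: lookup_single when_def)
qed

text \<open>\<open>perm_exponent \<sigma>\<close> is a bijection of exponents, so a single monomial
  of \<open>f\<close> contributes. Most laws of \<open>perm_laurent\<close> are then checked
  coefficient by coefficient.\<close>

lemma lookup_perm_laurent:
  "Poly_Mapping.lookup (perm_laurent \<sigma> f) \<alpha> = Poly_Mapping.lookup f (perm_exponent (inverse \<sigma>) \<alpha>)"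
proof -
  have *: "perm_exponent \<sigma> \<beta> = \<alpha> \<longleftrightarrow> \<beta> = perm_exponent (inverse \<sigma>) \<alpha>" for \<beta>
    by (metis perm_exponent_mult perm.left_inverse perm.right_inverse perm_exponent_one)
  show ?thesis
    by (simp add: perm_laurent_def lookup_sum lookup_single when_def * sum.delta in_keys_iff)
qed

lemma perm_laurent_add [simp]: "perm_laurent \<sigma> (f + g) = perm_laurent \<sigma> f + perm_laurent \<sigma> g"
  by (rule poly_mapping_eqI) (simp add: lookup_perm_laurent lookup_add)

lemma perm_laurent_minus: "perm_laurent \<sigma> (f - g) = perm_laurent \<sigma> f - perm_laurent \<sigma> g"
  by (rule poly_mapping_eqI) (simp add: lookup_perm_laurent lookup_minus)

lemma perm_laurent_scale:
  "perm_laurent \<sigma> (laurent_scale c f) = laurent_scale c (perm_laurent \<sigma> f)"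
  by (rule poly_mapping_eqI) (simp add: lookup_perm_laurent lookup_laurent_scale)

lemma perm_laurent_mult_perm: "perm_laurent (\<sigma> * \<tau>) f = perm_laurent \<sigma> (perm_laurent \<tau> f)"
  by (rule poly_mapping_eqI) (simp add: lookup_perm_laurent perm_exponent_mult[symmetric])

lemma perm_laurent_one_perm [simp]: "perm_laurent 1 f = f"
  by (rule poly_mapping_eqI) (simp add: lookup_perm_laurent)

lemma perm_laurent_single:
  "perm_laurent \<sigma> (Poly_Mapping.single \<alpha> c) = Poly_Mapping.single (perm_exponent \<sigma> \<alpha>) c"
  by (cases "c = 0") (simp_all add: perm_laurent_def)

lemma perm_laurent_one [simp]: "perm_laurent \<sigma> 1 = 1"
proof -
  have "perm_exponent \<sigma> 0 = 0" by (rule poly_mapping_eqI) simp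
  then show ?thesis by (simp flip: single_one add: perm_laurent_single)
qed

lemma perm_laurent_xpow [simp]: "perm_laurent \<sigma> (xpow p j) = xpow (Perm.apply \<sigma> p) j"
  by (simp add: xpow_def perm_laurent_single perm_exponent_single)

lemma perm_laurent_xpow_mult:
  "perm_laurent \<sigma> (xpow p j * f) = xpow (Perm.apply \<sigma> p) j * perm_laurent \<sigma> f"
proof -
  have "perm_exponent (inverse \<sigma>) (Poly_Mapping.single (Perm.apply \<sigma> p) j) = Poly_Mapping.single p j"
    by (simp add: perm_exponent_single Perm.apply_sequence)
  moreover have "perm_exponent \<tau> (\<alpha> - \<beta>) = perm_exponent \<tau> \<alpha> - perm_exponent \<tau> \<beta>" for \<tau> :: "'a perm" and \<alpha> \<beta>
    by (rule poly_mapping_eqI) (simp add: lookup_minus)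
  ultimately show ?thesis
    by (intro poly_mapping_eqI)
      (simp add: lookup_perm_laurent xpow_def lookup_single_times_add)
qed

lemma xpow_mult: "xpow p i * xpow p j = xpow p (i + j)"
  by (simp add: xpow_def mult_single flip: single_add)

lemma xpow_zero [simp]: "xpow p 0 = 1"
  by (simp add: xpow_def)

text \<open>The operators \<open>x\<^sub>p \<partial>\<^sub>p\<close> and \<open>x\<^sub>p / (x\<^sub>p - x\<^sub>r) (1 - \<sigma>\<^bsub>pr\<^esub>)\<close> in the action of \<open>z\<^sub>p\<close>.\<close>

definition euler_op :: "'n \<Rightarrow> 'n laurent \<Rightarrow> 'n laurent" where
  "euler_op p f = xpow p 1 * laurent_partial p f"

text \<open>Multiplication by \<open>x_p\<close> undoes the exponent shift of the derivative:
  monomials are eigenvectors, with the exponent of \<open>x_p\<close> as eigenvalue.\<close>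

lemma lookup_euler_op:
  "Poly_Mapping.lookup (euler_op p f) \<alpha> = of_int (Poly_Mapping.lookup \<alpha> p) * Poly_Mapping.lookup f \<alpha>"
proof -
  have *: "\<beta> - Poly_Mapping.single p 1 = \<alpha> - Poly_Mapping.single p 1 \<longleftrightarrow> \<beta> = \<alpha>" for \<beta> by auto
  show ?thesis
    by (simp add: euler_op_def xpow_def lookup_single_times_add laurent_partial_def lookup_sum
        lookup_single when_def * sum.delta in_keys_iff)
qed

lemma euler_op_add: "euler_op p (f + g) = euler_op p f + euler_op p g"
  by (rule poly_mapping_eqI) (simp add: lookup_euler_op lookup_add algebra_simps)

lemma euler_op_scale: "euler_op p (laurent_scale c f) = laurent_scale c (euler_op p f)"
  by (rule poly_mapping_eqI) (simp add: lookup_euler_op lookup_laurent_scale)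

lemma laurent_scale_mult:
  fixes f g :: "'n laurent"
  shows "laurent_scale c (f * g) = f * laurent_scale c g"
proof -
  have "laurent_scale c h = Poly_Mapping.single 0 c * h" for h :: "'n laurent"
    by (rule poly_mapping_eqI) (simp add: lookup_laurent_scale lookup_single_times_add)
  then show ?thesis by (simp only: mult.left_commute)
qed

text \<open>The Leibniz rule. As \<open>euler_op p\<close> is diagonal, it amounts to additivity of
  exponents, also for negative \<open>j\<close>.\<close>

lemma euler_op_xpow_mult:
  "euler_op p (xpow q j * f) = xpow q j * euler_op p f + (if p = q then laurent_scale (of_int j) (xpow q j * f) else 0)"
  by (rule poly_mapping_eqI)
    (auto simp: lookup_euler_op lookup_add xpow_def lookup_single_times_add lookup_laurent_scale
      lookup_minus lookup_single when_def left_diff_distrib)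

lemma euler_op_one [simp]: "euler_op p 1 = 0"
  by (rule poly_mapping_eqI) (auto simp: lookup_euler_op lookup_one when_def)

section \<open>Divided differences: twisted Leibniz rules and values on negative powers\<close>

definition demazure :: "'n \<Rightarrow> 'n \<Rightarrow> 'n laurent \<Rightarrow> 'n laurent" where
  "demazure p r f = xpow p 1 * divided_difference p r f"

lemma demazure_mult:
  assumes "p \<noteq> r"
  shows "(xpow p 1 - xpow r 1) * demazure p r f = xpow p 1 * (f - perm_laurent (Perm.swap p r) f)"
proof -
  have "(xpow p 1 - xpow r 1) * divided_difference p r f = f - perm_laurent (Perm.swap p r) f"
    unfolding divided_difference_def by (rule theI'[OF divided_difference_ex1[OF assms]])
  moreover have "(xpow p 1 - xpow r 1) * demazure p r f =
      xpow p 1 * ((xpow p 1 - xpow r 1) * divided_difference p r f)"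
    unfolding demazure_def by (rule mult.left_commute)
  ultimately show ?thesis by simp
qed

text \<open>Since \<open>x_p - x_r\<close> is not a zero divisor, identities for
  \<open>demazure\<close> may be checked after multiplication by it.\<close>

lemma demazure_eqI:
  assumes "p \<noteq> r" "(xpow p 1 - xpow r 1) * g = xpow p 1 * (f - perm_laurent (Perm.swap p r) f)"
  shows "demazure p r f = g"
  using xpow_diff_cancel[OF assms(1), of "demazure p r f - g"] demazure_mult[OF assms(1), of f] assms(2)
  by (simp add: right_diff_distrib)

lemma demazure_add: "p \<noteq> r \<Longrightarrow> demazure p r (f + g) = demazure p r f + demazure p r g"
  by (rule demazure_eqI) (simp_all add: distrib_left demazure_mult, simp add: algebra_simps)

lemma demazure_scale: "p \<noteq> r \<Longrightarrow> demazure p r (laurent_scale c f) = laurent_scale c (demazure p r f)"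
proof (rule demazure_eqI)
  interpret L: vector_space laurent_scale by (rule vector_space_laurent)
  show "(xpow p 1 - xpow r 1) * laurent_scale c (demazure p r f) =
      xpow p 1 * (laurent_scale c f - perm_laurent (Perm.swap p r) (laurent_scale c f))" if "p \<noteq> r"
    using that
    by (simp add: demazure_mult perm_laurent_scale flip: laurent_scale_mult L.scale_right_diff_distrib)
qed

lemma demazure_one [simp]: "p \<noteq> r \<Longrightarrow> demazure p r 1 = 0"
  by (rule demazure_eqI) simp_all

lemma demazure_xpow_mult_other:
  assumes "p \<noteq> r" "q \<noteq> p" "q \<noteq> r"
  shows "demazure p r (xpow q j * f) = xpow q j * demazure p r f"
  using arg_cong[OF demazure_mult[OF assms(1), of f], of "(*) (xpow q j)"] assms
  by (intro demazure_eqI) (simp_all add: perm_laurent_xpow_mult, simp_all add: algebra_simps)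

text \<open>The twisted Leibniz rule \<open>D (g f) = g (D f) + (D g) (\<sigma> f)\<close> for
  \<open>g = x_p\<close>, where \<open>D x_p = x_p\<close>; for \<open>g = x_r\<close> one has
  \<open>D x_r = - x_p\<close>. These are the source of the terms \<open>x_p \<sigma>_pr\<close> in
  the commutators of \<open>z_p\<close> with the variables.\<close>

lemma demazure_x_left:
  assumes "p \<noteq> r"
  shows "demazure p r (xpow p 1 * f) =
     xpow p 1 * demazure p r f + xpow p 1 * perm_laurent (Perm.swap p r) f"
  using arg_cong[OF demazure_mult[OF assms(1), of f], of "(*) (xpow p 1)"] assms
  by (intro demazure_eqI) (simp_all add: perm_laurent_xpow_mult, simp_all add: algebra_simps)

lemma demazure_x_right:
  assumes "p \<noteq> r"
  shows "demazure p r (xpow r 1 * f) =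
     xpow r 1 * demazure p r f - xpow p 1 * perm_laurent (Perm.swap p r) f"
  using arg_cong[OF demazure_mult[OF assms(1), of f], of "(*) (xpow r 1)"] assms
  by (intro demazure_eqI) (simp_all add: perm_laurent_xpow_mult, simp_all add: algebra_simps)

text \<open>A finite geometric sum. The exponent of \<open>x_p\<close> runs from \<open>0\<close> to
  \<open>1 - j\<close>, that of \<open>x_r\<close> from \<open>- j\<close> to \<open>- 1\<close>;
  this asymmetry decides which boundary terms survive in the commutator of \<open>z_p\<close> and
  \<open>z_q\<close>.\<close>

lemma demazure_telescope:
  fixes p r :: 'n
  shows "(xpow p 1 - xpow r 1) * (\<Sum>k<j. xpow p (- int k) * xpow r (int k - int j)) =
    xpow p 1 * (xpow r (- int j) - xpow p (- int j))"
proof -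
  define g :: "nat \<Rightarrow> 'n laurent" where "g k = xpow p (1 - int k) * xpow r (int k - int j)" for k
  have "(xpow p 1 - xpow r 1) * (xpow p (- int k) * xpow r (int k - int j)) = g k - g (Suc k)" for k
  proof -
    have "(xpow p 1 - xpow r 1) * (xpow p (- int k) * xpow r (int k - int j)) =
        (xpow p 1 * xpow p (- int k)) * xpow r (int k - int j)
        - xpow p (- int k) * (xpow r 1 * xpow r (int k - int j))"
      by (simp add: algebra_simps)
    also have "\<dots> = g k - g (Suc k)"
      by (simp add: xpow_mult g_def algebra_simps)
    finally show ?thesis .
  qed
  then have "(xpow p 1 - xpow r 1) * (\<Sum>k<j. xpow p (- int k) * xpow r (int k - int j)) = (\<Sum>k<j. g k - g (Suc k))"
    by (simp add: sum_distrib_left)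
  also have "\<dots> = g 0 - g j" by (rule sum_lessThan_telescope')
  finally show ?thesis by (simp add: g_def right_diff_distrib xpow_mult)
qed

lemma demazure_xpow_right:
  assumes "p \<noteq> r"
  shows "demazure p r (xpow r (- int j)) = (\<Sum>k<j. xpow p (- int k) * xpow r (int k - int j))"
  by (rule demazure_eqI[OF assms]) (simp add: demazure_telescope)

lemma demazure_xpow_left:
  assumes "p \<noteq> r"
  shows "demazure p r (xpow p (- int j)) = - (\<Sum>k<j. xpow p (- int k) * xpow r (int k - int j))"
  by (rule demazure_eqI[OF assms])
    (simp only: mult_minus_right demazure_telescope, simp add: algebra_simps)


section \<open>Elementary operators on \<open>W\<close>\<close>

lemma mat_mult_left: "mat c ** A = map_matrix ((*) c) (A :: complex ^ 'm ^ 'm::finite)"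
  by (simp add: vec_eq_iff matrix_matrix_mult_def mat_def if_distrib[of "\<lambda>x. x * _"] cong: if_cong)

lemma mat_mult_right: "A ** mat c = map_matrix ((*) c) (A :: complex ^ 'm ^ 'm::finite)"
  by (simp add: vec_eq_iff matrix_matrix_mult_def mat_def if_distrib[of "\<lambda>x. _ * x"] mult.commute cong: if_cong)

lemma matrix_diff_ldistrib: "(A :: complex ^ 'm ^ 'm::finite) ** (B - C) = A ** B - A ** C"
  by (simp add: vec_eq_iff matrix_matrix_mult_def right_diff_distrib sum_subtractf)

lemma matrix_diff_rdistrib: "(A - B) ** C = A ** C - B ** (C :: complex ^ 'm ^ 'm::finite)"
  by (simp add: vec_eq_iff matrix_matrix_mult_def left_diff_distrib sum_subtractf)

lemma trace_scale: "trace (map_matrix ((*) c) A) = c * trace (A :: complex ^ 'm ^ 'm::finite)"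
  by (simp add: trace_def sum_distrib_left)

lemma trace_add_matrix: "trace (A + B) = trace A + trace (B :: complex ^ 'm ^ 'm::finite)"
  by (simp add: trace_def sum.distrib)

lemma trace_diff_matrix: "trace (A - B) = trace A - trace (B :: complex ^ 'm ^ 'm::finite)"
  by (simp add: trace_def sum_subtractf)

lemma trace_mat: "trace (mat c :: complex ^ 'm ^ 'm::finite) = of_nat CARD('m) * c"
  by (simp add: trace_def mat_def)

lemma trace_zero [simp]: "trace (0 :: complex ^ 'm ^ 'm::finite) = 0"
  by (simp add: trace_def)

lemma trace_mult_commute: "trace (A ** B) = trace (B ** (A :: complex ^ 'm ^ 'm::finite))"
  by (simp add: trace_def matrix_matrix_mult_def, subst sum.swap, simp add: mult.commute)

lemma trace_matrix_unit_mult: "trace (matrix_unit b a ** A) = A $ a $ b"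
proof -
  have "trace (matrix_unit b a ** A) = (\<Sum>i\<in>UNIV. \<Sum>j\<in>UNIV. if i = b then (if j = a then A $ j $ i else 0) else 0)"
    unfolding trace_def matrix_unit_def matrix_matrix_mult_def
    by (intro sum.cong refl) (simp, intro sum.cong refl, simp)
  also have "\<dots> = (\<Sum>i\<in>UNIV. if i = b then (\<Sum>j\<in>UNIV. if j = a then A $ j $ i else 0) else 0)"
    by (intro sum.cong refl) simp
  finally show ?thesis by (simp add: sum.delta)
qed

lemma matrix_sum_units:
  "A = (\<Sum>a\<in>UNIV. \<Sum>b\<in>UNIV. map_matrix ((*) (A $ a $ b)) (matrix_unit a b))"
  for A :: "complex ^ 'm ^ 'm::finite"
proof -
  have "(\<Sum>a\<in>UNIV. \<Sum>b\<in>UNIV. map_matrix ((*) (A $ a $ b)) (matrix_unit a b)) $ i $ j = A $ i $ j" for i j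
  proof -
    have "(\<Sum>a\<in>UNIV. \<Sum>b\<in>UNIV. map_matrix ((*) (A $ a $ b)) (matrix_unit a b)) $ i $ j =
        (\<Sum>a\<in>UNIV. \<Sum>b\<in>UNIV. if a = i then (if b = j then A $ a $ b else 0) else 0)"
      unfolding matrix_unit_def by (simp, intro sum.cong refl, auto)
    also have "\<dots> = (\<Sum>a\<in>UNIV. if a = i then (\<Sum>b\<in>UNIV. if b = j then A $ a $ b else 0) else 0)"
      by (intro sum.cong refl) simp
    finally show ?thesis by (simp add: sum.delta)
  qed
  then show ?thesis by (simp add: vec_eq_iff)
qed

lemma matrix_unit_mult_right:
  "matrix_unit a b ** A = (\<Sum>c\<in>UNIV. map_matrix ((*) (A $ b $ c)) (matrix_unit a c))"
proof -
  have "(\<Sum>k\<in>UNIV. matrix_unit a b $ i $ k * A $ k $ j) = (\<Sum>k\<in>UNIV. if k = b then (if i = a then A $ k $ j else 0) else 0)" for i j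
    by (intro sum.cong refl) (simp add: matrix_unit_def)
  moreover have "(\<Sum>c\<in>UNIV. A $ b $ c * matrix_unit a c $ i $ j) = (\<Sum>c\<in>UNIV. if c = j then (if i = a then A $ b $ c else 0) else 0)" for i j
    by (intro sum.cong refl) (simp add: matrix_unit_def)
  ultimately show ?thesis by (simp add: vec_eq_iff matrix_matrix_mult_def sum.delta)
qed

lemma matrix_unit_mult_left:
  "A ** matrix_unit a b = (\<Sum>c\<in>UNIV. map_matrix ((*) (A $ c $ a)) (matrix_unit c b))"
proof -
  have "(\<Sum>k\<in>UNIV. A $ i $ k * matrix_unit a b $ k $ j) = (\<Sum>k\<in>UNIV. if k = a then (if j = b then A $ i $ k else 0) else 0)" for i j
    by (intro sum.cong refl) (simp add: matrix_unit_def)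
  moreover have "(\<Sum>c\<in>UNIV. A $ c $ a * matrix_unit c b $ i $ j) = (\<Sum>c\<in>UNIV. if c = i then (if j = b then A $ c $ a else 0) else 0)" for i j
    by (intro sum.cong refl) (auto simp add: matrix_unit_def)
  ultimately show ?thesis by (simp add: vec_eq_iff matrix_matrix_mult_def sum.delta)
qed

text \<open>Invariance of \<open>\<Sum>\<^bsub>ab\<^esub> E\<^bsub>ab\<^esub> \<otimes> E\<^bsub>ba\<^esub>\<close>, stated for a balanced biadditive map in place of \<open>\<otimes>\<close>.\<close>

lemma casimir_transfer:
  fixes B :: "complex ^ 'm ^ 'm::finite \<Rightarrow> complex ^ 'm ^ 'm \<Rightarrow> 'b::ab_group_add"
  assumes add1: "\<And>A A' C. B (A + A') C = B A C + B A' C"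
    and add2: "\<And>A C C'. B A (C + C') = B A C + B A C'"
    and bal: "\<And>c A C. B (map_matrix ((*) c) A) C = B A (map_matrix ((*) c) C)"
  shows "(\<Sum>a\<in>UNIV. \<Sum>b\<in>UNIV. B (matrix_unit a b ** P) (matrix_unit b a)) =
      (\<Sum>a\<in>UNIV. \<Sum>b\<in>UNIV. B (matrix_unit a b) (P ** matrix_unit b a))"
    and "(\<Sum>a\<in>UNIV. \<Sum>b\<in>UNIV. B (P ** matrix_unit a b) (matrix_unit b a)) =
      (\<Sum>a\<in>UNIV. \<Sum>b\<in>UNIV. B (matrix_unit a b) (matrix_unit b a ** P))"
proof -
  have z1: "B 0 C = 0" for C using add1[of 0 0 C] by simp
  have z2: "B A 0 = 0" for A using add2[of A 0 0] by simp
  have s1: "B (\<Sum>i\<in>I. f i) C = (\<Sum>i\<in>I. B (f i) C)" for f C and I :: "'m set"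
    by (induction I rule: infinite_finite_induct) (simp_all add: z1 add1)
  have s2: "B A (\<Sum>i\<in>I. f i) = (\<Sum>i\<in>I. B A (f i))" for f A and I :: "'m set"
    by (induction I rule: infinite_finite_induct) (simp_all add: z2 add2)
  show "(\<Sum>a\<in>UNIV. \<Sum>b\<in>UNIV. B (matrix_unit a b ** P) (matrix_unit b a)) =
      (\<Sum>a\<in>UNIV. \<Sum>b\<in>UNIV. B (matrix_unit a b) (P ** matrix_unit b a))"
    by (simp add: matrix_unit_mult_right matrix_unit_mult_left s1 s2 bal)
      (intro sum.cong refl sum.swap)
  show "(\<Sum>a\<in>UNIV. \<Sum>b\<in>UNIV. B (P ** matrix_unit a b) (matrix_unit b a)) =
      (\<Sum>a\<in>UNIV. \<Sum>b\<in>UNIV. B (matrix_unit a b) (matrix_unit b a ** P))"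
    \<comment> \<open>Here \<open>b\<close> is the index that stays fixed, so it is brought to the
      outside before the two inner sums are exchanged.\<close>
    apply (subst (1 2) sum.swap)
    by (simp add: matrix_unit_mult_right matrix_unit_mult_left s1 s2 bal)
      (intro sum.cong refl sum.swap)
qed

section \<open>Operators on single tensor factors and permutations of the factors\<close>

lemma factor_op_factor_op: "factor_op q A (factor_op q B u) = factor_op q (A ** B) u"
proof -
  have "(\<Sum>b\<in>UNIV. A $ g q $ b * (\<Sum>c\<in>UNIV. B $ b $ c * u $ (g(q := c)))) =
    (\<Sum>c\<in>UNIV. (\<Sum>b\<in>UNIV. A $ g q $ b * B $ b $ c) * u $ (g(q := c)))" for g
    by (simp add: sum_distrib_left sum_distrib_right mult.assoc) (rule sum.swap)
  then show ?thesis by (simp add: factor_op_def vec_eq_iff matrix_matrix_mult_def)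
qed

lemma factor_op_commute:
  assumes "p \<noteq> q"
  shows "factor_op p A (factor_op q B u) = factor_op q B (factor_op p A u)"
proof -
  have "(\<Sum>b\<in>UNIV. A $ g p $ b * (\<Sum>c\<in>UNIV. B $ g q $ c * u $ (g(p := b, q := c)))) =
    (\<Sum>c\<in>UNIV. B $ g q $ c * (\<Sum>b\<in>UNIV. A $ g p $ b * u $ (g(q := c, p := b))))" for g
    by (subst sum_distrib_left, subst sum_distrib_left, subst sum.swap)
      (intro sum.cong refl, simp add: fun_upd_twist[OF assms] mult.left_commute)
  then show ?thesis using assms by (simp add: factor_op_def vec_eq_iff)
qed

lemma perm_tensor_factor_op:
  "perm_tensor \<sigma> (factor_op q A u) = factor_op (Perm.apply \<sigma> q) A (perm_tensor \<sigma> u)"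
proof -
  have "(g(Perm.apply \<sigma> q := b)) \<circ> Perm.apply \<sigma> = (g \<circ> Perm.apply \<sigma>)(q := b)" for g :: "'a \<Rightarrow> 'b" and b
    by (rule ext) (simp add: apply_inj)
  then show ?thesis by (simp add: factor_op_def perm_tensor_def vec_eq_iff)
qed

lemma perm_tensor_mult_perm: "perm_tensor (\<sigma> * \<tau>) u = perm_tensor \<sigma> (perm_tensor \<tau> u)"
  by (simp add: perm_tensor_def vec_eq_iff Perm.apply_times o_assoc)

lemma perm_tensor_one_perm [simp]: "perm_tensor 1 u = u"
  by (simp add: perm_tensor_def vec_eq_iff)

text \<open>At the coordinate \<open>g\<close> only the term with \<open>a = g p\<close> and
  \<open>b = g r\<close> survives. Writing the flip through matrix units is what links the symmetric
  group to the Casimir sums.\<close>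

lemma perm_tensor_swap:
  assumes "p \<noteq> r"
  shows "perm_tensor (Perm.swap p r) u =
    (\<Sum>a\<in>UNIV. \<Sum>b\<in>UNIV. factor_op p (matrix_unit a b) (factor_op r (matrix_unit b a) u))"
proof -
  have 1: "factor_op p (matrix_unit a b) w $ g = (if g p = a then w $ (g(p := b)) else 0)"
    for p a b g and w :: "('a, 'b) tpower"
  proof -
    have "factor_op p (matrix_unit a b) w $ g = (\<Sum>c\<in>UNIV. if c = b then (if g p = a then w $ (g(p := c)) else 0) else 0)"
      unfolding factor_op_def vec_lambda_beta by (intro sum.cong refl) (simp add: matrix_unit_def)
    then show ?thesis by (simp add: sum.delta)
  qed
  have 2: "g \<circ> Perm.apply (Perm.swap p r) = g(p := g r, r := g p)" for g :: "'a \<Rightarrow> 'b"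
    using assms by (auto simp: fun_eq_iff apply_swap_eq_iff)
  have "(\<Sum>a\<in>UNIV. \<Sum>b\<in>UNIV. factor_op p (matrix_unit a b) (factor_op r (matrix_unit b a) u)) $ g =
      u $ (g(p := g r, r := g p))" for g
  proof -
    have "(\<Sum>a\<in>UNIV. \<Sum>b\<in>UNIV. factor_op p (matrix_unit a b) (factor_op r (matrix_unit b a) u)) $ g =
        (\<Sum>a\<in>UNIV. \<Sum>b\<in>UNIV. if a = g p then (if b = g r then u $ (g(p := b, r := a)) else 0) else 0)"
      using assms by (simp add: 1, intro sum.cong refl, auto simp: 1)
    also have "\<dots> = (\<Sum>a\<in>UNIV. if a = g p then (\<Sum>b\<in>UNIV. if b = g r then u $ (g(p := b, r := a)) else 0) else 0)"
      by (intro sum.cong refl) simp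
    finally show ?thesis by (simp add: sum.delta)
  qed
  then show ?thesis by (simp add: vec_eq_iff perm_tensor_def 2)
qed

abbreviation laurent_linear :: "('n laurent \<Rightarrow> 'n laurent) \<Rightarrow> bool" where
  "laurent_linear \<equiv> Vector_Spaces.linear laurent_scale laurent_scale"

abbreviation tpower_linear :: "(('n::finite, 'm::finite) tpower \<Rightarrow> ('n, 'm) tpower) \<Rightarrow> bool" where
  "tpower_linear \<equiv> Vector_Spaces.linear (*s) (*s)"

lemma laurent_linear_simps [simp]:
  "laurent_linear id" "laurent_linear ((*) g)" "laurent_linear (perm_laurent \<sigma>)"
  "laurent_linear (euler_op p)" "p \<noteq> r \<Longrightarrow> laurent_linear (demazure p r)"
  by (simp_all add: Vector_Spaces.linear_iff vector_space_laurent distrib_left laurent_scale_mult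
      perm_laurent_scale euler_op_add euler_op_scale demazure_add demazure_scale)

lemma tpower_linear_simps [simp]:
  "tpower_linear id" "tpower_linear (perm_tensor \<sigma>)" "tpower_linear (factor_op p A)"
  by (simp_all add: Vector_Spaces.linear_iff vec.vector_space_axioms vec_eq_iff perm_tensor_def
      factor_op_def algebra_simps sum.distrib sum_distrib_left)

section \<open>The elementary operators as elements of the endomorphism ring of
  \<open>W\<close>\<close>

locale tensor_space = vector_space smul for smul :: "complex \<Rightarrow> 'v::ab_group_add \<Rightarrow> 'v"
begin

abbreviation pure where "pure \<equiv> pure_tensor smul"

lemma pure_add:
  "pure (f + f') u v = pure f u v + pure f' u v"
  "pure f (u + u') v = pure f u v + pure f u' v"
  "pure f u (v + v') = pure f u v + pure f u v'"
  using pure_tensor_trilinear[OF vector_space_axioms]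
  unfolding Vector_Spaces.linear_iff by blast+

lemma pure_scale:
  "pure (laurent_scale c f) u v = wscale smul c (pure f u v)"
  "pure f (c *s u) v = wscale smul c (pure f u v)"
  "pure f u (smul c v) = wscale smul c (pure f u v)"
  using pure_tensor_trilinear[OF vector_space_axioms]
  unfolding Vector_Spaces.linear_iff by blast+

lemma pure_zero [simp]: "pure 0 u v = 0" "pure f 0 v = 0" "pure f u 0 = 0"
  using pure_add(1)[of 0 0 u v] pure_add(2)[of f 0 0 v] pure_add(3)[of f u 0 0] by simp_all

lemma pure_diff:
  "pure (f - f') u v = pure f u v - pure f' u v"
  "pure f (u - u') v = pure f u v - pure f u' v"
  "pure f u (v - v') = pure f u v - pure f u v'"
  by (simp_all add: eq_diff_eq flip: pure_add)

lemma pure_minus: "pure f u (- v) = - pure f u v"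
  using pure_diff(3)[of f u 0 v] by simp

lemma pure_sum:
  "pure (\<Sum>i\<in>I. F i) u v = (\<Sum>i\<in>I. pure (F i) u v)"
  "pure f (\<Sum>i\<in>I. U i) v = (\<Sum>i\<in>I. pure f (U i) v)"
  by (induction I rule: infinite_finite_induct; simp add: pure_add)+

text \<open>A scalar can be absorbed into the vector of \<open>V\<close>, so pure tensors generate
  \<open>W\<close> already as an additive group. This matches the additive endomorphisms in
  \<open>endo\<close>.\<close>

lemma wspace_induct [case_names pure add]:
  fixes w :: "('n::finite, 'm::finite, 'v) wspace"
  assumes "\<And>f u v. P (pure f u v)" "\<And>w w'. P w \<Longrightarrow> P w' \<Longrightarrow> P (w + w')"
  shows "P w"
proof -
  have 0: "P 0" using assms(1)[of 0 undefined undefined] by simp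
  have *: "P (\<Sum>i\<in>I. h i)" if "\<And>i. P (h i)" for I and h :: "('n \<Rightarrow>\<^sub>0 int) \<times> ('n \<Rightarrow> 'm) \<Rightarrow> ('n, 'm, 'v) wspace"
    using that by (induction I rule: infinite_finite_induct) (simp_all add: 0 assms(2))
  show ?thesis
    by (subst wspace_decompose[OF vector_space_axioms]) (rule *, simp add: case_prod_unfold assms(1))
qed

lemma endo_eq_pureI:
  "(\<And>f u v. app F (pure f u v) = app G (pure f u v)) \<Longrightarrow> F = G"
proof (rule endo_eqI)
  show "app F w = app G w" if "\<And>f u v. app F (pure f u v) = app G (pure f u v)" for w
    using that by (induction w rule: wspace_induct) simp_all
qed

abbreviation coeff_linear :: "('v \<Rightarrow> 'v) \<Rightarrow> bool" where
  "coeff_linear \<equiv> Vector_Spaces.linear smul smul"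

lemma coeff_linear_id [simp]: "coeff_linear id" "coeff_linear (smul c)"
  by (simp_all add: Vector_Spaces.linear_iff vector_space_axioms algebra_simps)

lemma app_tensor_map:
  assumes "laurent_linear A" "tpower_linear T" "coeff_linear D"
  shows "app (Endo (tensor_map smul A T D)) = tensor_map smul A T D"
  using tensor_map_linear_pure(1)[OF vector_space_axioms assms]
  by (intro app_Endo) (simp add: Vector_Spaces.linear_iff)

text \<open>\<open>tensor_map\<close> applies \<open>A\<close> to basis monomials only, so this is
  the operator of \<open>A\<close> on the first factor just for linear \<open>A\<close>; hence the
  linearity premises in the rules below.\<close>

definition opL :: "('n::finite laurent \<Rightarrow> 'n laurent) \<Rightarrow> ('n, 'm::finite, 'v) wspace endo" where
  "opL A = Endo (tensor_map smul A id id)"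

definition opT :: "(('n::finite, 'm::finite) tpower \<Rightarrow> ('n, 'm) tpower) \<Rightarrow> ('n, 'm, 'v) wspace endo" where
  "opT T = Endo (tensor_map smul id T id)"

definition opV :: "('v \<Rightarrow> 'v) \<Rightarrow> ('n::finite, 'm::finite, 'v) wspace endo" where
  "opV D = Endo (tensor_map smul id id D)"

lemma app_op_pure:
  "laurent_linear A \<Longrightarrow> app (opL A) (pure f u v) = pure (A f) u v"
  "tpower_linear T \<Longrightarrow> app (opT T) (pure f u v) = pure f (T u) v"
  "coeff_linear D \<Longrightarrow> app (opV D) (pure f u v) = pure f u (D v)"
  by (simp_all add: opL_def opT_def opV_def app_tensor_map tensor_map_linear_pure(2)[OF vector_space_axioms])

text \<open>The bridge from the operators on \<open>W\<close> in the statement of the theorem to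
  products in the endomorphism ring.\<close>

lemma tensor_map_eq_app:
  assumes "laurent_linear A" "tpower_linear T" "coeff_linear D"
  shows "tensor_map smul A T D w = app (opL A * opT T * opV D) w"
proof -
  have "Endo (tensor_map smul A T D) = opL A * opT T * opV D"
    by (rule endo_eq_pureI)
      (simp add: app_tensor_map assms tensor_map_linear_pure(2)[OF vector_space_axioms] app_op_pure)
  then show ?thesis using app_tensor_map[OF assms] by metis
qed

lemma opL_id [simp]: "opL id = 1" and opT_id [simp]: "opT id = 1" and opV_id [simp]: "opV id = 1"
  by (rule endo_eq_pureI, simp add: app_op_pure)+

text \<open>
  In the notation of the paper, \<open>Y g\<close> is multiplication by the Laurent polynomial \<open>g\<close>, \<open>M p A\<close> is
  \<open>A\<^bsup>(p)\<^esup>\<close>, \<open>Pt \<sigma>\<close> permutes the tensor factors only and \<open>Sg \<sigma>\<close> permutes the variables as well.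
\<close>

definition Sc :: "complex \<Rightarrow> ('n::finite, 'm::finite, 'v) wspace endo" where
  "Sc c = opV (smul c)"

definition Y :: "'n::finite laurent \<Rightarrow> ('n, 'm::finite, 'v) wspace endo" where
  "Y g = opL ((*) g)"

definition Eu :: "'n::finite \<Rightarrow> ('n, 'm::finite, 'v) wspace endo" where
  "Eu p = opL (euler_op p)"

definition Dm :: "'n::finite \<Rightarrow> 'n \<Rightarrow> ('n, 'm::finite, 'v) wspace endo" where
  "Dm p r = opL (demazure p r)"

definition M :: "'n::finite \<Rightarrow> complex ^ 'm ^ 'm::finite \<Rightarrow> ('n, 'm, 'v) wspace endo" where
  "M p A = opT (factor_op p A)"

definition Pt :: "'n::finite perm \<Rightarrow> ('n, 'm::finite, 'v) wspace endo" where
  "Pt \<sigma> = opT (perm_tensor \<sigma>)"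

definition Sg :: "'n::finite perm \<Rightarrow> ('n, 'm::finite, 'v) wspace endo" where
  "Sg \<sigma> = opL (perm_laurent \<sigma>) * Pt \<sigma>"

lemma app_pure [simp]:
  "app (Sc c) (pure f u v) = pure f u (smul c v)"
  "app (Y g) (pure f u v) = pure (g * f) u v"
  "app (Eu p) (pure f u v) = pure (euler_op p f) u v"
  "p \<noteq> r \<Longrightarrow> app (Dm p r) (pure f u v) = pure (demazure p r f) u v"
  "app (M p A) (pure f u v) = pure f (factor_op p A u) v"
  "app (Pt \<sigma>) (pure f u v) = pure f (perm_tensor \<sigma> u) v"
  "app (Sg \<sigma>) (pure f u v) = pure (perm_laurent \<sigma> f) (perm_tensor \<sigma> u) v"
  by (simp_all add: Sc_def Y_def Eu_def Dm_def M_def Pt_def Sg_def app_op_pure)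

lemma pure_smul:
  "pure (laurent_scale c f) u v = pure f u (smul c v)" "pure f (c *s u) v = pure f u (smul c v)"
  by (simp_all add: pure_scale)

lemma app_Sc: "app (Sc c) w = wscale smul c w"
proof (induction w rule: wspace_induct)
  case (pure f u v)
  then show ?case by (simp add: pure_scale)
next
  case (add w w')
  then show ?case
    by (simp add: vector_space.vector_space_assms(1)[OF vector_space_wscale[OF vector_space_axioms]])
qed

lemma Sc_simps:
  "Sc 0 = 0" "Sc 1 = 1" "Sc (c + d) = Sc c + Sc d" "Sc (c * d) = Sc c * Sc d"
  "Sc (- c) = - Sc c" "Sc (c - d) = Sc c - Sc d"
  by (rule endo_eq_pureI; simp add: algebra_simps pure_add pure_diff pure_minus)+

lemma op_Sc:
  "laurent_linear A \<Longrightarrow> opL A * Sc c = Sc c * opL A"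
  "tpower_linear T \<Longrightarrow> opT T * Sc c = Sc c * opT T"
  "coeff_linear D \<Longrightarrow> opV D * Sc c = Sc c * opV D"
  by (rule endo_eq_pureI; simp add: app_op_pure Vector_Spaces.linear_iff)+

lemma Sc_commute:
  "Y g * Sc c = Sc c * Y g" "Eu p * Sc c = Sc c * Eu p" "p \<noteq> r \<Longrightarrow> Dm p r * Sc c = Sc c * Dm p r"
  "M p A * Sc c = Sc c * M p A" "Pt \<sigma> * Sc c = Sc c * Pt \<sigma>" "Sg \<sigma> * Sc c = Sc c * Sg \<sigma>"
  by (rule endo_eq_pureI; simp)+

lemma Y_simps:
  "Y 1 = 1" "Y (f * g) = Y f * Y g" "Y (f + g) = Y f + Y g" "Y 0 = 0" "Y (f - g) = Y f - Y g"
  by (rule endo_eq_pureI; simp add: mult.assoc pure_add pure_diff distrib_right left_diff_distrib)+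

lemma Y_uminus: "Y (- f) = - Y f"
  by (simp add: eq_neg_iff_add_eq_0 Y_simps(4) flip: Y_simps(3))

lemma Y_scale: "Y (laurent_scale c f) = Sc c * Y f"
proof (rule endo_eq_pureI)
  fix g u v
  have "laurent_scale c f * g = laurent_scale c (f * g)"
    by (metis laurent_scale_mult mult.commute)
  then show "app (Y (laurent_scale c f)) (pure g u v) = app (Sc c * Y f) (pure g u v)"
    by (simp add: pure_smul)
qed

lemma Y_sum: "Y (\<Sum>i\<in>I. f i) = (\<Sum>i\<in>I. Y (f i))"
  by (induction I rule: infinite_finite_induct) (simp_all add: Y_simps)

lemma Y_commute: "Y f * Y g = Y g * Y f"
  by (metis Y_simps(2) mult.commute)

lemma M_simps:
  "M p (A + B) = M p A + M p B" "M p (map_matrix ((*) c) A) = Sc c * M p A"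
  "M p A * M p B = M p (A ** B)" "M p (A - B) = M p A - M p B"
proof -
  have "factor_op p (A + B) u = factor_op p A u + factor_op p B u"
    "factor_op p (A - B) u = factor_op p A u - factor_op p B u"
    "factor_op p (map_matrix ((*) c) A) u = c *s factor_op p A u" for u
    by (simp_all add: factor_op_def vec_eq_iff algebra_simps sum.distrib sum_subtractf sum_distrib_left)
  then show "M p (A + B) = M p A + M p B" "M p (map_matrix ((*) c) A) = Sc c * M p A"
    "M p (A - B) = M p A - M p B"
    by (auto intro!: endo_eq_pureI simp: pure_add pure_diff pure_smul)
  show "M p A * M p B = M p (A ** B)"
    by (rule endo_eq_pureI) (simp add: factor_op_factor_op)
qed

lemma M_commute: "p \<noteq> q \<Longrightarrow> M p A * M q B = M q B * M p A"
  by (rule endo_eq_pureI) (simp add: factor_op_commute[of p q])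

lemma M_Y: "M p A * Y g = Y g * M p A"
  by (rule endo_eq_pureI) simp

lemma Pt_Y: "Pt \<sigma> * Y g = Y g * Pt \<sigma>"
  by (rule endo_eq_pureI) simp

lemma Pt_M: "Pt \<sigma> * M q A = M (Perm.apply \<sigma> q) A * Pt \<sigma>"
  by (rule endo_eq_pureI) (simp add: perm_tensor_factor_op)

lemma Pt_swap:
  "p \<noteq> r \<Longrightarrow> Pt (Perm.swap p r) = (\<Sum>a\<in>UNIV. \<Sum>b\<in>UNIV. M p (matrix_unit a b) * M r (matrix_unit b a))"
  by (rule endo_eq_pureI) (simp add: app_sum_endo perm_tensor_swap pure_sum)

lemma Sg_X: "Sg \<sigma> * Y (xpow q j) = Y (xpow (Perm.apply \<sigma> q) j) * Sg \<sigma>"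
  by (rule endo_eq_pureI) (simp add: perm_laurent_xpow_mult)

lemma Sg_M: "Sg \<sigma> * M q A = M (Perm.apply \<sigma> q) A * Sg \<sigma>"
  by (rule endo_eq_pureI) (simp add: perm_tensor_factor_op)

lemma Sg_mult: "Sg \<sigma> * Sg \<tau> = Sg (\<sigma> * \<tau>)" and Sg_one: "Sg 1 = 1"
  by (rule endo_eq_pureI, simp add: perm_tensor_mult_perm perm_laurent_mult_perm)+

lemma X_mult: "Y (xpow p i) * Y (xpow p j) = Y (xpow p (i + j))"
  by (simp add: xpow_mult flip: Y_simps)

lemma Eu_X: "Eu p * Y (xpow q j) = Y (xpow q j) * Eu p + (if p = q then Sc (of_int j) * Y (xpow q j) else 0)"
  by (rule endo_eq_pureI) (auto simp: euler_op_xpow_mult pure_add pure_smul)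

lemma Dm_X_other:
  "p \<noteq> r \<Longrightarrow> q \<noteq> p \<Longrightarrow> q \<noteq> r \<Longrightarrow> Dm p r * Y (xpow q j) = Y (xpow q j) * Dm p r"
  by (rule endo_eq_pureI) (simp add: demazure_xpow_mult_other)

text \<open>The variable swap left over by \<open>demazure_x_left\<close> joins the tensor swap
  \<open>Pt\<close> to form \<open>Sg\<close>, the full group element of the defining
  relations.\<close>

lemma B_X_left:
  "p \<noteq> r \<Longrightarrow> Dm p r * Pt (Perm.swap p r) * Y (xpow p 1) =
     Y (xpow p 1) * (Dm p r * Pt (Perm.swap p r)) + Y (xpow p 1) * Sg (Perm.swap p r)"
  by (rule endo_eq_pureI) (simp add: demazure_x_left pure_add)

lemma B_X_right:
  "p \<noteq> r \<Longrightarrow> Dm p r * Pt (Perm.swap p r) * Y (xpow r 1) =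
     Y (xpow r 1) * (Dm p r * Pt (Perm.swap p r)) - Y (xpow p 1) * Sg (Perm.swap p r)"
  by (rule endo_eq_pureI) (simp add: demazure_x_right pure_diff)

text \<open>The subspace \<open>1 \<otimes> (\<complex>\<^sup>m)\<^bsup>\<otimes>N\<^esup> \<otimes> V\<close> of \<open>W\<close>.\<close>

inductive_set const_tensors :: "('n::finite, 'm::finite, 'v) wspace set" where
  const_tensors_pure: "pure 1 u v \<in> const_tensors"
| const_tensors_add: "c \<in> const_tensors \<Longrightarrow> c' \<in> const_tensors \<Longrightarrow> c + c' \<in> const_tensors"

lemma const_tensors_sum: "(\<And>i. i \<in> I \<Longrightarrow> h i \<in> const_tensors) \<Longrightarrow> (\<Sum>i\<in>I. h i) \<in> const_tensors"
proof (induction I rule: infinite_finite_induct)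
  case (infinite I)
  then show ?case using const_tensors_pure[of 0 0] by simp
next
  case empty
  then show ?case using const_tensors_pure[of 0 0] by simp
qed (simp add: const_tensors_add)

lemma const_tensors_op:
  assumes "c \<in> const_tensors"
  shows "app (M p A) c \<in> const_tensors" "app (Pt \<sigma>) c \<in> const_tensors"
    "coeff_linear D \<Longrightarrow> app (opV D) c \<in> const_tensors"
  using assms by (induction rule: const_tensors.induct) (simp_all add: const_tensors_pure const_tensors_add app_op_pure)

text \<open>After multiplication by \<open>g\<close>, the polynomial factor of a constant tensor is
  exactly \<open>g\<close>, so \<open>A\<close> meets only \<open>g\<close>.\<close>

lemma opL_Y_const_tensors:
  assumes "c \<in> const_tensors" "laurent_linear A"
  shows "app (opL A) (app (Y g) c) = app (Y (A g)) c"
  using assms by (induction rule: const_tensors.induct) (simp_all add: app_op_pure)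

lemma Sg_const_tensors: "c \<in> const_tensors \<Longrightarrow> app (Sg \<sigma>) c = app (Pt \<sigma>) c"
  by (induction rule: const_tensors.induct) simp_all

lemma single_as_X:
  fixes \<alpha> :: "'n::finite \<Rightarrow>\<^sub>0 int"
  shows "Poly_Mapping.single \<alpha> (1::complex) = (\<Prod>p\<in>UNIV. xpow p (Poly_Mapping.lookup \<alpha> p))"
proof -
  have "(\<Prod>p\<in>I. xpow p (h p)) = Poly_Mapping.single (\<Sum>p\<in>I. Poly_Mapping.single p (h p)) (1::complex)"
    for I :: "'n set" and h :: "'n \<Rightarrow> int"
    by (induction I rule: infinite_finite_induct) (simp_all add: xpow_def mult_single)
  moreover have "(\<Sum>p\<in>UNIV. Poly_Mapping.single p (Poly_Mapping.lookup \<alpha> p)) = \<alpha>"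
    by (rule poly_mapping_eqI) (simp add: lookup_sum lookup_single when_def sum.delta)
  ultimately show ?thesis by simp
qed

text \<open>Every monomial is a product of powers of variables, and \<open>K\<close> moves past each
  of them; thus \<open>K\<close> on a tensor with monomial factor is a monomial times
  \<open>K\<close> on a constant tensor.\<close>

lemma intertwiner_eq_0:
  fixes K :: "('n::finite, 'm::finite, 'v) wspace endo"
  assumes X: "\<And>p. K * Y (xpow p 1) = Y (xpow (\<pi> p) 1) * K"
    and K0: "\<And>c. c \<in> const_tensors \<Longrightarrow> app K c = 0"
  shows "K = 0"
proof -
  have inv: "Y (xpow p (- 1)) * Y (xpow p 1) = (1 :: ('n, 'm, 'v) wspace endo)"
    "Y (xpow p 1) * Y (xpow p (- 1)) = (1 :: ('n, 'm, 'v) wspace endo)" for p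
    by (simp_all add: X_mult Y_simps)
  \<comment> \<open>Multiplying the relation for \<open>x_p\<close> by inverses on both sides gives
    the one for the inverse of \<open>x_p\<close>, and then all integer powers follow.\<close>
  have X': "K * Y (xpow p (- 1)) = Y (xpow (\<pi> p) (- 1)) * K" for p
  proof -
    have "Y (xpow (\<pi> p) (- 1)) * (Y (xpow (\<pi> p) 1) * K) * Y (xpow p (- 1)) = K * Y (xpow p (- 1))"
      by (simp add: inv flip: mult.assoc)
    moreover have "Y (xpow (\<pi> p) (- 1)) * (K * Y (xpow p 1)) * Y (xpow p (- 1)) = Y (xpow (\<pi> p) (- 1)) * K"
      by (simp add: mult.assoc inv)
    ultimately show ?thesis by (simp add: X)
  qed
  have step: "K * Y (xpow p j) = Y (xpow (\<pi> p) j) * K" for p j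
  proof (induction j rule: int_induct[where k = 0])
    case base
    then show ?case by (simp add: Y_simps)
  next
    case (step1 i)
    have "K * Y (xpow p (i + 1)) = K * Y (xpow p i) * Y (xpow p 1)"
      by (simp add: mult.assoc X_mult)
    also have "\<dots> = Y (xpow (\<pi> p) (i + 1)) * K"
      by (simp add: step1 mult.assoc X) (simp add: X_mult flip: mult.assoc)
    finally show ?case .
  next
    case (step2 i)
    have "K * Y (xpow p (i - 1)) = K * Y (xpow p i) * Y (xpow p (- 1))"
      by (simp add: mult.assoc X_mult)
    also have "\<dots> = Y (xpow (\<pi> p) (i - 1)) * K"
      by (simp add: step2 mult.assoc X') (simp add: X_mult flip: mult.assoc)
    finally show ?case .
  qed
  have prod: "K * Y (\<Prod>p\<in>I. xpow p (h p)) = Y (\<Prod>p\<in>I. xpow (\<pi> p) (h p)) * K" for I and h :: "'n \<Rightarrow> int"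
  proof (induction I rule: infinite_finite_induct)
    case (insert p I)
    have "K * Y (\<Prod>p\<in>insert p I. xpow p (h p)) = K * Y (xpow p (h p)) * Y (\<Prod>p\<in>I. xpow p (h p))"
      using insert by (simp add: Y_simps mult.assoc)
    then show ?case using insert by (simp add: step mult.assoc Y_simps)
  qed (simp_all add: Y_simps)
  show ?thesis
  proof (rule endo_eq_pureI)
    fix f u v
    have "app K (pure (Poly_Mapping.single \<alpha> c) u v) = 0" for \<alpha> c
    proof -
      have "pure (Poly_Mapping.single \<alpha> c) u v = pure (laurent_scale c (Poly_Mapping.single \<alpha> 1)) u v"
        by (rule arg_cong[of _ _ "\<lambda>f. pure f u v"], rule poly_mapping_eqI)
          (simp add: lookup_laurent_scale lookup_single when_def)
      also have "\<dots> = app (Y (Poly_Mapping.single \<alpha> 1)) (pure 1 u (smul c v))"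
        by (simp add: pure_smul)
      finally have "app K (pure (Poly_Mapping.single \<alpha> c) u v) =
          app (K * Y (Poly_Mapping.single \<alpha> 1)) (pure 1 u (smul c v))"
        by simp
      then show ?thesis
        by (simp only: single_as_X prod app_endo K0 const_tensors_pure app_zero)
    qed
    then show "app K (pure f u v) = app 0 (pure f u v)"
      by (subst poly_mapping_sum_monomials[of f]) (simp only: pure_sum app_sum app_endo sum.neutral_const)
  qed
qed

end


section \<open>The operators of the loop algebra and the Casimir sums\<close>

text \<open>The projection of all matrices onto trace zero along the scalar matrices. It keeps
  \<open>rho\<close> within the subalgebra where it is constrained.\<close>

definition traceless :: "complex ^ 'm ^ 'm \<Rightarrow> complex ^ 'm ^ 'm::finite" where
  "traceless A = A - mat (trace A / of_nat CARD('m))"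

lemma trace_traceless [simp]: "trace (traceless A) = 0"
  by (simp add: traceless_def trace_diff_matrix trace_mat)

lemma traceless_id: "trace A = 0 \<Longrightarrow> traceless A = A"
  by (simp add: traceless_def vec_eq_iff mat_def)

lemma traceless_add: "traceless (A + B) = traceless A + traceless B"
  by (simp add: traceless_def trace_add_matrix vec_eq_iff mat_def add_divide_distrib)

lemma traceless_scale: "traceless (map_matrix ((*) c) A) = map_matrix ((*) c) (traceless A)"
  by (simp add: traceless_def trace_scale vec_eq_iff mat_def right_diff_distrib)

text \<open>Scalar matrices are central and commutators have trace zero, so the projection is a
  homomorphism of Lie algebras.\<close>

lemma traceless_commutator:
  "traceless A ** traceless B - traceless B ** traceless A = traceless (A ** B - B ** A)"
proof -
  have "traceless (A ** B - B ** A) = A ** B - B ** A"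
    by (rule traceless_id) (simp add: trace_diff_matrix trace_mult_commute[of A B])
  moreover have "traceless A ** traceless B - traceless B ** traceless A = A ** B - B ** A"
    by (simp add: traceless_def matrix_diff_ldistrib matrix_diff_rdistrib mat_mult_left mat_mult_right)
      (simp add: vec_eq_iff mat_def algebra_simps diff_divide_distrib)
  ultimately show ?thesis by simp
qed

text \<open>The trace pairing with a matrix of trace zero does not see the subtracted scalar matrix.
  The value is the coefficient of the central term in \<open>T_R_level\<close>.\<close>

lemma trace_traceless_unit_mult:
  "trace A = 0 \<Longrightarrow> trace (traceless (matrix_unit b a) ** A) = A $ a $ b"
  by (simp add: traceless_def matrix_diff_rdistrib trace_diff_matrix mat_mult_left trace_scale
      trace_matrix_unit_mult)

lemma loop_in_affine_sl [simp]: "trace A = 0 \<Longrightarrow> loop A i \<in> affine_sl"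
  by (simp add: affine_sl_def loop_def lookup_single when_def)

lemma loop_add: "loop (A + B) i = loop A i + loop B i"
  by (simp add: loop_def single_add)

lemma loop_scale: "loop (map_matrix ((*) c) A) i = affine_scale c (loop A i)"
proof -
  have "map_matrix ((*) c) 0 = (0 :: complex ^ 'm ^ 'm)"
    by (simp add: vec_eq_iff)
  then show ?thesis
    by (auto simp: loop_def affine_scale_def Poly_Mapping.map.rep_eq lookup_single when_def
        intro!: poly_mapping_eqI)
qed

lemma central_in_affine_sl [simp]: "central \<in> (affine_sl :: 'm::finite affine_gl set)"
  "affine_scale c central \<in> (affine_sl :: 'm affine_gl set)"
proof -
  have "Poly_Mapping.map (map_matrix ((*) c)) (0 :: int \<Rightarrow>\<^sub>0 complex ^ 'm ^ 'm) = 0"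
    by (rule poly_mapping_eqI) (simp add: Poly_Mapping.map.rep_eq)
  then show "central \<in> (affine_sl :: 'm affine_gl set)"
    "affine_scale c central \<in> (affine_sl :: 'm affine_gl set)"
    by (simp_all add: central_def affine_sl_def affine_scale_def)
qed

lemma affine_scale_zero [simp]: "affine_scale 0 central = 0"
  by (auto simp: central_def affine_scale_def zero_prod_def Poly_Mapping.map.rep_eq intro!: poly_mapping_eqI)

lemma affine_bracket_loop:
  fixes A B :: "complex ^ 'm ^ 'm::finite"
  shows "affine_bracket (loop A i) (loop B j) =
     loop (A ** B - B ** A) (i + j) + affine_scale (if i = - j then of_int i * trace (A ** B) else 0) central"
proof (cases "A = 0 \<or> B = 0")
  \<comment> \<open>The polynomial of \<open>loop 0 i\<close> has no keys, so the defining sums of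
    the bracket are empty; this case has to be separated.\<close>
  case True
  have "0 ** C = 0" "C ** 0 = 0" for C :: "complex ^ 'm ^ 'm"
    by (simp_all add: vec_eq_iff matrix_matrix_mult_def)
  moreover have "loop 0 k = (0 :: 'm affine_gl)" for k by (simp add: loop_def zero_prod_def)
  ultimately show ?thesis using True by (auto simp: affine_bracket_def loop_def)
next
  case False
  then show ?thesis by (simp add: affine_bracket_def loop_def Let_def)
qed

locale annihilated_module = tensor_space smul + affine_sl_module smul rho
  for smul :: "complex \<Rightarrow> 'v::ab_group_add \<Rightarrow> 'v" and rho :: "'m::finite affine_gl \<Rightarrow> 'v \<Rightarrow> 'v" +
  assumes annihilation: "\<exists>i. \<forall>\<xi>\<in>loop_sl {i..}. rho \<xi> v = 0"
begin

text \<open>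
  Subtracting the trace makes \<open>A t\<^sup>i\<close> act on \<open>V\<close> for every matrix \<open>A\<close>, linearly in \<open>A\<close>; the
  identity matrix acts as zero.
\<close>

definition rv :: "complex ^ 'm ^ 'm \<Rightarrow> int \<Rightarrow> 'v \<Rightarrow> 'v" where
  "rv A i = rho (loop (traceless A) i)"

lemma coeff_linear_rv [simp]: "coeff_linear (rv A i)" and coeff_linear_central [simp]: "coeff_linear (rho central)"
  by (simp_all add: rv_def linear_rho)

lemma rv_add: "rv (A + B) i v = rv A i v + rv B i v"
  by (simp add: rv_def traceless_add loop_add rho_add)

lemma rv_scale: "rv (map_matrix ((*) c) A) i v = smul c (rv A i v)"
  by (simp add: rv_def traceless_scale loop_scale rho_scale)

lemma rv_commutator:
  "rv A i (rv B j v) - rv B j (rv A i v) = rv (A ** B - B ** A) (i + j) v +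
     (if i = - j then smul (of_int i * trace (traceless A ** traceless B)) (rho central v) else 0)"
  by (simp add: rv_def affine_bracket_loop rho_add rho_scale traceless_commutator flip: rho_bracket)

definition R :: "complex ^ 'm ^ 'm \<Rightarrow> int \<Rightarrow> ('n::finite, 'm, 'v) wspace endo" where
  "R A i = opV (rv A i)"

definition Lv :: "('n::finite, 'm, 'v) wspace endo" where
  "Lv = opV (rho central)"

lemma app_R_pure [simp]: "app (R A i) (pure f u v) = pure f u (rv A i v)"
  and app_Lv_pure [simp]: "app Lv (pure f u v) = pure f u (rho central v)"
  by (simp_all add: R_def Lv_def app_op_pure)

lemma R_simps: "R (A + B) i = R A i + R B i" "R (map_matrix ((*) c) A) i = Sc c * R A i"
  by (rule endo_eq_pureI, simp add: rv_add rv_scale pure_add)+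

lemma R_diff: "R (A - B) i = R A i - R B i"
  by (simp add: eq_diff_eq flip: R_simps(1))

lemma R_commute: "R A i * Y g = Y g * R A i" "R A i * M p B = M p B * R A i"
  "R A i * Pt \<sigma> = Pt \<sigma> * R A i" "R A i * Sg \<sigma> = Sg \<sigma> * R A i" "R A i * Sc c = Sc c * R A i"
proof -
  show "R A i * Sc c = Sc c * R A i" by (simp add: R_def Sc_def[symmetric] op_Sc)
qed (rule endo_eq_pureI, simp)+

lemma R_commutator:
  "R A i * R B j = R B j * R A i + R (A ** B - B ** A) (i + j) +
     (if i = - j then Sc (of_int i * trace (traceless A ** traceless B)) * Lv else 0)"
  using rv_commutator[of A i B j] by (intro endo_eq_pureI) (simp add: diff_eq_eq pure_add)

text \<open>The annihilation condition for one vector of \<open>V\<close> bounds the degree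
  uniformly in \<open>A\<close>, and an element of \<open>W\<close> involves only finitely many such
  vectors. All infinite sums below become finite by this.\<close>

lemma R_bound: "\<exists>n. \<forall>i\<ge>n. \<forall>A. app (R A (int i)) w = 0"
proof (induction w rule: wspace_induct)
  case (pure f u v)
  obtain k where k: "\<And>\<xi>. \<xi> \<in> loop_sl {k..} \<Longrightarrow> rho \<xi> v = 0" using annihilation by blast
  have "rv A (int i) v = 0" if "i \<ge> nat k" for A i
    unfolding rv_def by (rule k) (use that in \<open>auto simp: loop_sl_def loop_in_affine_sl, auto simp: loop_def split: if_splits\<close>)
  then show ?case by (intro exI[of _ "nat k"]) simp
next
  case (add w w')
  then obtain n n' where "\<forall>i\<ge>n. \<forall>A. app (R A (int i)) w = 0" "\<forall>i\<ge>n'. \<forall>A. app (R A (int i)) w' = 0" by blast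
  then show ?case by (intro exI[of _ "max n n'"]) simp
qed

section \<open>The Casimir coefficients and their commutators\<close>

definition T :: "'n::finite \<Rightarrow> int \<Rightarrow> ('n, 'm, 'v) wspace endo" where
  "T p i = (\<Sum>a\<in>UNIV. \<Sum>b\<in>UNIV. M p (matrix_unit a b) * R (matrix_unit b a) i)"

text \<open>This is minus the commutator of \<open>T p i\<close> with \<open>M p A\<close>, and also
  the commutator of \<open>T p k\<close> with \<open>R A j\<close> for \<open>k + j = i\<close>, up
  to the central term.\<close>

definition ad_T :: "'n::finite \<Rightarrow> complex ^ 'm ^ 'm \<Rightarrow> int \<Rightarrow> ('n, 'm, 'v) wspace endo" where
  "ad_T p A i = (\<Sum>a\<in>UNIV. \<Sum>b\<in>UNIV.
     M p (matrix_unit a b) * R (matrix_unit b a ** A - A ** matrix_unit b a) i)"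

lemma MR_transfer:
  "(\<Sum>a\<in>UNIV. \<Sum>b\<in>UNIV. M p (matrix_unit a b ** P) * R (matrix_unit b a) i) =
     (\<Sum>a\<in>UNIV. \<Sum>b\<in>UNIV. M p (matrix_unit a b) * R (P ** matrix_unit b a) i)"
  "(\<Sum>a\<in>UNIV. \<Sum>b\<in>UNIV. M p (P ** matrix_unit a b) * R (matrix_unit b a) i) =
     (\<Sum>a\<in>UNIV. \<Sum>b\<in>UNIV. M p (matrix_unit a b) * R (matrix_unit b a ** P) i)"
  by (rule casimir_transfer[of "\<lambda>A B. M p A * R B i"];
      simp add: M_simps R_simps distrib_left distrib_right Sc_commute flip: mult.assoc)+

text \<open>Invariance of the Casimir element moves the commutator from the \<open>V\<close> slot to
  the tensor slot, with opposite sign.\<close>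

lemma ad_T_alt:
  "ad_T p A i = (\<Sum>a\<in>UNIV. \<Sum>b\<in>UNIV.
     M p (A ** matrix_unit a b - matrix_unit a b ** A) * R (matrix_unit b a) i)"
  by (simp add: ad_T_def M_simps R_diff left_diff_distrib right_diff_distrib sum_subtractf MR_transfer)

lemma T_Y: "T p i * Y g = Y g * T p i"
  unfolding T_def sum_distrib_left sum_distrib_right
  by (intro sum.cong refl) (simp add: mult.assoc R_commute, simp add: M_Y flip: mult.assoc)

lemma T_Sc: "T p i * Sc c = Sc c * T p i"
  unfolding T_def sum_distrib_left sum_distrib_right
  by (intro sum.cong refl) (simp add: mult.assoc R_commute, simp add: Sc_commute flip: mult.assoc)

lemma T_M_other: "p \<noteq> q \<Longrightarrow> T p i * M q A = M q A * T p i"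
  unfolding T_def sum_distrib_left sum_distrib_right
  by (intro sum.cong refl) (simp add: mult.assoc R_commute, simp add: M_commute flip: mult.assoc)

lemma T_M_same: "T p i * M p A = M p A * T p i - ad_T p A i"
  unfolding T_def ad_T_alt sum_distrib_left sum_distrib_right sum_subtractf[symmetric]
  by (intro sum.cong refl)
    (simp add: M_simps left_diff_distrib mult.assoc R_commute, simp add: M_simps flip: mult.assoc)

text \<open>The premise excludes the central term: the cocycle vanishes unless the degrees add up to
  zero, and its factor \<open>i\<close> vanishes for \<open>i = 0\<close>.\<close>

lemma T_R:
  fixes p :: "'n::finite"
  assumes "i \<noteq> - j \<or> i = 0"
  shows "T p i * R A j = R A j * T p i + ad_T p A (i + j)"
proof -
  have "M p (matrix_unit a b) * R (matrix_unit b a) i * R A j =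
     R A j * (M p (matrix_unit a b) * R (matrix_unit b a) i) +
     M p (matrix_unit a b) * R (matrix_unit b a ** A - A ** matrix_unit b a) (i + j)" for a b
  proof -
    have "R (matrix_unit b a) i * R A j = R A j * R (matrix_unit b a) i
       + (R (matrix_unit b a ** A - A ** matrix_unit b a) (i + j) :: ('n, 'm, 'v) wspace endo)"
      using assms by (auto simp: R_commutator[of _ i] Sc_simps)
    then show ?thesis
      by (simp add: mult.assoc distrib_left, simp add: R_commute flip: mult.assoc)
  qed
  then show ?thesis
    by (simp add: T_def ad_T_def sum_distrib_left sum_distrib_right sum.distrib)
qed

text \<open>The central terms carry the coefficients \<open>i * A $ a $ b\<close>; summed against
  the matrix units in factor \<open>p\<close> they rebuild \<open>A\<close>.\<close>

lemma T_R_level: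
  fixes p :: "'n::finite"
  assumes "trace A = 0"
  shows "T p i * R A (- i) = R A (- i) * T p i + ad_T p A 0 + Sc (of_int i) * M p A * Lv"
proof -
  have *: "M p (matrix_unit a b) * R (matrix_unit b a) i * R A (- i) =
     R A (- i) * (M p (matrix_unit a b) * R (matrix_unit b a) i) +
     M p (matrix_unit a b) * R (matrix_unit b a ** A - A ** matrix_unit b a) 0 +
     Sc (of_int i) * M p (map_matrix ((*) (A $ a $ b)) (matrix_unit a b)) * Lv" for a b
  proof -
    have "R (matrix_unit b a) i * R A (- i) = R A (- i) * R (matrix_unit b a) i
       + (R (matrix_unit b a ** A - A ** matrix_unit b a) 0 :: ('n, 'm, 'v) wspace endo)
       + Sc (of_int i * A $ a $ b) * Lv"
      using assms by (simp add: R_commutator[of _ i] traceless_id trace_traceless_unit_mult)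
    then show ?thesis
      by (simp add: mult.assoc distrib_left, simp add: R_commute M_simps Sc_commute flip: mult.assoc Sc_simps(4))
  qed
  have "(\<Sum>a\<in>UNIV. \<Sum>b\<in>UNIV. M p (map_matrix ((*) (A $ a $ b)) (matrix_unit a b))) = (M p A :: ('n, 'm, 'v) wspace endo)"
  proof -
    have 0: "M p 0 = (0 :: ('n, 'm, 'v) wspace endo)" using M_simps(4)[of p 0 0] by simp
    have "M p (\<Sum>i\<in>I. F i) = (\<Sum>i\<in>I. M p (F i) :: ('n, 'm, 'v) wspace endo)" for I :: "'m set" and F
      by (induction I rule: infinite_finite_induct) (simp_all add: 0 M_simps)
    then show ?thesis
      using arg_cong[OF matrix_sum_units[of A], of "M p :: _ \<Rightarrow> ('n, 'm, 'v) wspace endo"] by simp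
  qed
  then have "Sc (of_int i) * M p A * Lv = (\<Sum>a\<in>UNIV. \<Sum>b\<in>UNIV.
      Sc (of_int i) * M p (map_matrix ((*) (A $ a $ b)) (matrix_unit a b)) * (Lv :: ('n, 'm, 'v) wspace endo))"
    by (simp flip: sum_distrib_left sum_distrib_right)
  then show ?thesis
    by (simp add: T_def ad_T_def sum_distrib_left sum_distrib_right sum.distrib *)
qed

text \<open>Commuting \<open>T p i\<close> past the \<open>R\<close> factors of \<open>T q j\<close>
  leaves commutators with \<open>E_dc\<close> in factor \<open>p\<close>; paired with
  \<open>E_cd\<close> in factor \<open>q\<close> they add up to a commutator with the flip of
  \<open>p\<close> and \<open>q\<close>. Nonnegative degrees exclude the central term.\<close>

lemma T_commutator:
  fixes p q :: "'n::finite"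
  assumes "p \<noteq> q" "i \<ge> 0" "j \<ge> 0"
  shows "T p i * T q j = T q j * T p i + Pt (Perm.swap p q) * (T p (i + j) - T q (i + j))"
proof -
  let ?S = "\<lambda>f. (\<Sum>a\<in>UNIV. \<Sum>b\<in>UNIV. f a b) :: ('n, 'm, 'v) wspace endo"
  let ?E = "matrix_unit :: 'm \<Rightarrow> 'm \<Rightarrow> _"
  have cond: "i \<noteq> - j \<or> i = 0" using assms by auto
  have swap4: "?S (\<lambda>c d. ?S (\<lambda>a b. h a b c d)) = ?S (\<lambda>a b. ?S (\<lambda>c d. h a b c d))" for h
  proof -
    have "?S (\<lambda>c d. ?S (\<lambda>a b. h a b c d)) = ?S (\<lambda>c a. ?S (\<lambda>d b. h a b c d))"
      by (intro sum.cong refl sum.swap)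
    also have "\<dots> = ?S (\<lambda>a c. ?S (\<lambda>d b. h a b c d))"
      by (rule sum.swap)
    also have "\<dots> = ?S (\<lambda>a c. ?S (\<lambda>b d. h a b c d))"
      by (intro sum.cong refl sum.swap)
    also have "\<dots> = ?S (\<lambda>a b. ?S (\<lambda>c d. h a b c d))"
      by (intro sum.cong refl sum.swap)
    finally show ?thesis .
  qed
  have lc: "M p A * (M q B * y) = M q B * (M p A * y)" for A B and y :: "('n, 'm, 'v) wspace endo"
    by (simp add: M_commute[OF assms(1)] flip: mult.assoc)
  have "T p i * (M q (?E c d) * R (?E d c) j) =
      M q (?E c d) * R (?E d c) j * T p i + M q (?E c d) * ad_T p (?E d c) (i + j)" for c d
  proof -
    have "T p i * (M q (?E c d) * R (?E d c) j) = M q (?E c d) * (T p i * R (?E d c) j)"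
      using T_M_other[OF assms(1), of i "?E c d"] by (simp flip: mult.assoc)
    then show ?thesis by (simp add: T_R[OF cond] distrib_left mult.assoc)
  qed
  then have "T p i * T q j = T q j * T p i + ?S (\<lambda>c d. M q (?E c d) * ad_T p (?E d c) (i + j))"
    unfolding T_def[of q j] sum_distrib_left sum_distrib_right by (simp add: sum.distrib)
  also have "?S (\<lambda>c d. M q (?E c d) * ad_T p (?E d c) (i + j)) =
    ?S (\<lambda>c d. ?S (\<lambda>a b. (M q (?E c d) * M p (?E d c) * M p (?E a b) - M p (?E a b) * (M q (?E c d) * M p (?E d c)))
      * R (?E b a) (i + j)))"
    unfolding ad_T_alt sum_distrib_left
    by (intro sum.cong refl)
      (simp add: M_simps(4) right_diff_distrib left_diff_distrib mult.assoc lc flip: M_simps(3))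
  also have "\<dots> = ?S (\<lambda>a b. ?S (\<lambda>c d. (M q (?E c d) * M p (?E d c) * M p (?E a b) - M p (?E a b) * (M q (?E c d) * M p (?E d c)))
      * R (?E b a) (i + j)))"
    by (rule swap4)
  \<comment> \<open>The sums over \<open>c\<close> and \<open>d\<close> are the expansion
    \<open>Pt_swap\<close> of the flip.\<close>
  also have "\<dots> = ?S (\<lambda>a b. (Pt (Perm.swap q p) * M p (?E a b) - M p (?E a b) * Pt (Perm.swap q p)) * R (?E b a) (i + j))"
    using assms(1) by (simp add: Pt_swap sum_distrib_left sum_distrib_right sum_subtractf left_diff_distrib right_diff_distrib)
  also have "\<dots> = ?S (\<lambda>a b. Pt (Perm.swap q p) * (M p (?E a b) - M q (?E a b)) * R (?E b a) (i + j))"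
    by (simp add: Pt_M right_diff_distrib)
  also have "\<dots> = Pt (Perm.swap p q) * (T p (i + j) - T q (i + j))"
    by (simp add: T_def mult.assoc swap_sym[of q p] left_diff_distrib right_diff_distrib sum_subtractf flip: sum_distrib_left)
  finally show ?thesis .
qed

end


section \<open>The operators of the elements \<open>z\<^sub>p\<close>\<close>

lemma mult_assoc_rule: "a * b = c \<Longrightarrow> a * (b * y) = c * (y :: 'a::ring)"
  by (simp flip: mult.assoc)

lemma app_commute: "F * G = G' * F' \<Longrightarrow> app F (app G x) = app G' (app F' x)"
  by (simp flip: app_endo(6))

lemma swap_conj: "\<sigma> * Perm.swap p r = Perm.swap (Perm.apply \<sigma> p) (Perm.apply \<sigma> r) * \<sigma>"
proof (rule perm_eqI)
  fix a
  show "Perm.apply (\<sigma> * Perm.swap p r) a = Perm.apply (Perm.swap (Perm.apply \<sigma> p) (Perm.apply \<sigma> r) * \<sigma>) a"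
    by (cases "a = p"; cases "a = r") (simp_all add: Perm.apply_times apply_inj)
qed

text \<open>
  The Jacobi identity for \<open>z\<^sub>p\<close>, \<open>z\<^sub>q\<close> and \<open>x\<^sub>r\<close>, with \<open>r \<noteq> p, q\<close> and with \<open>r = p\<close>. Here \<open>s\<close>,
  \<open>sp\<close>, \<open>sq\<close> stand for \<open>\<sigma>\<^bsub>pq\<^esub>\<close>, \<open>\<sigma>\<^bsub>pr\<^esub>\<close>, \<open>\<sigma>\<^bsub>qr\<^esub>\<close>, and \<open>G\<close> for the sum of all \<open>\<sigma>\<^bsub>pr\<^esub>\<close> with \<open>r \<noteq> p, q\<close>.
\<close>

lemma cherednik_jacobi_other:
  fixes Zp :: "'a::ring"
  assumes "Zp * Xr = Xr * Zp - Xp * sp" "Zq * Xr = Xr * Zq - Xq * sq"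
    "Zp * Xq = Xq * Zp - Xp * s" "Zq * Xp = Xp * Zq - Xq * s"
    "sp * Zq = Zq * sp" "sq * Zp = Zp * sq" "s * Xr = Xr * s" "s * Xp = Xq * s" "s * Xq = Xp * s"
  shows "(Zp * Zq - Zq * Zp - s * (Zp - Zq)) * Xr = Xr * (Zp * Zq - Zq * Zp - s * (Zp - Zq))"
  by (simp add: assms assms[THEN mult_assoc_rule] algebra_simps)

lemma cherednik_jacobi_same:
  fixes Zp :: "'a::{ring, monoid_mult}"
  assumes "Zp * Xp = Xp * Zp + k * Xp + Xp * s + Xp * G" "Zq * Xp = Xp * Zq - Xq * s"
    "Zp * Xq = Xq * Zp - Xp * s" "s * Xp = Xq * s" "s * Xq = Xp * s" "Zq * s = s * Zp" "Zp * s = s * Zq"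
    "s * s = 1" "G * Zq = Zq * G" "Zq * k = k * Zq" "Xp * k = k * Xp" "s * k = k * s"
  shows "(Zp * Zq - Zq * Zp - s * (Zp - Zq)) * Xp = Xp * (Zp * Zq - Zq * Zp - s * (Zp - Zq))"
  by (simp add: assms assms[THEN mult_assoc_rule] algebra_simps)

context annihilated_module
begin

abbreviation Xm :: "'n::finite \<Rightarrow> int \<Rightarrow> ('n, 'm, 'v) wspace endo" where
  "Xm p j \<equiv> Y (xpow p j)"

abbreviation B :: "'n::finite \<Rightarrow> 'n \<Rightarrow> ('n, 'm, 'v) wspace endo" where
  "B p r \<equiv> Dm p r * Pt (Perm.swap p r)"

lemma T_zero: "app (T p i) w = 0" "app (ad_T p A i) w = 0" if "\<And>A. app (R A i) w = 0"
  by (simp_all add: T_def ad_T_def app_sum_endo that)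

lemma T_bound: "\<exists>n. \<forall>i\<ge>n. \<forall>p. app (T p (int i)) w = 0 \<and> (\<forall>A. app (ad_T p A (int i)) w = 0)"
  using R_bound[of w] T_zero by blast

text \<open>The third summand of \<open>z_p\<close>. The number of nonzero terms depends on the
  vector, so the sum is formed pointwise and not in the endomorphism ring.\<close>

definition Cas :: "'n::finite \<Rightarrow> ('n, 'm, 'v) wspace endo" where
  "Cas p = Endo (\<lambda>w. Sum_any (\<lambda>i. app (Xm p (- int i) * T p (int i)) w))"

lemma finite_Cas: "finite {i. app (Xm p (- int i) * T p (int i)) w \<noteq> 0}"
proof -
  obtain n where "\<forall>i\<ge>n. app (T p (int i)) w = 0" using T_bound[of w] by blast
  then have "{i. app (Xm p (- int i) * T p (int i)) w \<noteq> 0} \<subseteq> {..<n}"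
    by auto (metis app_zero not_le)
  then show ?thesis using finite_subset by blast
qed

lemma app_Cas: "app (Cas p) w = Sum_any (\<lambda>i. app (Xm p (- int i) * T p (int i)) w)"
proof -
  have "app (Cas p) = (\<lambda>w. Sum_any (\<lambda>i. app (Xm p (- int i) * T p (int i)) w))"
    unfolding Cas_def by (rule app_Endo) (simp only: app_add Sum_any.distrib[OF finite_Cas finite_Cas])
  then show ?thesis by simp
qed

text \<open>Any sufficiently large bound is allowed, so that sums for different vectors can be put
  over one range.\<close>

lemma app_Cas_sum:
  assumes "\<And>i. i \<ge> n \<Longrightarrow> app (T p (int i)) w = 0"
  shows "app (Cas p) w = (\<Sum>i<n. app (Xm p (- int i)) (app (T p (int i)) w))"
  unfolding app_Cas
proof (subst Sum_any.expand_superset[of "{..<n}"])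
  show "{i. app (Xm p (- int i) * T p (int i)) w \<noteq> 0} \<subseteq> {..<n}"
    using assms by auto (metis app_zero not_le)
qed simp_all

text \<open>An identity for each term suffices: the sums at \<open>w\<close> and at the image of
  \<open>w\<close> under \<open>F\<close> are truncated at a common bound.\<close>

lemma Cas_intertwine:
  assumes "\<And>i. F * (Xm p (- i) * T p i) = (Xm q (- i) * T q i) * F"
  shows "F * Cas p = Cas q * F"
proof (rule endo_eqI)
  fix w
  obtain n n' where n: "\<forall>i\<ge>n. \<forall>p. app (T p (int i)) w = 0"
    and n': "\<forall>i\<ge>n'. \<forall>p. app (T p (int i)) (app F w) = 0"
    using T_bound[of w] T_bound[of "app F w"] by meson
  have F: "app F (app (Xm p (- i)) (app (T p i) w)) = app (Xm q (- i)) (app (T q i) (app F w))" for i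
    using arg_cong[OF assms[of i], of "\<lambda>G. app G w"] by simp
  have "app (Cas p) w = (\<Sum>i<max n n'. app (Xm p (- int i)) (app (T p (int i)) w))"
    by (rule app_Cas_sum) (simp add: n)
  moreover have "app (Cas q) (app F w) = (\<Sum>i<max n n'. app (Xm q (- int i)) (app (T q (int i)) (app F w)))"
    by (rule app_Cas_sum) (simp add: n')
  ultimately show "app (F * Cas p) w = app (Cas q * F) w"
    by (simp add: app_sum F)
qed

lemma Cas_Y: "Y g * Cas p = Cas p * Y g"
  by (rule Cas_intertwine) (simp add: mult.assoc T_Y, simp add: Y_commute[of g] flip: mult.assoc)

lemma Cas_Sc: "Sc c * Cas p = Cas p * Sc c"
  by (rule Cas_intertwine) (simp add: mult.assoc T_Sc, simp add: Sc_commute flip: mult.assoc)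

lemma Sg_T: "Sg \<sigma> * T p i = T (Perm.apply \<sigma> p) i * Sg \<sigma>"
  unfolding T_def sum_distrib_left sum_distrib_right
  by (intro sum.cong refl) (simp add: mult.assoc R_commute, simp add: Sg_M flip: mult.assoc)

lemma Sg_Cas: "Sg \<sigma> * Cas p = Cas (Perm.apply \<sigma> p) * Sg \<sigma>"
  by (rule Cas_intertwine) (simp add: mult.assoc flip: Sg_T, simp add: Sg_X flip: mult.assoc)

definition Z :: "complex \<Rightarrow> 'n::finite \<Rightarrow> ('n, 'm, 'v) wspace endo" where
  "Z \<kappa> p = Sc \<kappa> * Eu p + (\<Sum>r\<in>UNIV - {p}. B p r) + Cas p"

text \<open>The Euler operator for \<open>p\<close> and the Casimir sum commute with
  \<open>x_q\<close>, and so do all divided differences except the one with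
  \<open>r = q\<close>.\<close>

lemma Z_X_other:
  assumes "q \<noteq> p"
  shows "Z \<kappa> p * Xm q 1 = Xm q 1 * Z \<kappa> p - Xm p 1 * Sg (Perm.swap p q)"
proof -
  have "(\<Sum>r\<in>UNIV - {p}. B p r * Xm q 1) =
    (\<Sum>r\<in>UNIV - {p}. Xm q 1 * B p r - (if r = q then Xm p 1 * Sg (Perm.swap p q) else 0))"
  proof (rule sum.cong)
    fix r assume "r \<in> UNIV - {p}"
    then show "B p r * Xm q 1 = Xm q 1 * B p r - (if r = q then Xm p 1 * Sg (Perm.swap p q) else 0)"
      using assms
      by (cases "r = q")
        (simp add: B_X_right, simp add: mult.assoc Pt_Y, simp add: Dm_X_other flip: mult.assoc)
  qed simp
  then have "(\<Sum>r\<in>UNIV - {p}. B p r) * Xm q 1 =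
      Xm q 1 * (\<Sum>r\<in>UNIV - {p}. B p r) - Xm p 1 * Sg (Perm.swap p q)"
    using assms by (simp add: sum_distrib_left sum_distrib_right sum_subtractf sum.delta)
  moreover have "Sc \<kappa> * Eu p * Xm q 1 = Xm q 1 * (Sc \<kappa> * Eu p)"
    using assms by (simp add: mult.assoc Eu_X) (simp add: Sc_commute flip: mult.assoc)
  ultimately show ?thesis
    by (simp add: Z_def distrib_left distrib_right Cas_Y)
qed

lemma Z_X_same:
  "Z \<kappa> p * Xm p 1 = Xm p 1 * Z \<kappa> p + Sc \<kappa> * Xm p 1 + (\<Sum>r\<in>UNIV - {p}. Xm p 1 * Sg (Perm.swap p r))"
proof -
  have "(\<Sum>r\<in>UNIV - {p}. B p r * Xm p 1) = (\<Sum>r\<in>UNIV - {p}. Xm p 1 * B p r + Xm p 1 * Sg (Perm.swap p r))"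
    by (intro sum.cong refl) (simp add: B_X_left)
  moreover have "Sc \<kappa> * Eu p * Xm p 1 = Xm p 1 * (Sc \<kappa> * Eu p) + Sc \<kappa> * Xm p 1"
    by (simp add: mult.assoc Eu_X distrib_left Sc_simps) (simp add: Sc_commute flip: mult.assoc)
  ultimately show ?thesis
    by (simp add: Z_def distrib_left distrib_right Cas_Y sum_distrib_left sum_distrib_right sum.distrib)
qed

lemma Sg_Z: "Sg \<sigma> * Z \<kappa> p = Z \<kappa> (Perm.apply \<sigma> p) * Sg \<sigma>"
proof -
  have eu: "perm_laurent \<sigma> (euler_op p f) = euler_op (Perm.apply \<sigma> p) (perm_laurent \<sigma> f)" for f
    by (rule poly_mapping_eqI) (simp add: lookup_perm_laurent lookup_euler_op)
  \<comment> \<open>Equivariance follows by applying \<open>\<sigma>\<close> to the equation that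
    characterises the divided difference.\<close>
  have "demazure (Perm.apply \<sigma> p) (Perm.apply \<sigma> r) (perm_laurent \<sigma> f) = perm_laurent \<sigma> (demazure p r f)"
    if "p \<noteq> r" for r f
  proof (rule demazure_eqI)
    show "Perm.apply \<sigma> p \<noteq> Perm.apply \<sigma> r" using that by (simp add: apply_inj)
    show "(xpow (Perm.apply \<sigma> p) 1 - xpow (Perm.apply \<sigma> r) 1) * perm_laurent \<sigma> (demazure p r f) =
      xpow (Perm.apply \<sigma> p) 1 * (perm_laurent \<sigma> f -
        perm_laurent (Perm.swap (Perm.apply \<sigma> p) (Perm.apply \<sigma> r)) (perm_laurent \<sigma> f))"
      using arg_cong[OF demazure_mult[OF that, of f], of "perm_laurent \<sigma>"]
      by (simp add: left_diff_distrib right_diff_distrib perm_laurent_minus perm_laurent_xpow_mult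
          swap_conj flip: perm_laurent_mult_perm)
  qed
  then have "Sg \<sigma> * B p r = B (Perm.apply \<sigma> p) (Perm.apply \<sigma> r) * Sg \<sigma>" if "p \<noteq> r" for r
    using that
    by (intro endo_eq_pureI) (simp add: apply_inj swap_conj flip: perm_tensor_mult_perm)
  then have "(\<Sum>r\<in>UNIV - {p}. Sg \<sigma> * B p r) = (\<Sum>r\<in>UNIV - {p}. B (Perm.apply \<sigma> p) (Perm.apply \<sigma> r) * Sg \<sigma>)"
    by (intro sum.cong) auto
  also have "\<dots> = (\<Sum>r\<in>UNIV - {Perm.apply \<sigma> p}. B (Perm.apply \<sigma> p) r * Sg \<sigma>)"
    by (rule sum.reindex_bij_witness[of _ "Perm.apply (inverse \<sigma>)" "Perm.apply \<sigma>"]) (auto simp: apply_inj)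
  finally have "Sg \<sigma> * (\<Sum>r\<in>UNIV - {p}. B p r) = (\<Sum>r\<in>UNIV - {Perm.apply \<sigma> p}. B (Perm.apply \<sigma> p) r) * Sg \<sigma>"
    by (simp add: sum_distrib_left sum_distrib_right)
  moreover have "Sg \<sigma> * (Sc \<kappa> * Eu p) = Sc \<kappa> * Eu (Perm.apply \<sigma> p) * Sg \<sigma>"
    by (rule endo_eq_pureI) (simp add: eu)
  ultimately show ?thesis by (simp add: Z_def distrib_left distrib_right Sg_Cas)
qed

lemma Z_Sc: "Z \<kappa> p * Sc c = Sc c * Z \<kappa> p"
proof -
  have "B p r * Sc c = Sc c * B p r" if "p \<noteq> r" for r
    using that by (intro endo_eq_pureI) simp
  then have "(\<Sum>r\<in>UNIV - {p}. B p r * Sc c) = (\<Sum>r\<in>UNIV - {p}. Sc c * B p r)"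
    by (intro sum.cong) auto
  moreover have "Sc \<kappa> * Eu p * Sc c = Sc c * (Sc \<kappa> * Eu p)"
    by (rule endo_eq_pureI) (simp add: mult.commute)
  ultimately show ?thesis
    by (simp add: Z_def distrib_left distrib_right sum_distrib_left sum_distrib_right Cas_Sc)
qed

lemma Z_Y_const_tensors:
  assumes "c \<in> const_tensors"
  shows "app (Z \<kappa> p) (app (Y g) c) = app (Sc \<kappa>) (app (Y (euler_op p g)) c)
    + (\<Sum>r\<in>UNIV - {p}. app (Y (demazure p r g)) (app (Pt (Perm.swap p r)) c)) + app (Y g) (app (Cas p) c)"
proof -
  have "app (B p r) (app (Y g) c) = app (Y (demazure p r g)) (app (Pt (Perm.swap p r)) c)" if "p \<noteq> r" for r
  proof -
    have "app (B p r) (app (Y g) c) = app (Dm p r) (app (Y g) (app (Pt (Perm.swap p r)) c))"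
      by (simp add: app_commute[OF Pt_Y])
    then show ?thesis
      using that assms by (simp add: Dm_def opL_Y_const_tensors const_tensors_op)
  qed
  then have "(\<Sum>r\<in>UNIV - {p}. app (B p r) (app (Y g) c)) =
      (\<Sum>r\<in>UNIV - {p}. app (Y (demazure p r g)) (app (Pt (Perm.swap p r)) c))"
    by (intro sum.cong) auto
  moreover have "app (Eu p) (app (Y g) c) = app (Y (euler_op p g)) c"
    using assms by (simp add: Eu_def opL_Y_const_tensors)
  moreover have "app (Cas p) (app (Y g) c) = app (Y g) (app (Cas p) c)"
    by (simp add: app_commute[OF Cas_Y])
  ultimately show ?thesis
    by (simp only: Z_def app_sum_endo app_endo(3)) (simp add: app_endo(6))
qed

lemma demazure_xpow_other:
  "p \<noteq> r \<Longrightarrow> q \<noteq> p \<Longrightarrow> q \<noteq> r \<Longrightarrow> demazure p r (xpow q j) = 0"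
  using demazure_xpow_mult_other[of p r q j 1] by simp

lemma euler_op_xpow: "euler_op p (xpow q j) = (if p = q then laurent_scale (of_int j) (xpow q j) else 0)"
  using euler_op_xpow_mult[of p q j 1] by auto

text \<open>Among the divided differences only the one with \<open>r = q\<close> sees
  \<open>x_q\<close>; its value is the telescoping sum.\<close>

lemma Z_X_power_const_tensors:
  assumes "c \<in> const_tensors" "p \<noteq> q"
  shows "app (Z \<kappa> p) (app (Xm q (- int j)) c) =
    (\<Sum>k<j. app (Xm p (- int k) * Xm q (int k - int j)) (app (Pt (Perm.swap p q)) c)) + app (Xm q (- int j)) (app (Cas p) c)"
proof -
  have "(\<Sum>r\<in>UNIV - {p}. app (Y (demazure p r (xpow q (- int j)))) (app (Pt (Perm.swap p r)) c)) =
      (\<Sum>r\<in>UNIV - {p}. if r = q then app (Y (demazure p q (xpow q (- int j)))) (app (Pt (Perm.swap p q)) c) else 0)"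
    using assms(2) by (intro sum.cong refl) (auto simp: demazure_xpow_other Y_simps)
  then show ?thesis
    using assms
    by (simp add: Z_Y_const_tensors euler_op_xpow Y_simps sum.delta demazure_xpow_right Y_sum app_sum_endo)
qed

lemma T_const_tensors: "c \<in> const_tensors \<Longrightarrow> app (T p i) c \<in> const_tensors"
  unfolding T_def app_sum_endo app_endo
  by (intro const_tensors_sum const_tensors_op) (simp_all add: R_def const_tensors_op)

end

section \<open>The commutator of \<open>z_p\<close> and \<open>z_q\<close>\<close>

lemma sum_square_triangle:
  fixes G :: "nat \<Rightarrow> nat \<Rightarrow> 'a::comm_monoid_add"
  assumes "\<And>i j. i + j \<ge> n \<Longrightarrow> G i j = 0"
  shows "(\<Sum>i<n. \<Sum>j<n. G i j) = (\<Sum>k<n. \<Sum>i\<le>k. G i (k - i))"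
proof -
  have "(\<Sum>i<n. \<Sum>j<n. G i j) = (\<Sum>(i, j)\<in>{..<n} \<times> {..<n}. G i j)"
    by (rule sum.cartesian_product)
  also have "\<dots> = (\<Sum>(i, j)\<in>{(i, j). i + j < n}. G i j)"
    by (rule sum.mono_neutral_right) (auto, metis assms not_le)
  also have "\<dots> = (\<Sum>k<n. \<Sum>i\<le>k. G i (k - i))"
    by (rule sum.triangle_reindex)
  finally show ?thesis .
qed

context annihilated_module
begin

text \<open>On constants \<open>z_q\<close> is the Casimir sum alone. The first double sum then
  comes from the divided differences in \<open>z_p\<close>, the second from its Casimir sum.\<close>

lemma Z_Z_const_tensors:
  fixes p q :: "'n::finite"
  assumes c: "c \<in> const_tensors" and pq: "p \<noteq> q"
    and n: "\<And>i p. i \<ge> n \<Longrightarrow> app (T p (int i)) c = (0 :: ('n, 'm, 'v) wspace)"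
  shows "app (Z \<kappa> p) (app (Z \<kappa> q) c) =
    (\<Sum>j<n. \<Sum>k<j. app (Xm p (- int k) * Xm q (- int (j - k))) (app (Pt (Perm.swap p q)) (app (T q (int j)) c)))
    + (\<Sum>i<n. \<Sum>j<n. app (Xm p (- int i) * Xm q (- int j)) (app (T p (int i)) (app (T q (int j)) c)))"
proof -
  have conv: "(\<Sum>k<j. app (Xm p (- int k) * Xm q (int k - int j)) x) =
      (\<Sum>k<j. app (Xm p (- int k) * Xm q (- int (j - k))) x)" for j x
    by (intro sum.cong refl) (simp add: of_nat_diff)
  have "app (Z \<kappa> q) c = app (Cas q) c"
    using Z_Y_const_tensors[OF c, of \<kappa> q 1] by (simp add: Y_simps)
  then have "app (Z \<kappa> q) c = (\<Sum>j<n. app (Xm q (- int j)) (app (T q (int j)) c))"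
    using n by (simp add: app_Cas_sum)
  moreover have "app (Cas p) (app (T q (int j)) c) = (\<Sum>i<n. app (Xm p (- int i)) (app (T p (int i)) (app (T q (int j)) c)))" for j
  proof (rule app_Cas_sum)
    fix i assume i: "i \<ge> n"
    \<comment> \<open>By \<open>T_commutator\<close> this involves only Casimir coefficients of
      degrees \<open>i\<close> and \<open>i + j\<close> acting directly on \<open>c\<close>, so the
      bound \<open>n\<close> for \<open>c\<close> still serves.\<close>
    have "app (T p (int i)) (app (T q (int j)) c) = app (T p (int i) * T q (int j)) c" by simp
    also have "\<dots> = 0"
      using n[OF i] n[of "i + j"] i by (simp only: T_commutator[OF pq] app_endo) (simp flip: of_nat_add)
    finally show "app (T p (int i)) (app (T q (int j)) c) = 0" .
  qed
  ultimately have "app (Z \<kappa> p) (app (Z \<kappa> q) c) =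
    (\<Sum>j<n. (\<Sum>k<j. app (Xm p (- int k) * Xm q (int k - int j)) (app (Pt (Perm.swap p q)) (app (T q (int j)) c)))
      + (\<Sum>i<n. app (Xm q (- int j)) (app (Xm p (- int i)) (app (T p (int i)) (app (T q (int j)) c)))))"
    using pq c by (simp add: app_sum Z_X_power_const_tensors T_const_tensors)
  also have "\<dots> = (\<Sum>j<n. \<Sum>k<j. app (Xm p (- int k) * Xm q (int k - int j)) (app (Pt (Perm.swap p q)) (app (T q (int j)) c)))
    + (\<Sum>j<n. \<Sum>i<n. app (Xm p (- int i)) (app (Xm q (- int j)) (app (T p (int i)) (app (T q (int j)) c))))"
    by (simp add: sum.distrib app_commute[OF Y_commute, of "xpow q _"])
  also have "(\<Sum>j<n. \<Sum>i<n. app (Xm p (- int i)) (app (Xm q (- int j)) (app (T p (int i)) (app (T q (int j)) c)))) =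
      (\<Sum>i<n. \<Sum>j<n. app (Xm p (- int i) * Xm q (- int j)) (app (T p (int i)) (app (T q (int j)) c)))"
    by (simp, rule sum.swap)
  finally show ?thesis by (simp only: conv)
qed

lemma Z_commutator_const_tensors:
  fixes p q :: "'n::finite"
  assumes c: "c \<in> const_tensors" and pq: "p \<noteq> q"
  shows "app (Z \<kappa> p) (app (Z \<kappa> q) c) - app (Z \<kappa> q) (app (Z \<kappa> p) c) =
    (app (Sg (Perm.swap p q)) (app (Z \<kappa> p) c - app (Z \<kappa> q) c) :: ('n, 'm, 'v) wspace)"
proof -
  obtain n where n: "\<And>i p. i \<ge> n \<Longrightarrow> app (T p (int i)) c = (0 :: ('n, 'm, 'v) wspace)"
    using T_bound[of c] by blast
  define t where "t s i = app (Pt (Perm.swap p q)) (app (T s (int i)) c)" for s i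
  define F :: "nat \<Rightarrow> nat \<Rightarrow> ('n, 'm, 'v) wspace endo" where "F i j = Xm p (- int i) * Xm q (- int j)" for i j
  have t0: "t s i = 0" if "i \<ge> n" for s i using n[OF that] by (simp add: t_def)
  have TT: "app (T p (int i)) (app (T q (int j)) c) - app (T q (int j)) (app (T p (int i)) c) = t p (i + j) - t q (i + j)" for i j
    using arg_cong[OF T_commutator[OF pq, of "int i" "int j"], of "\<lambda>G. app G c"] by (simp add: t_def)
  have "app (Z \<kappa> p) (app (Z \<kappa> q) c) = (\<Sum>j<n. \<Sum>k<j. app (F k (j - k)) (t q j))
      + (\<Sum>i<n. \<Sum>j<n. app (F i j) (app (T p (int i)) (app (T q (int j)) c)))"
    by (subst Z_Z_const_tensors[OF c pq, of n]) (simp_all add: n F_def t_def)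
  moreover have "app (Z \<kappa> q) (app (Z \<kappa> p) c) = (\<Sum>j<n. \<Sum>k<j. app (F (j - k) k) (t p j))
      + (\<Sum>i<n. \<Sum>j<n. app (F i j) (app (T q (int j)) (app (T p (int i)) c)))"
    by (subst Z_Z_const_tensors[OF c pq[symmetric], of n], simp add: n, subst (2) sum.swap)
      (simp add: F_def t_def swap_sym[of q p] app_commute[OF Y_commute, of "xpow q _"])
  ultimately have "app (Z \<kappa> p) (app (Z \<kappa> q) c) - app (Z \<kappa> q) (app (Z \<kappa> p) c) =
      (\<Sum>j<n. \<Sum>k<j. app (F k (j - k)) (t q j)) - (\<Sum>j<n. \<Sum>k<j. app (F (j - k) k) (t p j))
      + (\<Sum>i<n. \<Sum>j<n. app (F i j) (t p (i + j) - t q (i + j)))"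
    by (simp add: sum_subtractf flip: TT)
  also have "(\<Sum>i<n. \<Sum>j<n. app (F i j) (t p (i + j) - t q (i + j))) =
      (\<Sum>m<n. \<Sum>i\<le>m. app (F i (m - i)) (t p m)) - (\<Sum>m<n. \<Sum>i\<le>m. app (F i (m - i)) (t q m))"
    by (subst sum_square_triangle) (simp_all add: t0 sum_subtractf)
  \<comment> \<open>The divided differences supply these terms for \<open>i < m\<close> only; the
    term \<open>i = m\<close> remains as a boundary term.\<close>
  also have "(\<Sum>m<n. \<Sum>i\<le>m. app (F i (m - i)) (t q m)) =
      (\<Sum>m<n. \<Sum>i<m. app (F i (m - i)) (t q m)) + (\<Sum>m<n. app (F m 0) (t q m))"
    by (simp add: sum.distrib flip: lessThan_Suc_atMost)
  \<comment> \<open>For \<open>p\<close> the index is first reflected to \<open>m - i\<close>, so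
    that the leftover boundary term is \<open>F 0 m\<close>.\<close>
  also have "(\<Sum>m<n. \<Sum>i\<le>m. app (F i (m - i)) (t p m)) =
      (\<Sum>m<n. \<Sum>i<m. app (F (m - i) i) (t p m)) + (\<Sum>m<n. app (F 0 m) (t p m))"
  proof -
    have "(\<Sum>i\<le>m. app (F i (m - i)) (t p m)) = (\<Sum>i\<le>m. app (F (m - i) i) (t p m))" for m
      by (rule sum.reindex_bij_witness[of _ "\<lambda>i. m - i" "\<lambda>i. m - i"]) auto
    then show ?thesis by (simp add: sum.distrib flip: lessThan_Suc_atMost)
  qed
  finally have L: "app (Z \<kappa> p) (app (Z \<kappa> q) c) - app (Z \<kappa> q) (app (Z \<kappa> p) c) =
      (\<Sum>m<n. app (F 0 m) (t p m)) - (\<Sum>m<n. app (F m 0) (t q m))"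
    by simp
  have Zc: "app (Z \<kappa> s) c = (\<Sum>i<n. app (Xm s (- int i)) (app (T s (int i)) c))" for s
    using Z_Y_const_tensors[OF c, of \<kappa> s 1] n by (simp add: Y_simps app_Cas_sum)
  \<comment> \<open>The transposition exchanges the powers of \<open>x_p\<close> and
    \<open>x_q\<close>, which produces exactly the two boundary sums.\<close>
  have "app (Sg (Perm.swap p q)) (app (Xm s (- int i)) (app (T s (int i)) c)) =
      app (Xm (Perm.apply (Perm.swap p q) s) (- int i)) (t s i)" for s i
    using c by (simp add: app_commute[OF Sg_X] Sg_const_tensors T_const_tensors t_def)
  then have "app (Sg (Perm.swap p q)) (app (Z \<kappa> p) c - app (Z \<kappa> q) c) =
      (\<Sum>m<n. app (F 0 m) (t p m)) - (\<Sum>m<n. app (F m 0) (t q m))"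
    by (simp add: Zc app_sum F_def Y_simps)
  then show ?thesis by (simp only: L)
qed

lemma Z_commutator:
  fixes p q :: "'n::finite"
  assumes pq: "p \<noteq> q"
  shows "Z \<kappa> p * Z \<kappa> q - Z \<kappa> q * Z \<kappa> p = (Sg (Perm.swap p q) * (Z \<kappa> p - Z \<kappa> q) :: ('n, 'm, 'v) wspace endo)"
proof -
  \<comment> \<open>Taken for all pairs of indices, so that antisymmetry later yields commutation
    with \<open>x_q\<close> from commutation with \<open>x_p\<close>.\<close>
  define K :: "'n \<Rightarrow> 'n \<Rightarrow> ('n, 'm, 'v) wspace endo"
    where "K p q = Z \<kappa> p * Z \<kappa> q - Z \<kappa> q * Z \<kappa> p - Sg (Perm.swap p q) * (Z \<kappa> p - Z \<kappa> q)" for p q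
  have Xother: "K p q * Xm t 1 = Xm t 1 * K p q" if "p \<noteq> q" "t \<noteq> p" "t \<noteq> q" for p q t
    unfolding K_def
    by (rule cherednik_jacobi_other[where sp = "Sg (Perm.swap p t)" and sq = "Sg (Perm.swap q t)"
          and Xp = "Xm p 1" and Xq = "Xm q 1"])
      (use that in \<open>simp_all add: Z_X_other Sg_Z Sg_X swap_sym[of q p]\<close>)
  have Xsame: "K p q * Xm p 1 = Xm p 1 * K p q" if "p \<noteq> q" for p q
    unfolding K_def
  proof (rule cherednik_jacobi_same[where k = "Sc \<kappa>" and Xq = "Xm q 1"
        and G = "\<Sum>t\<in>UNIV - {p} - {q}. Sg (Perm.swap p t)"])
    have "(\<Sum>t\<in>UNIV - {p}. Xm p 1 * Sg (Perm.swap p t)) =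
        Xm p 1 * Sg (Perm.swap p q) + Xm p 1 * (\<Sum>t\<in>UNIV - {p} - {q}. Sg (Perm.swap p t) :: ('n, 'm, 'v) wspace endo)"
      using that by (subst sum.remove[of _ q]) (simp_all add: sum_distrib_left)
    then show "Z \<kappa> p * Xm p 1 = Xm p 1 * Z \<kappa> p + Sc \<kappa> * Xm p 1 + Xm p 1 * Sg (Perm.swap p q) +
        Xm p 1 * (\<Sum>t\<in>UNIV - {p} - {q}. Sg (Perm.swap p t) :: ('n, 'm, 'v) wspace endo)"
      by (simp add: Z_X_same add.assoc)
    show "(\<Sum>t\<in>UNIV - {p} - {q}. Sg (Perm.swap p t)) * Z \<kappa> q =
        Z \<kappa> q * (\<Sum>t\<in>UNIV - {p} - {q}. Sg (Perm.swap p t) :: ('n, 'm, 'v) wspace endo)"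
      unfolding sum_distrib_left sum_distrib_right using that by (intro sum.cong refl) (auto simp: Sg_Z)
    have "Perm.swap p q * Perm.swap p q = 1" by (metis perm.left_inverse inverse_swap)
    then show "Sg (Perm.swap p q) * Sg (Perm.swap p q) = (1 :: ('n, 'm, 'v) wspace endo)"
      by (simp add: Sg_mult Sg_one)
  qed (use that in \<open>simp_all add: Z_X_other Sg_Z Sg_X swap_sym[of q p] Z_Sc Sc_commute\<close>)
  have anti: "K q p = - K p q"
    by (simp add: K_def swap_sym[of q p] algebra_simps)
  have "K p q * Xm t 1 = Xm t 1 * K p q" for t
  proof (cases "t = q")
    case True
    then show ?thesis using Xsame[of q p] pq by (simp add: anti)
  next
    case False
    then show ?thesis using Xother[OF pq] Xsame[OF pq] by (cases "t = p") auto
  qed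
  then have "K p q = 0"
    by (rule intertwiner_eq_0[of _ "\<lambda>p. p"]) (simp add: K_def Z_commutator_const_tensors[OF _ pq] del: app_diff)
  then show ?thesis by (simp add: K_def)
qed

end


section \<open>Compatibility with the affine Lie algebra\<close>

lemma sum_lessThan_add:
  fixes h :: "nat \<Rightarrow> 'a::comm_monoid_add"
  shows "(\<Sum>i<m + n. h i) = (\<Sum>i<m. h i) + (\<Sum>i<n. h (m + i))"
  by (induction n) (simp_all add: add.assoc)

lemma matrix_unit_mult_nth:
  "(matrix_unit a b ** A) $ i $ j = (if i = a then A $ b $ j else 0)"
  "(A ** matrix_unit a b) $ i $ j = (if j = b then A $ i $ a else 0)"
proof -
  have "(matrix_unit a b ** A) $ i $ j = (\<Sum>k\<in>UNIV. if k = b then (if i = a then A $ k $ j else 0) else 0)"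
    unfolding matrix_matrix_mult_def vec_lambda_beta by (intro sum.cong refl) (simp add: matrix_unit_def)
  then show "(matrix_unit a b ** A) $ i $ j = (if i = a then A $ b $ j else 0)"
    by (simp add: sum.delta)
  have "(A ** matrix_unit a b) $ i $ j = (\<Sum>k\<in>UNIV. if k = a then (if j = b then A $ i $ k else 0) else 0)"
    unfolding matrix_matrix_mult_def vec_lambda_beta by (intro sum.cong refl) (simp add: matrix_unit_def)
  then show "(A ** matrix_unit a b) $ i $ j = (if j = b then A $ i $ a else 0)"
    by (simp add: sum.delta)
qed

text \<open>The first products add up to the trace of \<open>A\<close> times the identity, hence to
  zero, and the second to \<open>m\<close> times \<open>A\<close>. This is the origin of the shift
  of the level by \<open>m\<close>.\<close>

lemma sum_commutator_units:
  fixes A :: "complex ^ 'm ^ 'm::finite"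
  assumes "trace A = 0"
  shows "(\<Sum>a\<in>UNIV. \<Sum>b\<in>UNIV. (matrix_unit b a ** A - A ** matrix_unit b a) ** matrix_unit a b) =
    map_matrix ((*) (- of_nat CARD('m))) A"
proof -
  have "(\<Sum>a\<in>UNIV. \<Sum>b\<in>UNIV. (if j = b then (if i = b then A $ a $ a else 0) - A $ i $ b else 0)) =
      - of_nat CARD('m) * A $ i $ j" for i j
    using assms by (cases "i = j") (simp_all add: sum.delta trace_def sum_subtractf)
  then show ?thesis
    by (simp add: vec_eq_iff matrix_unit_mult_nth)
qed

context annihilated_module
begin

text \<open>\<open>G j A\<close> is the action of \<open>A t\<^sup>j\<close> on \<open>W\<close> when \<open>A\<close> has trace zero.\<close>

definition G :: "int \<Rightarrow> complex ^ 'm ^ 'm \<Rightarrow> ('n::finite, 'm, 'v) wspace endo" where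
  "G j A = (\<Sum>q\<in>UNIV. Xm q j * M q A) + R A j"

lemma G_Y: "G j A * Y g = Y g * G j A"
proof -
  have "Xm q j * M q A * Y g = Y g * (Xm q j * M q A)" for q
    by (simp add: mult.assoc M_Y) (simp add: Y_commute[of g] flip: mult.assoc)
  then show ?thesis
    by (simp add: G_def distrib_left distrib_right sum_distrib_left sum_distrib_right R_commute)
qed

lemma Sg_G: "Sg \<sigma> * G j A = G j A * Sg \<sigma>"
proof -
  have "(\<Sum>q\<in>UNIV. Sg \<sigma> * (Xm q j * M q A)) = (\<Sum>q\<in>UNIV. Xm (Perm.apply \<sigma> q) j * M (Perm.apply \<sigma> q) A * Sg \<sigma>)"
    by (intro sum.cong refl) (simp add: Sg_X Sg_M mult.assoc flip: mult.assoc[of "Sg \<sigma>"])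
  also have "\<dots> = (\<Sum>q\<in>UNIV. Xm q j * M q A * Sg \<sigma>)"
    by (rule sum.reindex_bij_witness[of _ "Perm.apply (inverse \<sigma>)" "Perm.apply \<sigma>"]) auto
  finally show ?thesis
    by (simp add: G_def distrib_left distrib_right sum_distrib_left sum_distrib_right R_commute)
qed

lemma G_Sc: "G j A * Sc c = (Sc c * G j A :: ('n::finite, 'm, 'v) wspace endo)"
proof -
  have "Xm q j * M q A * Sc c = Sc c * (Xm q j * M q A)" for q :: 'n
    by (simp add: mult.assoc Sc_commute) (simp add: Sc_commute flip: mult.assoc)
  then show ?thesis
    by (simp add: G_def distrib_left distrib_right sum_distrib_left sum_distrib_right R_commute)
qed

text \<open>
  At level \<open>\<kappa> - m\<close>, or for \<open>j = 0\<close>, the commutator of \<open>z\<^sub>p\<close> with \<open>A t\<^bsup>-j\<^esup>\<close> is \<open>\<Sum>\<^bsub>k<j\<^esub> x\<^sub>p\<^bsup>-k\<^esup> H p A (k - j)\<close>; see \<open>Z_G\<close>.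
\<close>

definition H :: "'n::finite \<Rightarrow> complex ^ 'm ^ 'm \<Rightarrow> int \<Rightarrow> ('n, 'm, 'v) wspace endo" where
  "H p A i = (\<Sum>a\<in>UNIV. \<Sum>b\<in>UNIV. G i (matrix_unit b a ** A - A ** matrix_unit b a) * M p (matrix_unit a b))"

lemma H_Y: "H p A i * Y g = Y g * H p A i"
  unfolding H_def sum_distrib_left sum_distrib_right
  by (intro sum.cong refl) (simp add: mult.assoc M_Y, simp add: G_Y flip: mult.assoc)

lemma M_sum: "M p (\<Sum>i\<in>I. F i) = (\<Sum>i\<in>I. M p (F i))"
proof -
  have "M p (0 :: complex ^ 'b ^ 'b) = 0" using M_simps(4)[of p 0 0] by simp
  then show ?thesis by (induction I rule: infinite_finite_induct) (simp_all add: M_simps)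
qed

text \<open>In \<open>H\<close> the factors \<open>q\<close> other than \<open>p\<close> give flips,
  the factor \<open>p\<close> gives the multiple \<open>- m\<close> of \<open>A\<close> by
  \<open>sum_commutator_units\<close>, and the action on \<open>V\<close> gives
  \<open>ad_T\<close>.\<close>

lemma H_eq:
  fixes p :: "'n::finite"
  assumes "trace A = 0"
  shows "H p A i = (\<Sum>q\<in>UNIV - {p}. Xm q i * Pt (Perm.swap p q) * (M q A - M p A))
    + Sc (- of_nat CARD('m)) * Xm p i * M p A + (ad_T p A i :: ('n, 'm, 'v) wspace endo)"
proof -
  let ?S = "\<lambda>f. (\<Sum>a\<in>UNIV. \<Sum>b\<in>UNIV. f a b) :: ('n, 'm, 'v) wspace endo"
  let ?E = "matrix_unit :: 'm \<Rightarrow> 'm \<Rightarrow> _"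
  let ?C = "\<lambda>a b. ?E b a ** A - A ** ?E b a"
  have "H p A i = ?S (\<lambda>a b. (\<Sum>q\<in>UNIV. Xm q i * (M q (?C a b) * M p (?E a b))) + M p (?E a b) * R (?C a b) i)"
    by (simp add: H_def G_def distrib_right sum_distrib_right mult.assoc R_commute)
  also have "\<dots> = (\<Sum>q\<in>UNIV. Xm q i * ?S (\<lambda>a b. M q (?C a b) * M p (?E a b))) + ad_T p A i"
  proof -
    have "?S (\<lambda>a b. \<Sum>q\<in>UNIV. h q a b) = (\<Sum>q\<in>UNIV. ?S (h q))" for h :: "'n \<Rightarrow> _"
    proof -
      have "?S (\<lambda>a b. \<Sum>q\<in>UNIV. h q a b) = (\<Sum>a\<in>UNIV. \<Sum>q\<in>UNIV. \<Sum>b\<in>UNIV. h q a b)"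
        by (intro sum.cong refl sum.swap)
      also have "\<dots> = (\<Sum>q\<in>UNIV. ?S (h q))" by (rule sum.swap)
      finally show ?thesis .
    qed
    then show ?thesis by (simp add: sum.distrib ad_T_def sum_distrib_left)
  qed
  also have "(\<Sum>q\<in>UNIV. Xm q i * ?S (\<lambda>a b. M q (?C a b) * M p (?E a b))) =
     Xm p i * ?S (\<lambda>a b. M p (?C a b) * M p (?E a b))
     + (\<Sum>q\<in>UNIV - {p}. Xm q i * ?S (\<lambda>a b. M q (?C a b) * M p (?E a b)))"
    by (subst sum.remove[of _ p]) simp_all
  also have "?S (\<lambda>a b. M p (?C a b) * M p (?E a b)) = Sc (- of_nat CARD('m)) * M p A"
  proof -
    have "?S (\<lambda>a b. M p (?C a b) * M p (?E a b)) = M p (\<Sum>a\<in>UNIV. \<Sum>b\<in>UNIV. ?C a b ** ?E a b)"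
      by (simp only: M_sum M_simps(3))
    then show ?thesis by (simp only: sum_commutator_units[OF assms] M_simps(2))
  qed
  also have "Xm p i * (Sc (- of_nat CARD('m)) * M p A) = (Sc (- of_nat CARD('m)) * Xm p i * M p A :: ('n, 'm, 'v) wspace endo)"
    by (simp add: Sc_commute flip: mult.assoc)
  also have "(\<Sum>q\<in>UNIV - {p}. Xm q i * ?S (\<lambda>a b. M q (?C a b) * M p (?E a b))) =
     (\<Sum>q\<in>UNIV - {p}. Xm q i * Pt (Perm.swap p q) * (M q A - M p A))"
  proof (rule sum.cong)
    fix q assume "q \<in> UNIV - {p}"
    then have pq: "p \<noteq> q" by auto
    have lc: "M p A' * (M q B' * y) = M q B' * (M p A' * y)" for A' B' and y :: "('n, 'm, 'v) wspace endo"
      by (simp add: M_commute[OF pq] flip: mult.assoc)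
    \<comment> \<open>Summed over \<open>a\<close> and \<open>b\<close>, the products of matrix
      units in the factors \<open>p\<close> and \<open>q\<close> form the flip, so its commutator
      with \<open>M q A\<close> remains.\<close>
    have "M q (?C a b) * M p (?E a b) =
        (M p (?E a b) * M q (?E b a)) * M q A - M q A * (M p (?E a b) * M q (?E b a) :: ('n, 'm, 'v) wspace endo)" for a b
      by (simp add: M_simps(4) left_diff_distrib M_commute[OF pq] mult.assoc lc flip: M_simps(3))
    then have "?S (\<lambda>a b. M q (?C a b) * M p (?E a b)) = Pt (Perm.swap p q) * M q A - M q A * Pt (Perm.swap p q)"
      using pq by (simp add: Pt_swap sum_distrib_left sum_distrib_right sum_subtractf)
    also have "M q A * Pt (Perm.swap p q) = (Pt (Perm.swap p q) * M p A :: ('n, 'm, 'v) wspace endo)"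
      by (simp add: Pt_M)
    finally show "Xm q i * ?S (\<lambda>a b. M q (?C a b) * M p (?E a b)) = Xm q i * Pt (Perm.swap p q) * (M q A - M p A)"
      by (simp add: mult.assoc right_diff_distrib)
  qed simp
  finally show ?thesis by (simp only: ac_simps)
qed

lemma T_R':
  fixes p :: "'n::finite"
  assumes "trace A = 0"
  shows "T p i * R A j = R A j * T p i + ad_T p A (i + j)
    + (if i = - j then Sc (of_int i) * M p A * Lv else (0 :: ('n, 'm, 'v) wspace endo))"
  using T_R_level[OF assms, of p i] by (cases "i = - j") (simp_all add: T_R)

text \<open>Now every \<open>r\<close> contributes a divided difference, with opposite sign, and the
  Euler operator contributes the scalar \<open>- \<kappa> * j\<close>.\<close>

lemma Z_X_power_same_const_tensors:
  fixes p :: "'n::finite"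
  assumes "c \<in> const_tensors"
  shows "app (Z \<kappa> p) (app (Xm p (- int j)) c) = app (Sc (- \<kappa> * of_nat j) * Xm p (- int j)) c
    - (\<Sum>r\<in>UNIV - {p}. \<Sum>k<j. app (Xm p (- int k) * Xm r (int k - int j)) (app (Pt (Perm.swap p r)) c))
    + app (Xm p (- int j)) (app (Cas p) c)"
proof -
  have "app (Y (demazure p r (xpow p (- int j)))) (app (Pt (Perm.swap p r)) c) =
      - (\<Sum>k<j. app (Xm p (- int k) * Xm r (int k - int j)) (app (Pt (Perm.swap p r)) c))" if "p \<noteq> r" for r
  proof -
    have "Y (demazure p r (xpow p (- int j))) = - (\<Sum>k<j. Xm p (- int k) * Xm r (int k - int j))"
      using that by (simp add: demazure_xpow_left Y_uminus Y_sum Y_simps)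
    then show ?thesis by (simp add: app_sum_endo)
  qed
  then have "(\<Sum>r\<in>UNIV - {p}. app (Y (demazure p r (xpow p (- int j)))) (app (Pt (Perm.swap p r)) c)) =
      - (\<Sum>r\<in>UNIV - {p}. \<Sum>k<j. app (Xm p (- int k) * Xm r (int k - int j)) (app (Pt (Perm.swap p r)) c))"
    unfolding sum_negf[symmetric] by (intro sum.cong) auto
  moreover have "Sc (- (\<kappa> * of_nat j)) = (Sc \<kappa> * Sc (- of_nat j) :: ('n, 'm, 'v) wspace endo)"
    by (simp flip: Sc_simps)
  ultimately show ?thesis
    using assms by (simp add: Z_Y_const_tensors euler_op_xpow Y_scale)
qed

text \<open>Both sides reduce to flips applied to \<open>M q A - M p A\<close>, the
  \<open>ad_T\<close> terms of negative degree, and a multiple of \<open>Xm p (- j) * M p A\<close>.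
  That multiple is \<open>- \<kappa> * j + j * (\<kappa> - m)\<close> on the left and
  \<open>j\<close> times \<open>- m\<close> on the right.\<close>

lemma Z_G_const_tensors:
  fixes p :: "'n::finite"
  assumes c: "c \<in> const_tensors" and A: "trace A = 0"
    and level: "j \<noteq> 0 \<Longrightarrow> Lv = (Sc (\<kappa> - of_nat CARD('m)) :: ('n, 'm, 'v) wspace endo)"
  shows "app (Z \<kappa> p) (app (G (- int j) A) c) - app (G (- int j) A) (app (Z \<kappa> p) c) =
    (\<Sum>k<j. app (Xm p (- int k)) (app (H p A (int k - int j)) c) :: ('n, 'm, 'v) wspace)"
proof -
  let ?P = "\<lambda>r. Pt (Perm.swap p r) :: ('n, 'm, 'v) wspace endo"
  obtain n0 where "\<And>i p. i \<ge> n0 \<Longrightarrow> app (T p (int i)) c = (0 :: ('n, 'm, 'v) wspace)"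
    "\<And>i p A. i \<ge> n0 \<Longrightarrow> app (ad_T p A (int i)) c = (0 :: ('n, 'm, 'v) wspace)"
    using T_bound[of c] by blast
  \<comment> \<open>Positivity of \<open>n\<close> puts the index \<open>i = j\<close> of the
    central term into the range \<open>i < n + j\<close> used for \<open>CR\<close>.\<close>
  then obtain n where n: "n > 0" "\<And>i p. i \<ge> n \<Longrightarrow> app (T p (int i)) c = (0 :: ('n, 'm, 'v) wspace)"
    "\<And>i p A. i \<ge> n \<Longrightarrow> app (ad_T p A (int i)) c = (0 :: ('n, 'm, 'v) wspace)"
    by (metis Suc_leD zero_less_Suc)
  have Zc: "app (Z \<kappa> p) d = app (Cas p) d" if "d \<in> const_tensors" for d
    using Z_Y_const_tensors[OF that, of \<kappa> p 1] by (simp add: Y_simps)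
  have Mc: "app (M q A) c \<in> const_tensors" for q using c by (rule const_tensors_op)
  have Rc: "app (R A i) c \<in> const_tensors" for i using c by (simp add: R_def const_tensors_op)
  have CM: "app (Cas p) (app (M q A) c) = app (M q A) (app (Cas p) c)" if "q \<noteq> p" for q
  proof -
    have "M q A * Cas p = (Cas p * M q A :: ('n, 'm, 'v) wspace endo)"
      by (rule Cas_intertwine)
        (use that in \<open>simp add: mult.assoc T_M_other, simp add: M_Y flip: mult.assoc\<close>)
    then show ?thesis using app_commute by metis
  qed
  have CM': "app (Cas p) (app (M p A) c) = app (M p A) (app (Cas p) c)
      - (\<Sum>i<n. app (Xm p (- int i)) (app (ad_T p A (int i)) c))"
  proof -
    have TM: "app (T p (int i)) (app (M p A) c) = app (M p A) (app (T p (int i)) c) - app (ad_T p A (int i)) c" for i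
      using arg_cong[OF T_M_same[of p "int i" A], of "\<lambda>F. app F c"] by simp
    have "app (Cas p) (app (M p A) c) = (\<Sum>i<n. app (Xm p (- int i)) (app (T p (int i)) (app (M p A) c)))"
      by (rule app_Cas_sum) (simp add: TM n)
    moreover have "app (M p A) (app (Cas p) c) = (\<Sum>i<n. app (Xm p (- int i)) (app (M p A) (app (T p (int i)) c)))"
      by (simp add: app_Cas_sum[of n] n app_sum app_commute[OF M_Y])
    ultimately show ?thesis by (simp add: TM sum_subtractf)
  qed
  \<comment> \<open>The \<open>ad_T\<close> terms with \<open>i < j\<close> keep a negative degree.
    Those with \<open>i \<ge> j\<close> reassemble into a power of \<open>x_p\<close> times the sum
    in \<open>CM'\<close>, which enters with opposite sign and cancels.\<close>
  have CR: "app (Cas p) (app (R A (- int j)) c) = app (R A (- int j)) (app (Cas p) c)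
      + (\<Sum>k<j. app (Xm p (- int k)) (app (ad_T p A (int k - int j)) c))
      + app (Xm p (- int j)) (\<Sum>i<n. app (Xm p (- int i)) (app (ad_T p A (int i)) c))
      + app (Xm p (- int j)) (app (Sc (of_nat j) * M p A * Lv) c)"
  proof -
    have TR: "app (T p (int i)) (app (R A (- int j)) c) = app (R A (- int j)) (app (T p (int i)) c)
        + app (ad_T p A (int i - int j)) c + (if i = j then app (Sc (of_nat i) * M p A * Lv) c else 0)" for i
      using arg_cong[OF T_R'[OF A, of p "int i" "- int j"], of "\<lambda>F. app F c"] by (simp split: if_splits)
    have ad0: "app (ad_T p A (int i - int j)) c = 0" if "i \<ge> n + j" for i
      using n(3)[of "i - j"] that by (simp add: of_nat_diff)
    have "app (Cas p) (app (R A (- int j)) c) = (\<Sum>i<n+j. app (Xm p (- int i)) (app (T p (int i)) (app (R A (- int j)) c)))"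
      by (rule app_Cas_sum) (use n(1) in \<open>auto simp: TR n(2) ad0\<close>)
    also have "\<dots> = (\<Sum>i<n+j. app (Xm p (- int i)) (app (R A (- int j)) (app (T p (int i)) c)))
       + (\<Sum>i<n+j. app (Xm p (- int i)) (app (ad_T p A (int i - int j)) c))
       + (\<Sum>i<n+j. if i = j then app (Xm p (- int j)) (app (Sc (of_nat j) * M p A * Lv) c) else 0)"
      unfolding sum.distrib[symmetric] by (intro sum.cong refl) (simp add: TR)
    also have "(\<Sum>i<n+j. app (Xm p (- int i)) (app (R A (- int j)) (app (T p (int i)) c))) = app (R A (- int j)) (app (Cas p) c)"
      by (simp add: app_Cas_sum[of "n + j"] n app_sum app_commute[OF R_commute(1)])
    also have "(\<Sum>i<n+j. app (Xm p (- int i)) (app (ad_T p A (int i - int j)) c)) =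
       (\<Sum>k<j. app (Xm p (- int k)) (app (ad_T p A (int k - int j)) c))
       + app (Xm p (- int j)) (\<Sum>i<n. app (Xm p (- int i)) (app (ad_T p A (int i)) c))"
    proof -
      have "(\<Sum>i<j+n. app (Xm p (- int i)) (app (ad_T p A (int i - int j)) c)) =
        (\<Sum>k<j. app (Xm p (- int k)) (app (ad_T p A (int k - int j)) c))
       + (\<Sum>i<n. app (Xm p (- int (j + i))) (app (ad_T p A (int (j + i) - int j)) c))"
        by (rule sum_lessThan_add)
      moreover have "app (Xm p (- int (j + i))) w = app (Xm p (- int j)) (app (Xm p (- int i)) w)" for i w
        by (simp add: X_mult flip: app_endo(6))
      ultimately show ?thesis by (simp add: app_sum add.commute[of n])
    qed
    finally show ?thesis using n(1) by (simp add: sum.delta)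
  qed
  \<comment> \<open>For \<open>j = 0\<close> no level is assumed, but the factor \<open>j\<close>
    makes both sides vanish.\<close>
  have LvM: "app (Sc (of_nat j) * M p A * Lv) c = app (Sc (of_nat j * (\<kappa> - of_nat CARD('m))) * M p A) c"
  proof (cases "j = 0")
    case True
    then show ?thesis by (simp add: Sc_simps)
  next
    case False
    have "Sc (of_nat j) * M p A * Lv = (Sc (of_nat j * (\<kappa> - of_nat CARD('m))) * M p A :: ('n, 'm, 'v) wspace endo)"
      by (simp add: level[OF False] mult.assoc Sc_commute Sc_simps(4))
    then show ?thesis by simp
  qed
  have "app (Z \<kappa> p) (app (G (- int j) A) c) =
      app (Z \<kappa> p) (app (Xm p (- int j)) (app (M p A) c))
      + (\<Sum>q\<in>UNIV - {p}. app (Z \<kappa> p) (app (Xm q (- int j)) (app (M q A) c)))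
      + app (Cas p) (app (R A (- int j)) c)"
    by (simp add: G_def app_sum_endo app_sum Zc[OF Rc] sum.remove[of UNIV p])
  also have "(\<Sum>q\<in>UNIV - {p}. app (Z \<kappa> p) (app (Xm q (- int j)) (app (M q A) c))) =
      (\<Sum>q\<in>UNIV - {p}. \<Sum>k<j. app (Xm p (- int k) * Xm q (int k - int j)) (app (?P q) (app (M q A) c)))
      + (\<Sum>q\<in>UNIV - {p}. app (Xm q (- int j)) (app (M q A) (app (Cas p) c)))"
    unfolding sum.distrib[symmetric]
    by (intro sum.cong refl) (use Z_X_power_const_tensors[OF Mc] CM in auto)
  finally have "app (Z \<kappa> p) (app (G (- int j) A) c) - app (G (- int j) A) (app (Z \<kappa> p) c) =
      (\<Sum>q\<in>UNIV - {p}. \<Sum>k<j. app (Xm p (- int k) * Xm q (int k - int j)) (app (?P q) (app (M q A) c)))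
      - (\<Sum>q\<in>UNIV - {p}. \<Sum>k<j. app (Xm p (- int k) * Xm q (int k - int j)) (app (?P q) (app (M p A) c)))
      + (\<Sum>k<j. app (Xm p (- int k)) (app (ad_T p A (int k - int j)) c))
      + (app (Sc (- \<kappa> * of_nat j) * Xm p (- int j)) (app (M p A) c)
      + app (Xm p (- int j)) (app (Sc (of_nat j * (\<kappa> - of_nat CARD('m))) * M p A) c))"
    unfolding Zc[OF c] Z_X_power_same_const_tensors[OF Mc] CR CM' LvM
    by (simp add: G_def app_sum_endo sum.remove[of UNIV p])
  also have "app (Sc (- \<kappa> * of_nat j) * Xm p (- int j)) (app (M p A) c)
      + app (Xm p (- int j)) (app (Sc (of_nat j * (\<kappa> - of_nat CARD('m))) * M p A) c) =
      app (Sc (of_nat j * - of_nat CARD('m)) * Xm p (- int j) * M p A) c"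
  proof -
    have "Sc (- \<kappa> * of_nat j) * Xm p (- int j) * M p A + Xm p (- int j) * (Sc (of_nat j * (\<kappa> - of_nat CARD('m))) * M p A)
      = (Sc (of_nat j * - of_nat CARD('m)) * Xm p (- int j) * M p A :: ('n, 'm, 'v) wspace endo)"
    proof -
      have "Xm p (- int j) * (Sc (of_nat j * (\<kappa> - of_nat CARD('m))) * M p A) =
        (Sc (of_nat j * (\<kappa> - of_nat CARD('m))) * Xm p (- int j) * M p A :: ('n, 'm, 'v) wspace endo)"
        by (simp add: Sc_commute flip: mult.assoc)
      then show ?thesis
        by (simp flip: distrib_right Sc_simps(3)) (simp add: algebra_simps)
    qed
    from arg_cong[OF this, of "\<lambda>F. app F c"] show ?thesis by (simp only: app_endo)
  qed
  finally have L: "app (Z \<kappa> p) (app (G (- int j) A) c) - app (G (- int j) A) (app (Z \<kappa> p) c) =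
      (\<Sum>q\<in>UNIV - {p}. \<Sum>k<j. app (Xm p (- int k) * Xm q (int k - int j)) (app (?P q) (app (M q A - M p A) c)))
      + (\<Sum>k<j. app (Xm p (- int k)) (app (ad_T p A (int k - int j)) c))
      + app (Sc (of_nat j * - of_nat CARD('m)) * Xm p (- int j) * M p A) c"
    by (simp add: sum_subtractf)
  have "(\<Sum>k<j. app (Xm p (- int k)) (app (H p A (int k - int j)) c)) =
      (\<Sum>k<j. \<Sum>q\<in>UNIV - {p}. app (Xm p (- int k) * Xm q (int k - int j)) (app (?P q) (app (M q A - M p A) c)))
      + (\<Sum>k<j. app (Xm p (- int k)) (app (ad_T p A (int k - int j)) c))
      + (\<Sum>k<j. app (Sc (- of_nat CARD('m)) * Xm p (- int j) * M p A) c)"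
  proof -
    \<comment> \<open>The resulting power of \<open>x_p\<close> is independent of \<open>k\<close>,
      so the sum over \<open>k < j\<close> gives a factor \<open>j\<close>.\<close>
    have "Xm p (- int k) * (Sc (- of_nat CARD('m)) * Xm p (int k - int j) * M p A)
      = (Sc (- of_nat CARD('m)) * Xm p (- int j) * M p A :: ('n, 'm, 'v) wspace endo)" for k
    proof -
      have "Xm p (- int k) * (Sc (- of_nat CARD('m)) * Xm p (int k - int j) * M p A)
        = (Sc (- of_nat CARD('m)) * (Xm p (- int k) * Xm p (int k - int j)) * M p A :: ('n, 'm, 'v) wspace endo)"
        by (simp add: Sc_commute flip: mult.assoc)
      then show ?thesis by (simp add: X_mult)
    qed
    from arg_cong[OF this, of "\<lambda>F. app F c"]
    have *: "app (Xm p (- int k)) (app (Sc (- of_nat CARD('m)) * Xm p (int k - int j) * M p A) c)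
      = app (Sc (- of_nat CARD('m)) * Xm p (- int j) * M p A) c" for k
      by (simp only: app_endo)
    have "app (Xm p (- int k)) (app (H p A (int k - int j)) c) =
      (\<Sum>q\<in>UNIV - {p}. app (Xm p (- int k) * Xm q (int k - int j)) (app (?P q) (app (M q A - M p A) c)))
      + app (Xm p (- int k)) (app (ad_T p A (int k - int j)) c)
      + app (Sc (- of_nat CARD('m)) * Xm p (- int j) * M p A) c" for k
      unfolding H_eq[OF A] app_endo(3) app_add * by (simp add: app_sum_endo app_sum)
    then show ?thesis by (simp only: sum.distrib)
  qed
  also have "(\<Sum>k<j. app (Sc (- of_nat CARD('m)) * Xm p (- int j) * M p A) c) =
      app (Sc (of_nat j * - of_nat CARD('m)) * Xm p (- int j) * M p A) c"
  proof -
    have "(\<Sum>k<i. w) = app (Sc (of_nat i)) w" for i and w :: "('n, 'm, 'v) wspace"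
      by (induction i) (simp_all add: Sc_simps)
    then show ?thesis by (simp only: Sc_simps app_endo)
  qed
  also have "(\<Sum>k<j. \<Sum>q\<in>UNIV - {p}. app (Xm p (- int k) * Xm q (int k - int j)) (app (?P q) (app (M q A - M p A) c))) =
     (\<Sum>q\<in>UNIV - {p}. \<Sum>k<j. app (Xm p (- int k) * Xm q (int k - int j)) (app (?P q) (app (M q A - M p A) c)))"
    by (rule sum.swap)
  finally show ?thesis by (simp only: L)
qed

lemma Z_G:
  fixes p :: "'n::finite"
  assumes A: "trace A = 0"
    and level: "j \<noteq> 0 \<Longrightarrow> Lv = (Sc (\<kappa> - of_nat CARD('m)) :: ('n, 'm, 'v) wspace endo)"
  shows "Z \<kappa> p * G (- int j) A = G (- int j) A * Z \<kappa> p
    + (\<Sum>k<j. Xm p (- int k) * H p A (int k - int j) :: ('n, 'm, 'v) wspace endo)"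
proof -
  define K :: "('n, 'm, 'v) wspace endo"
    where "K = Z \<kappa> p * G (- int j) A - G (- int j) A * Z \<kappa> p - (\<Sum>k<j. Xm p (- int k) * H p A (int k - int j))"
  have 1: "(Z \<kappa> p * G (- int j) A - G (- int j) A * Z \<kappa> p) * Xm t 1 =
      Xm t 1 * (Z \<kappa> p * G (- int j) A - G (- int j) A * Z \<kappa> p)" for t
  proof -
    \<comment> \<open>The Jacobi identity: the commutator \<open>U\<close> of \<open>z_p\<close> and
      \<open>x_t\<close> is built from scalars, \<open>x_p\<close> and group elements, which all
      commute with \<open>G\<close>. As \<open>x_t\<close> commutes with \<open>G\<close> too, it
      commutes with the commutator of \<open>z_p\<close> and \<open>G\<close>.\<close>
    define U :: "('n, 'm, 'v) wspace endo" where "U = Z \<kappa> p * Xm t 1 - Xm t 1 * Z \<kappa> p"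
    have XS: "Xm p 1 * Sg \<sigma> * G i A = G i A * (Xm p 1 * Sg \<sigma>)" for i \<sigma>
      by (simp add: mult.assoc Sg_G) (simp add: G_Y flip: mult.assoc)
    have "U * G (- int j) A = G (- int j) A * U"
    proof (cases "t = p")
      case True
      have "U = Sc \<kappa> * Xm p 1 + (\<Sum>r\<in>UNIV - {p}. Xm p 1 * Sg (Perm.swap p r))"
        by (simp add: U_def True Z_X_same)
      moreover have "Sc \<kappa> * Xm p 1 * G (- int j) A = (G (- int j) A * (Sc \<kappa> * Xm p 1) :: ('n, 'm, 'v) wspace endo)"
        by (simp add: mult.assoc flip: G_Y) (simp add: G_Sc flip: mult.assoc)
      ultimately show ?thesis
        by (simp add: distrib_left distrib_right sum_distrib_left sum_distrib_right XS)
    next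
      case False
      then have "U = - (Xm p 1 * Sg (Perm.swap p t))" by (simp add: U_def Z_X_other)
      then show ?thesis by (simp add: XS)
    qed
    moreover have ZX: "Z \<kappa> p * Xm t 1 = Xm t 1 * Z \<kappa> p + U" by (simp add: U_def)
    ultimately show ?thesis
      by (simp add: left_diff_distrib right_diff_distrib mult.assoc G_Y ZX distrib_left)
        (simp add: G_Y ZX distrib_right flip: mult.assoc)
  qed
  have 2: "(\<Sum>k<j. Xm p (- int k) * H p A (int k - int j)) * Xm t 1 =
      Xm t 1 * (\<Sum>k<j. Xm p (- int k) * H p A (int k - int j) :: ('n, 'm, 'v) wspace endo)" for t
    unfolding sum_distrib_left sum_distrib_right
    by (intro sum.cong refl) (simp add: mult.assoc H_Y, simp add: Y_commute[of "xpow t 1"] flip: mult.assoc)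
  have "K = 0"
  proof (rule intertwiner_eq_0[of _ "\<lambda>p. p"])
    show "K * Xm t 1 = Xm t 1 * K" for t
      unfolding K_def by (simp only: left_diff_distrib[of "_ - _"] right_diff_distrib[of _ "_ - _"] 1 2)
    show "app K c = 0" if "c \<in> const_tensors" for c
      unfolding K_def using Z_G_const_tensors[OF that A level, where p = p and j = j]
      by (simp add: app_sum_endo)
  qed
  then show ?thesis by (simp add: K_def algebra_simps)
qed

end


section \<open>Representations of the trigonometric Cherednik algebra\<close>

lemma ring_of_type_algebra_ring: "ring (ring_of_type_algebra :: 'a::ring_1 ring)"
proof -
  have "\<exists>y. x + y = 0" for x :: 'a by (rule exI[of _ "- x"]) simp
  then show ?thesis
    unfolding ring_of_type_algebra_def
    by unfold_locales (auto simp: algebra_simps Units_def)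
qed

section \<open>Evaluation homomorphisms from the free algebra\<close>

definition word_value :: "('g \<Rightarrow> 'e::monoid_mult) \<Rightarrow> 'g free_monoid \<Rightarrow> 'e" where
  "word_value h u = (case u of Word l \<Rightarrow> prod_list (map h l))"

lemma word_value_simps [simp]:
  "word_value h 0 = 1" "word_value h (u + v) = word_value h u * word_value h v"
  "word_value h (Word [g]) = h g"
  by (simp_all add: word_value_def zero_free_monoid_def split: free_monoid.split)

text \<open>\<open>sc\<close> is required to commute with the images of the generators and not with
  the whole ring, because \<open>endo\<close> also contains additive maps that are not complex
  linear.\<close>

locale free_evaluation =
  fixes sc :: "complex \<Rightarrow> 'e::{ring, monoid_mult}" and h :: "'g \<Rightarrow> 'e"
  assumes sc_add: "sc (c + d) = sc c + sc d" and sc_mult: "sc (c * d) = sc c * sc d"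
    and sc_one: "sc 1 = 1" and sc_h: "h g * sc c = sc c * h g"
begin

definition ev :: "'g free_algebra \<Rightarrow> 'e" where
  "ev a = (\<Sum>u\<in>Poly_Mapping.keys a. sc (Poly_Mapping.lookup a u) * word_value h u)"

lemma sc_zero: "sc 0 = 0"
  using sc_add[of 0 0] by simp

lemma word_value_commute:
  assumes "\<And>g. F * h g = h g * F"
  shows "F * word_value h u = word_value h u * F"
proof (cases u)
  case (Word l)
  have "F * prod_list (map h l) = prod_list (map h l) * F"
    by (induction l) (simp, simp add: assms flip: mult.assoc, simp add: mult.assoc)
  then show ?thesis by (simp add: Word word_value_def)
qed

lemma ev_commute:
  assumes "\<And>g. F * h g = h g * F" "\<And>c. F * sc c = sc c * F"
  shows "F * ev a = ev a * F"
  unfolding ev_def sum_distrib_left sum_distrib_right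
  by (intro sum.cong refl)
    (simp add: mult.assoc word_value_commute[OF assms(1), symmetric], simp add: assms(2) flip: mult.assoc)

lemma sc_ev: "ev a * sc c = sc c * ev a"
proof -
  have "sc c * sc d = sc d * sc c" for d by (metis sc_mult mult.commute)
  then show ?thesis by (rule ev_commute[symmetric, OF sc_h[symmetric]])
qed

lemma ev_superset:
  "finite U \<Longrightarrow> Poly_Mapping.keys a \<subseteq> U \<Longrightarrow>
    ev a = (\<Sum>u\<in>U. sc (Poly_Mapping.lookup a u) * word_value h u)"
  unfolding ev_def by (intro sum.mono_neutral_left) (auto simp: in_keys_iff sc_zero)

lemma ev_add: "ev (a + b) = ev a + ev b"
proof -
  have "Poly_Mapping.keys (a + b) \<subseteq> Poly_Mapping.keys a \<union> Poly_Mapping.keys b" by (rule Poly_Mapping.keys_add)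
  then show ?thesis
    by (simp add: ev_superset[of "Poly_Mapping.keys a \<union> Poly_Mapping.keys b"] lookup_add sc_add
        distrib_right sum.distrib)
qed

lemma ev_zero: "ev 0 = 0"
  by (simp add: ev_def)

lemma ev_minus: "ev (a - b) = ev a - ev b"
  using ev_add[of "a - b" b] by simp

lemma ev_sum: "ev (\<Sum>i\<in>I. f i) = (\<Sum>i\<in>I. ev (f i))"
  by (induction I rule: infinite_finite_induct) (simp_all add: ev_zero ev_add)

lemma ev_single: "ev (Poly_Mapping.single u c) = sc c * word_value h u"
  by (subst ev_superset[of "{u}"]) (auto simp: lookup_single)

text \<open>By bilinearity this reduces to single words, where the second scalar is moved past the
  first word.\<close>

lemma ev_mult: "ev (a * b) = ev a * ev b"
proof -
  have single: "ev (Poly_Mapping.single u c * Poly_Mapping.single v d) = ev (Poly_Mapping.single u c) * ev (Poly_Mapping.single v d)"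
    for u v c d
  proof -
    have "word_value h u * sc d = sc d * word_value h u"
      by (rule word_value_commute[symmetric]) (simp add: sc_h)
    then have "sc c * word_value h u * (sc d * word_value h v) = sc c * sc d * (word_value h u * word_value h v)"
      by (metis mult.assoc)
    then show ?thesis by (simp add: mult_single ev_single sc_mult)
  qed
  have "ev (a * b) = ev ((\<Sum>u\<in>Poly_Mapping.keys a. Poly_Mapping.single u (Poly_Mapping.lookup a u)) *
      (\<Sum>v\<in>Poly_Mapping.keys b. Poly_Mapping.single v (Poly_Mapping.lookup b v)))"
    by (simp only: poly_mapping_sum_monomials[symmetric])
  also have "\<dots> = (\<Sum>u\<in>Poly_Mapping.keys a. \<Sum>v\<in>Poly_Mapping.keys b.
      ev (Poly_Mapping.single u (Poly_Mapping.lookup a u) * Poly_Mapping.single v (Poly_Mapping.lookup b v)))"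
    by (simp only: sum_distrib_left sum_distrib_right ev_sum, rule sum.swap)
  also have "\<dots> = ev a * ev b"
    by (simp only: single ev_single ev_def[of a] ev_def[of b] sum_distrib_left sum_distrib_right) (rule sum.swap)
  finally show ?thesis .
qed

lemma ev_gen: "ev (gen g) = h g" and ev_scalar: "ev (scalar c) = sc c" and ev_one: "ev 1 = 1"
  by (simp_all add: gen_def scalar_def ev_single sc_one flip: single_one)

text \<open>The generated ideal is the smallest one containing the relations, so it lies in this
  kernel once the relations do.\<close>

lemma ideal_kernel: "ideal {a. ev a = 0} ring_of_type_algebra"
proof (rule idealI)
  show "ring (ring_of_type_algebra :: 'g free_algebra ring)" by (rule ring_of_type_algebra_ring)
  interpret A: ring "ring_of_type_algebra :: 'g free_algebra ring" by (rule ring_of_type_algebra_ring)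
  show "subgroup {a. ev a = 0} (add_monoid (ring_of_type_algebra :: 'g free_algebra ring))"
  proof (rule A.add.subgroupI)
    show "\<ominus>\<^bsub>ring_of_type_algebra\<^esub> a \<in> {a. ev a = 0}" if "a \<in> {a. ev a = 0}" for a
    proof -
      have "\<ominus>\<^bsub>ring_of_type_algebra\<^esub> a = - a"
        by (rule A.minus_equality) (simp_all add: ring_of_type_algebra_def)
      then show ?thesis using that ev_minus[of 0 a] by (simp add: ev_zero)
    qed
  qed (auto simp: ring_of_type_algebra_def ev_add intro: exI[of _ 0] ev_zero)
qed (simp_all add: ring_of_type_algebra_def ev_mult)

end

section \<open>The operators assigned to the generators, and their effect on
  \<open>qW\<close>\<close>

context annihilated_module
begin

fun generator_op :: "complex \<Rightarrow> 'n::finite cherednik_generator \<Rightarrow> ('n, 'm, 'v) wspace endo" where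
  "generator_op \<kappa> (GenX p) = Xm p 1"
| "generator_op \<kappa> (GenXinv p) = Xm p (- 1)"
| "generator_op \<kappa> (GenS \<sigma>) = Sg \<sigma>"
| "generator_op \<kappa> (GenZ p) = Z \<kappa> p"

lemma generator_op_Sc: "generator_op \<kappa> g * Sc c = Sc c * generator_op \<kappa> g"
  by (cases g) (simp_all add: Sc_commute Z_Sc)

lemma free_evaluation_generator_op: "free_evaluation Sc (generator_op \<kappa>)"
  by unfold_locales (simp_all add: Sc_simps generator_op_Sc)

lemma tensor_map_mult:
  "tensor_map smul (\<lambda>f. xpow p j * f) id id = app (Xm p j)"
  by (simp add: fun_eq_iff tensor_map_eq_app Y_def)

lemma tensor_map_perm: "tensor_map smul (perm_laurent \<sigma>) (perm_tensor \<sigma>) id = app (Sg \<sigma>)"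
  by (simp add: fun_eq_iff tensor_map_eq_app Sg_def Pt_def)

text \<open>The matrix with \<open>1/m\<close> subtracted on the diagonal is the projection
  \<open>traceless\<close> of the matrix unit.\<close>

lemma casimir_term_eq: "casimir_term smul rho p i w = app (Xm p (- int i) * T p (int i)) w"
proof -
  have "tensor_map smul (\<lambda>f. xpow p (- int i) * f) (factor_op p (matrix_unit a b))
      (rho (loop (matrix_unit b a - mat (if a = b then 1 / of_nat CARD('m) else 0)) (int i))) w =
      app (Xm p (- int i) * (M p (matrix_unit a b) * R (matrix_unit b a) (int i))) w" for a b
  proof -
    have "matrix_unit b a - mat (if a = b then 1 / of_nat CARD('m) else 0) = traceless (matrix_unit b a)"
      by (simp add: traceless_def trace_matrix_unit)
    then have "rho (loop (matrix_unit b a - mat (if a = b then 1 / of_nat CARD('m) else 0)) (int i)) = rv (matrix_unit b a) (int i)"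
      by (simp add: rv_def)
    then show ?thesis by (simp add: tensor_map_eq_app Y_def M_def R_def)
  qed
  then show ?thesis
    by (simp add: casimir_term_def T_def sum_distrib_left app_sum_endo app_sum)
qed

lemma z_operator_eq:
  fixes p :: "'n::finite"
  shows "z_operator \<kappa> smul rho p = app (Z \<kappa> p)"
proof
  fix w :: "('n, 'm, 'v) wspace"
  have E: "tensor_map smul (\<lambda>f. laurent_scale \<kappa> (xpow p 1 * laurent_partial p f)) id id w = app (Sc \<kappa> * Eu p) w"
  proof -
    interpret L: vector_space laurent_scale by (rule vector_space_laurent)
    have lin: "laurent_linear (\<lambda>f. laurent_scale \<kappa> (euler_op p f))"
      by (simp add: Vector_Spaces.linear_iff vector_space_laurent euler_op_add euler_op_scale
          L.scale_right_distrib mult.commute)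
    moreover have "opL (\<lambda>f. laurent_scale \<kappa> (euler_op p f)) = (Sc \<kappa> * Eu p :: ('n, 'm, 'v) wspace endo)"
      by (rule endo_eq_pureI) (simp add: app_op_pure lin pure_smul)
    ultimately show ?thesis
      by (simp add: tensor_map_eq_app flip: euler_op_def del: app_endo(6))
  qed
  have "(\<Sum>r\<in>UNIV - {p}. tensor_map smul (\<lambda>f. xpow p 1 * divided_difference p r f) (perm_tensor (Perm.swap p r)) id w) =
      (\<Sum>r\<in>UNIV - {p}. app (B p r) w)"
  proof (rule sum.cong)
    fix r assume "r \<in> UNIV - {p}"
    moreover have "(\<lambda>f. xpow p 1 * divided_difference p r f) = demazure p r"
      by (simp add: demazure_def fun_eq_iff)
    ultimately show "tensor_map smul (\<lambda>f. xpow p 1 * divided_difference p r f) (perm_tensor (Perm.swap p r)) id w = app (B p r) w"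
      by (simp add: tensor_map_eq_app Dm_def Pt_def)
  qed simp
  then show "z_operator \<kappa> smul rho p w = app (Z \<kappa> p) w"
    by (simp add: z_operator_def E Z_def app_sum_endo casimir_term_eq app_Cas)
qed

lemma rho_sum:
  "(\<And>i. i \<in> I \<Longrightarrow> trace (F i) = 0) \<Longrightarrow> rho (\<Sum>i\<in>I. loop (F i) (d i)) v = (\<Sum>i\<in>I. rho (loop (F i) (d i)) v)"
proof -
  have z: "(0 :: 'm affine_gl) \<in> affine_sl" by (simp add: affine_sl_def)
  have 0: "rho 0 v = 0" using rho_add[OF z z, of v] by simp
  show "(\<And>i. i \<in> I \<Longrightarrow> trace (F i) = 0) \<Longrightarrow> rho (\<Sum>i\<in>I. loop (F i) (d i)) v = (\<Sum>i\<in>I. rho (loop (F i) (d i)) v)"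
  proof (induction I rule: infinite_finite_induct)
    case (insert i I)
    have "(\<Sum>i\<in>J. loop (F i) (d i)) \<in> affine_sl" if "\<And>i. i \<in> J \<Longrightarrow> trace (F i) = 0" for J
      using that
      by (induction J rule: infinite_finite_induct)
        (simp_all add: z, simp add: affine_sl_def loop_def lookup_add lookup_single when_def trace_add_matrix)
    then show ?case using insert by (simp add: rho_add)
  qed (simp_all add: 0)
qed

text \<open>\<open>P\<close> is split into homogeneous components. Each has trace zero, as required
  to use additivity of \<open>rho\<close>.\<close>

lemma affine_action_eq:
  fixes w :: "('n::finite, 'm, 'v) wspace"
  assumes "P \<in> loop_sl S"
  shows "affine_action smul rho P w = (\<Sum>j\<in>Poly_Mapping.keys (fst P). app (G j (Poly_Mapping.lookup (fst P) j)) w)"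
proof -
  let ?A = "Poly_Mapping.lookup (fst P)"
  have tr: "trace (?A j) = 0" for j using assms by (simp add: loop_sl_def affine_sl_def)
  have "P = (\<Sum>j\<in>Poly_Mapping.keys (fst P). loop (?A j) j)"
  proof (rule prod_eqI)
    show "fst P = fst (\<Sum>j\<in>Poly_Mapping.keys (fst P). loop (?A j) j)"
      by (simp add: fst_sum loop_def flip: poly_mapping_sum_monomials)
    show "snd P = snd (\<Sum>j\<in>Poly_Mapping.keys (fst P). loop (?A j) j)"
      using assms by (simp add: snd_sum loop_def loop_sl_def)
  qed
  then have rP: "rho P v = (\<Sum>j\<in>Poly_Mapping.keys (fst P). rv (?A j) j v)" for v
    using rho_sum[of "Poly_Mapping.keys (fst P)" ?A "\<lambda>j. j" v] by (simp add: tr rv_def traceless_id)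
  have "P \<in> affine_sl" using assms by (simp add: loop_sl_def)
  then have linP: "coeff_linear (rho P)" by (rule linear_rho)
  have "tensor_map smul id id (rho P) w = app (opV (rho P)) w"
    by (simp add: tensor_map_eq_app linP)
  also have "opV (rho P) = (\<Sum>j\<in>Poly_Mapping.keys (fst P). (R (?A j) j :: ('n, 'm, 'v) wspace endo))"
  proof (rule endo_eq_pureI)
    fix f :: "'n laurent" and u :: "('n, 'm) tpower" and v
    have "pure f u (\<Sum>j\<in>J. H j) = (\<Sum>j\<in>J. pure f u (H j))" for J :: "int set" and H
      by (induction J rule: infinite_finite_induct) (simp_all add: pure_add)
    then show "app (opV (rho P)) (pure f u v) = app (\<Sum>j\<in>Poly_Mapping.keys (fst P). R (?A j) j) (pure f u v)"
      by (simp add: app_op_pure linP rP app_sum_endo)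
  qed
  finally have "tensor_map smul id id (rho P) w = (\<Sum>j\<in>Poly_Mapping.keys (fst P). app (R (?A j) j) w)"
    by (simp only: app_sum_endo)
  then show ?thesis
    by (simp only: affine_action_def) (simp add: G_def app_sum_endo sum.distrib tensor_map_eq_app Y_def M_def)
qed

lemma M_zero: "M p (0 :: complex ^ 'm ^ 'm) = 0"
  using M_simps(4)[of p 0 0] by simp

lemma R_zero: "R 0 j = (0 :: ('n::finite, 'm, 'v) wspace endo)"
proof -
  have "R (0 - 0) j = R 0 j - (R 0 j :: ('n, 'm, 'v) wspace endo)" by (rule R_diff)
  then show "R 0 j = (0 :: ('n, 'm, 'v) wspace endo)" by simp
qed

lemma affine_action_loop:
  fixes w :: "('n::finite, 'm, 'v) wspace"
  assumes "trace A = 0"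
  shows "affine_action smul rho (loop A j) w = app (G j A) w"
proof (cases "A = 0")
  case True
  have "G j 0 = (0 :: ('n, 'm, 'v) wspace endo)"
    by (simp add: G_def M_zero R_zero)
  then show ?thesis
    using True by (subst affine_action_eq[of _ UNIV]) (simp_all add: loop_sl_def loop_def affine_sl_def)
next
  case False
  then show ?thesis
    using assms
    by (subst affine_action_eq[of _ UNIV]) (auto simp: loop_sl_def, simp_all add: loop_def)
qed

text \<open>For \<open>j = 0\<close> the sum in \<open>Z_G\<close> is empty and its level condition
  is vacuous; this yields (ii).\<close>

lemma generator_op_G0:
  assumes "trace A = 0"
  shows "generator_op \<kappa> g * G 0 A = G 0 A * generator_op \<kappa> g"
  using Z_G[OF assms, of 0] by (cases g) (simp_all add: G_Y Sg_G)

lemma qW_generator_op: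
  fixes w :: "('n::finite, 'm, 'v) wspace"
  assumes level: "\<And>v. rho central v = smul (\<kappa> - of_nat CARD('m)) v"
    and w: "w \<in> qW smul rho"
  shows "app (generator_op \<kappa> g) w \<in> qW smul rho"
proof -
  interpret W: vector_space "wscale smul :: complex \<Rightarrow> ('n, 'm, 'v) wspace \<Rightarrow> _"
    by (rule vector_space_wscale[OF vector_space_axioms])
  let ?Q = "qW smul rho :: ('n, 'm, 'v) wspace set"
  have sub: "W.subspace ?Q" unfolding qW_def by (rule W.subspace_span)
  have GQ: "app (G j A) x \<in> ?Q" if "j < 0" "trace A = 0" for j A and x :: "('n, 'm, 'v) wspace"
  proof -
    have "loop A j \<in> loop_sl {..-1}" using that by (auto simp: loop_sl_def, auto simp: loop_def split: if_splits)
    then show ?thesis unfolding qW_def affine_action_loop[OF that(2), symmetric] by (intro W.span_base) blast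
  qed
  have Lv: "Lv = (Sc (\<kappa> - of_nat CARD('m)) :: ('n, 'm, 'v) wspace endo)"
    by (rule endo_eq_pureI) (simp add: level)
  have step: "app (generator_op \<kappa> g) (app (G j A) x) \<in> ?Q" if "j < 0" "trace A = 0" for j A and x :: "('n, 'm, 'v) wspace"
  proof (cases g)
    case (GenZ p)
    define k where "k = nat (- j)"
    have j: "j = - int k" using that(1) by (simp add: k_def)
    \<comment> \<open>The power of \<open>x_p\<close> moves inside past \<open>G\<close>, leaving
      elements of negative degree \<open>i - k\<close> as outermost operators; their matrices are
      commutators and so have trace zero.\<close>
    have HQ: "app (Xm p (- int i)) (app (H p A (int i - int k)) x) \<in> ?Q" if "i < k" for i
    proof -
      let ?C = "\<lambda>a b. matrix_unit b a ** A - A ** matrix_unit b a"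
      have "app (Xm p (- int i)) (app (H p A (int i - int k)) x) =
          (\<Sum>a\<in>UNIV. \<Sum>b\<in>UNIV. app (G (int i - int k) (?C a b)) (app (Xm p (- int i)) (app (M p (matrix_unit a b)) x)))"
        by (simp add: H_def app_sum_endo app_sum app_commute[OF G_Y])
      also have "\<dots> \<in> ?Q"
        using that by (intro W.subspace_sum[OF sub] GQ) (simp_all add: trace_diff_matrix trace_mult_commute)
      finally show ?thesis .
    qed
    have "app (Z \<kappa> p) (app (G j A) x) = app (G j A) (app (Z \<kappa> p) x) +
        (\<Sum>i<k. app (Xm p (- int i)) (app (H p A (int i - int k)) x))"
      using arg_cong[OF Z_G[OF that(2) Lv, where j = k and p = p], of "\<lambda>F. app F x"] by (simp add: j app_sum_endo)
    also have "\<dots> \<in> ?Q"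
      by (intro W.subspace_add[OF sub] W.subspace_sum[OF sub] GQ HQ) (use that in auto)
    finally show ?thesis by (simp add: GenZ)
  qed (use that in \<open>simp_all add: GQ app_commute[OF G_Y[symmetric]] app_commute[OF Sg_G]\<close>)
  \<comment> \<open>The vectors mapped into \<open>qW\<close> form a subspace, so only the spanning
    vectors matter, and these are sums of values of \<open>G\<close> in negative degrees.\<close>
  have "?Q \<subseteq> {x. app (generator_op \<kappa> g) x \<in> ?Q}"
    unfolding qW_def
  proof (rule W.span_minimal)
    show "W.subspace {x. app (generator_op \<kappa> g) x \<in> W.span {affine_action smul rho P w |P w. P \<in> loop_sl {..-1}}}"
      using app_commute[OF generator_op_Sc[of \<kappa> g]] sub
      by (auto simp: W.subspace_def qW_def app_Sc)
    show "{affine_action smul rho P w |P w. P \<in> loop_sl {..-1}} \<subseteq>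
        {x. app (generator_op \<kappa> g) x \<in> W.span {affine_action smul rho P w |P w. P \<in> loop_sl {..-1}}}"
    proof clarify
      fix P :: "'m affine_gl" and x :: "('n, 'm, 'v) wspace"
      assume P: "P \<in> loop_sl {..-1}"
      have "app (generator_op \<kappa> g) (affine_action smul rho P x) \<in> ?Q"
        unfolding affine_action_eq[OF P] app_sum
        by (intro W.subspace_sum[OF sub] step) (use P in \<open>auto simp: loop_sl_def affine_sl_def\<close>)
      then show "app (generator_op \<kappa> g) (affine_action smul rho P x) \<in> W.span {affine_action smul rho P w |P w. P \<in> loop_sl {..-1}}"
        by (simp add: qW_def)
    qed
  qed
  then show ?thesis using w by blast
qed

lemma relations_in_kernel:
  "cherednik_relations \<kappa> \<subseteq> {a. free_evaluation.ev Sc (generator_op \<kappa> :: 'n::finite cherednik_generator \<Rightarrow> ('n, 'm, 'v) wspace endo) a = 0}"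
proof
  interpret E: free_evaluation Sc "generator_op \<kappa> :: 'n cherednik_generator \<Rightarrow> ('n, 'm, 'v) wspace endo"
    by (rule free_evaluation_generator_op)
  have SX: "Sg \<sigma> * Xm p j * Sg (inverse \<sigma>) = (Xm (Perm.apply \<sigma> p) j :: ('n, 'm, 'v) wspace endo)" for \<sigma> p j
    by (simp add: Sg_X mult.assoc Sg_mult Sg_one)
  have SZ: "Sg \<sigma> * Z \<kappa> p * Sg (inverse \<sigma>) = (Z \<kappa> (Perm.apply \<sigma> p) :: ('n, 'm, 'v) wspace endo)" for \<sigma> p
    by (simp add: Sg_Z mult.assoc Sg_mult Sg_one)
  note ev = E.ev_minus E.ev_add E.ev_mult E.ev_gen E.ev_one E.ev_sum E.ev_scalar
  fix a :: "'n cherednik_generator free_algebra"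
  assume "a \<in> cherednik_relations \<kappa>"
  then have "E.ev a = 0"
  proof (induction rule: cherednik_relations.induct)
    case (9 p q)
    \<comment> \<open>This relation contains a unary minus, which the rules in \<open>ev\<close> do
      not cover.\<close>
    have "E.ev (- b) = - E.ev b" for b
      using E.ev_minus[of 0 b] by (simp add: E.ev_zero)
    then show ?case using 9 by (simp add: ev Z_X_other)
  qed (simp_all add: ev X_mult Y_simps Y_commute Sg_one Sg_mult SX SZ Z_commutator Z_X_same)
  then show "a \<in> {a. E.ev a = 0}" by simp
qed

end

section \<open>Passage to the quotient algebra\<close>

theorem corollary2p4:
  fixes smul :: "complex \<Rightarrow> 'v::ab_group_add \<Rightarrow> 'v"
    and rho :: "'m::finite affine_gl \<Rightarrow> 'v \<Rightarrow> 'v"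
    and \<kappa> :: complex
  assumes "affine_sl_module smul rho"
    and "\<And>v. \<exists>i. \<forall>\<xi>\<in>loop_sl {i..}. rho \<xi> v = 0"
  shows "(\<forall>(p::'n::finite) w. finite {i. casimir_term smul rho p i w \<noteq> 0}) \<and>
    (\<exists>act :: 'n cherednik_generator free_algebra set \<Rightarrow> ('n, 'm, 'v) wspace \<Rightarrow> ('n, 'm, 'v) wspace.
       cherednik_action \<kappa> (wscale smul) act \<and>
       (\<forall>p. act (cherednik_class \<kappa> (gen (GenX p))) =
          tensor_map smul (\<lambda>f. xpow p 1 * f) id id) \<and>
       (\<forall>p. act (cherednik_class \<kappa> (gen (GenXinv p))) =
          tensor_map smul (\<lambda>f. xpow p (-1) * f) id id) \<and>
       (\<forall>\<sigma>. act (cherednik_class \<kappa> (gen (GenS \<sigma>))) =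
          tensor_map smul (perm_laurent \<sigma>) (perm_tensor \<sigma>) id) \<and>
       (\<forall>p. act (cherednik_class \<kappa> (gen (GenZ p))) = z_operator \<kappa> smul rho p) \<and>
       (\<forall>a\<in>carrier (cherednik \<kappa>). \<forall>P\<in>loop_sl {0}. \<forall>w.
          act a (affine_action smul rho P w) = affine_action smul rho P (act a w)) \<and>
       ((\<forall>v. rho central v = smul (\<kappa> - of_nat CARD('m)) v) \<longrightarrow>
          (\<forall>a\<in>carrier (cherednik \<kappa>). \<forall>w\<in>qW smul rho. act a w \<in> qW smul rho)))"
proof -
  interpret annihilated_module smul rho
    using assms by (intro annihilated_module.intro tensor_space.intro annihilated_module_axioms.intro)
      (auto simp: affine_sl_module_def)
  interpret E: free_evaluation Sc "generator_op \<kappa> :: 'n cherednik_generator \<Rightarrow> ('n, 'm, 'v) wspace endo"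
    by (rule free_evaluation_generator_op)
  let ?A = "ring_of_type_algebra :: 'n cherednik_generator free_algebra ring"
  let ?C = "cherednik \<kappa> :: 'n cherednik_generator free_algebra set ring"
  let ?cl = "cherednik_class \<kappa> :: 'n cherednik_generator free_algebra \<Rightarrow> _"
  interpret A: ring ?A by (rule ring_of_type_algebra_ring)
  have A_simps [simp]: "carrier ?A = UNIV" "\<one>\<^bsub>?A\<^esub> = 1" "a \<oplus>\<^bsub>?A\<^esub> b = a + b" "a \<otimes>\<^bsub>?A\<^esub> b = a * b" for a b
    by (simp_all add: ring_of_type_algebra_def)
  interpret I: ideal "cherednik_ideal \<kappa>" ?A
    unfolding cherednik_ideal_def by (rule A.genideal_ideal) simp
  have ker: "E.ev a = 0" if "a \<in> cherednik_ideal \<kappa>" for a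
    using A.genideal_minimal[OF E.ideal_kernel relations_in_kernel] that
    by (auto simp: cherednik_ideal_def)
  \<comment> \<open>Elements of the quotient are cosets. A representative is chosen, and by
    \<open>ker\<close> the evaluation does not depend on the choice.\<close>
  define act :: "'n cherednik_generator free_algebra set \<Rightarrow> ('n, 'm, 'v) wspace \<Rightarrow> ('n, 'm, 'v) wspace"
    where "act c = app (E.ev (SOME a. a \<in> c))" for c
  have act: "act (?cl a) = app (E.ev a)" for a
  proof -
    have cl: "?cl a = {i + a | i. i \<in> cherednik_ideal \<kappa>}"
      by (auto simp: cherednik_class_def a_r_coset_def')
    have "(SOME b. b \<in> ?cl a) \<in> ?cl a"
      by (rule someI[of _ "0 + a"]) (use I.zero_closed in \<open>auto simp: cl ring_of_type_algebra_def\<close>)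
    then obtain i where "i \<in> cherednik_ideal \<kappa>" "(SOME b. b \<in> ?cl a) = i + a"
      unfolding cl by blast
    then show ?thesis by (simp add: act_def E.ev_add ker)
  qed
  have carrier: "carrier ?C = range ?cl"
    by (auto simp: cherednik_def cherednik_class_def FactRing_def A_RCOSETS_def')
  have add: "?cl a \<oplus>\<^bsub>?C\<^esub> ?cl b = ?cl (a + b)" and mult: "?cl a \<otimes>\<^bsub>?C\<^esub> ?cl b = ?cl (a * b)"
    and one: "\<one>\<^bsub>?C\<^esub> = ?cl 1" for a b
    by (simp_all add: cherednik_def cherednik_class_def FactRing_def I.a_rcos_sum I.rcoset_mult_add)
  have act_scale: "app (E.ev a) (wscale smul c w) = wscale smul c (app (E.ev a) w)" for a c w
    using app_commute[OF E.sc_ev[of a c], of w] by (simp add: app_Sc)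
  have "cherednik_action \<kappa> (wscale smul) act"
    unfolding cherednik_action_def carrier
  proof (intro conjI)
    show "\<forall>a\<in>range ?cl. Vector_Spaces.linear (wscale smul) (wscale smul) (act a)"
      by (simp add: act act_scale Vector_Spaces.linear_iff vector_space_wscale[OF vector_space_axioms])
    show "act \<one>\<^bsub>?C\<^esub> = id"
      by (simp add: one act E.ev_one fun_eq_iff)
    show "\<forall>a\<in>range ?cl. \<forall>b\<in>range ?cl. \<forall>w. act (a \<oplus>\<^bsub>?C\<^esub> b) w = act a w + act b w \<and>
        act (a \<otimes>\<^bsub>?C\<^esub> b) w = act a (act b w)"
      by (simp add: act add mult E.ev_add E.ev_mult)
    show "\<forall>c. \<forall>a\<in>range ?cl. \<forall>w. act (?cl (scalar c) \<otimes>\<^bsub>?C\<^esub> a) w = wscale smul c (act a w)"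
      by (simp add: act mult E.ev_mult E.ev_scalar app_Sc)
  qed
  moreover have "act a (affine_action smul rho P w) = affine_action smul rho P (act a w)"
    if "a \<in> carrier ?C" "P \<in> loop_sl {0}" for a P w
  proof -
    from that(1) obtain b where b: "a = ?cl b" unfolding carrier by (rule rangeE)
    have "app (E.ev b) (app (G j (Poly_Mapping.lookup (fst P) j)) w) =
        app (G j (Poly_Mapping.lookup (fst P) j)) (app (E.ev b) w)" if "j \<in> Poly_Mapping.keys (fst P)" for j
    proof -
      have "j = 0" "trace (Poly_Mapping.lookup (fst P) j) = 0"
        using that \<open>P \<in> loop_sl {0}\<close> by (auto simp: loop_sl_def affine_sl_def)
      then show ?thesis
        \<comment> \<open>Commuting with the generators and the scalars passes to every evaluated
          element of the free algebra.\<close>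
        by (intro app_commute E.ev_commute[symmetric]) (simp_all add: generator_op_G0 G_Sc)
    qed
    then show ?thesis by (simp add: b act affine_action_eq[OF that(2)] app_sum)
  qed
  moreover have "act a w \<in> qW smul rho"
    if level: "\<And>v. rho central v = smul (\<kappa> - of_nat CARD('m)) v" and "a \<in> carrier ?C" "w \<in> qW smul rho" for a w
  proof -
    interpret W: vector_space "wscale smul :: complex \<Rightarrow> ('n, 'm, 'v) wspace \<Rightarrow> _"
      by (rule vector_space_wscale[OF vector_space_axioms])
    have sub: "W.subspace (qW smul rho)" unfolding qW_def by (rule W.subspace_span)
    from that(2) obtain b where b: "a = ?cl b" unfolding carrier by (rule rangeE)
    \<comment> \<open>Stability under single generators extends to words by induction, and then to
      linear combinations of words.\<close>
    have "app (prod_list (map (generator_op \<kappa>) l)) w \<in> qW smul rho" for l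
      by (induction l) (simp_all add: that(3) qW_generator_op[OF level])
    then have "app (word_value (generator_op \<kappa>) u) w \<in> qW smul rho" for u
      by (cases u) (simp add: word_value_def)
    then show ?thesis
      unfolding b act E.ev_def app_sum_endo
      by (intro W.subspace_sum[OF sub]) (simp add: app_Sc W.subspace_scale[OF sub])
  qed
  ultimately show ?thesis
    by (intro conjI exI[of _ act] allI ballI impI)
      (auto simp: act E.ev_gen tensor_map_mult tensor_map_perm z_operator_eq casimir_term_eq finite_Cas
        simp del: app_endo)
qed

end
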